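(* Let $\mathcal{H}$ be a separable real Hilbert space and let $T\colon \mathcal{H}\to\mathcal{H}$ be a positive self-adjoint compact operator whose eigenvalues $\{\lambda_n\}_{n\in\mathbb{N}^*}$, listed in non-increasing order, are positive and satisfy \[ \lambda_n = \frac{c_1}{n^{\alpha_1}} + \frac{c_2}{n^{\alpha_2}} + o_{n\to\infty}\!\left(\frac{1}{n^{\alpha_2}}\right), \] where $c_1>0$, $c_2\in\mathbb{R}$, $\alpha_1,\alpha_2>0$ are such that either $\alpha_1<\alpha_2<\alpha_1+1/2$, or $\alpha_1=\alpha_2$ and $c_2=0$. Then \[ H(\varepsilon;T) = \frac{\alpha_1 c_1^{1/\alpha_1}}{\ln 2}\,\varepsilon^{-1/\alpha_1} + \frac{c_2\, c_1^{(1-\alpha_2)/\alpha_1}}{\ln(2)(\alpha_1-\alpha_2+1)}\,\varepsilon^{-\frac{\alpha_1-\alpha_2+1}{\alpha_1}} + o_{\varepsilon\to 0}\!\left(\varepsilon^{-\frac{\alpha_1-\alpha_2+1}{\alpha_1}}\right), \] and equivalently \[ \varepsilon_m(T) = c_1\left(\frac{\alpha_1}{\ln 2}\right)^{\alpha_1} m^{-\alpha_1} + \frac{c_2}{\alpha_1-\alpha_2+1}\left(\frac{\alpha_1}{\ln 2}\right)^{\alpha_2} m^{-\alpha_2} + o_{m\to\infty}\!\left(m^{-\alpha_2}\right). \]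
   Context: $\mathbb{N}^*$ denotes the positive integers; $\log$ is base $2$, $\ln$ is the natural logarithm. For a compact set $K$ in a metric space $(X,d)$, $N(\varepsilon;K,d)$ is the minimal cardinality of a set $\{x_1,\dots,x_N\}\subseteq X$ such that every $x\in K$ has $d(x,x_i)\le\varepsilon$ for some $i$, and the metric entropy is $H(\varepsilon;K,d)=\log N(\varepsilon;K,d)$. For a compact linear operator $T$ on a Hilbert space $\mathcal{H}$ with closed unit ball $\mathcal{B}$, the entropy of $T$ is $H(\varepsilon;T)=H(\varepsilon;\overline{T(\mathcal{B})},\|\cdot\|_{\mathcal{H}})$ and, for $m\in\mathbb{N}^*$, the $m$-th entropy number is $\varepsilon_m(T)=\inf\{\varepsilon>0: H(\varepsilon;T)\le m\}$. $f=o_{x\to\ell}(g)$ means $f(x)/g(x)\to 0$. *)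

theory Defs
  imports "HOL-Analysis.Analysis" "HOL-Library.Landau_Symbols"
begin

definition covering_number :: "real \<Rightarrow> 'a::metric_space set \<Rightarrow> nat" where
  "covering_number eps K =
     (LEAST N. \<exists>C. finite C \<and> card C = N \<and> K \<subseteq> (\<Union>c\<in>C. cball c eps))"

definition metric_entropy :: "real \<Rightarrow> 'a::metric_space set \<Rightarrow> real" where
  "metric_entropy eps K = log 2 (real (covering_number eps K))"

definition op_entropy :: "real \<Rightarrow> ('a::real_normed_vector \<Rightarrow> 'a) \<Rightarrow> real" where
  "op_entropy eps T = metric_entropy eps (closure (T ` cball 0 1))"

definition entropy_number :: "nat \<Rightarrow> ('a::real_normed_vector \<Rightarrow> 'a) \<Rightarrow> real" where
  "entropy_number m T = Inf {eps. eps > 0 \<and> op_entropy eps T \<le> real m}"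

definition separable_space :: "'a::topological_space itself \<Rightarrow> bool" where
  "separable_space _ \<longleftrightarrow> (\<exists>D::'a set. countable D \<and> closure D = UNIV)"

definition compact_operator :: "('a::real_normed_vector \<Rightarrow> 'a) \<Rightarrow> bool" where
  "compact_operator T \<longleftrightarrow> bounded_linear T \<and> compact (closure (T ` cball 0 1))"

definition eigenspace :: "('a::real_vector \<Rightarrow> 'a) \<Rightarrow> real \<Rightarrow> 'a set" where
  "eigenspace T \<mu> = {x. T x = \<mu> *\<^sub>R x}"

definition is_eigenvalue :: "('a::real_vector \<Rightarrow> 'a) \<Rightarrow> real \<Rightarrow> bool" where
  "is_eigenvalue T \<mu> \<longleftrightarrow> (\<exists>x. x \<noteq> 0 \<and> T x = \<mu> *\<^sub>R x)"

text \<open>\<open>lam\<close> (used on indices n \<ge> 1) lists all eigenvalues of T in non-increasing order,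
  each repeated according to its (finite) multiplicity = dimension of the eigenspace.\<close>
definition eigenvalue_listing :: "('a::real_vector \<Rightarrow> 'a) \<Rightarrow> (nat \<Rightarrow> real) \<Rightarrow> bool" where
  "eigenvalue_listing T lam \<longleftrightarrow>
     (\<forall>n\<ge>1. lam (Suc n) \<le> lam n) \<and>
     (\<forall>n\<ge>1. is_eigenvalue T (lam n)) \<and>
     (\<forall>\<mu>. is_eigenvalue T \<mu> \<longrightarrow>
        (\<exists>B. finite B \<and> B \<subseteq> eigenspace T \<mu> \<and> independent B \<and>
             span B = eigenspace T \<mu> \<and> card B = card {n. 1 \<le> n \<and> lam n = \<mu>}))"

end

theory Submission
  imports Defs "HOL-Real_Asymp.Real_Asymp"
begin

text \<open>
  In an orthonormal eigenbasis the image of the unit ball is an ellipsoid with semi-axes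
  \<open>\<lambda>\<^sub>n\<close>, and its entropy at scale \<open>\<epsilon>\<close> is \<open>\<Sum>\<^sub>n log\<^sup>+ (\<lambda>\<^sub>n / \<epsilon>)\<close> up to an error
  \<open>O (sqrt d log d)\<close>, where \<open>d \<sim> \<epsilon> powr (-1 / \<alpha>\<^sub>1)\<close> is the number of axes longer than \<open>\<epsilon>\<close>.
  The lower bound compares volumes of finite-dimensional sections. For the upper bound, the
  coordinates are cut into about \<open>sqrt d\<close> blocks of length about \<open>sqrt d\<close>, in which the ellipsoid
  is replaced by a ball; an \<open>n\<close>-dimensional ball of radius \<open>R\<close> is covered by
  \<open>poly(n) (R / \<epsilon>) powr n\<close> balls of radius \<open>\<epsilon>\<close>, whose centres are chosen greedily from a ball of
  radius about \<open>sqrt (R\<^sup>2 - \<epsilon>\<^sup>2)\<close>. Since \<open>\<alpha>\<^sub>2 - \<alpha>\<^sub>1 < 1 / 2\<close>, the error is negligible against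
  \<open>d powr (1 - (\<alpha>\<^sub>2 - \<alpha>\<^sub>1))\<close>, and the sum is expanded with \<open>d! \<approx> (d / e) ^ d\<close> and
  the Stolz-Cesaro theorem. The entropy numbers follow by inverting the expansion.
\<close>

section \<open>Eigenbasis of a positive compact operator\<close>

text \<open>A constant factor per coordinate is already too much: covering a ball by the elementary
  bound \<open>(1 + 2 * R / eps) ^ n\<close> loses a multiple of \<open>d\<close> in the logarithm
  and spoils even the leading coefficient. This forces a ball covering whose loss is polynomial in
  the dimension. Blocks of length \<open>q\<close> cost about \<open>q\<close> times the logarithm
  of the largest axis ratio, and each of the \<open>d / q\<close> blocks costs a further logarithm;
  \<open>q\<close> near \<open>sqrt d\<close> balances the two. All estimates use the variable
  \<open>x\<close> with \<open>eps = c1 * x powr - \<alpha>1\<close>, to first order the number of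
  long axes. The summands split into \<open>\<alpha>1 * ln (x / n)\<close> and a correction of order
  \<open>n powr (\<alpha>1 - \<alpha>2)\<close>. The sum of \<open>ln (x / n)\<close> is stationary
  in the number of summands near \<open>x\<close>: it is at most \<open>x\<close> for every
  truncation, and at least \<open>x - O (ln x)\<close> at the integer part of \<open>x\<close>. So
  the number \<open>d\<close> of axes is needed only to first order, \<open>d / x\<close> tending to
  1, and both expansions are read off from one limit in \<open>x\<close>.\<close>

lemma finite_orthonormal_basis:
  fixes B :: "'a::real_inner set"
  assumes "finite B" "independent B"
  obtains C where "finite C" "card C = card B" "span C = span B"
    "pairwise orthogonal C" "\<And>x. x \<in> C \<Longrightarrow> norm x = 1"
proof -
  obtain C where C: "finite C" "card C \<le> card B" "span C = span B" "pairwise orthogonal C"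
    using basis_orthogonal[OF assms(1)] by blast
  \<comment> \<open>Minimality does double duty: it keeps 0 out of the orthogonal set
    \<open>C\<close>, and it shows that normalising cannot identify two vectors of
    \<open>C\<close>.\<close>
  have min_card: "card B \<le> card C'" if "finite C'" "span C' = span B" for C'
    using independent_span_bound[OF that(1) assms(2)] that(2) span_superset[of B] by auto
  have "0 \<notin> C"
  proof
    assume "0 \<in> C"
    then have "span (C - {0}) = span B"
      using C(3) by (simp add: span_delete_0)
    then have "card B \<le> card (C - {0})" using min_card C(1) by blast
    moreover have "card (C - {0}) < card C" using \<open>0 \<in> C\<close> C(1) by (intro card_Diff1_less)
    ultimately show False using C(2) by simp
  qed
  define f where "f x = x /\<^sub>R norm x" for x :: 'a
  have spanf: "span (f ` C) = span C"
    unfolding f_def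
    by (rule span_image_scale) (use C(1) \<open>0 \<notin> C\<close> in auto)
  have orth: "pairwise orthogonal (f ` C)"
    using C(4) unfolding pairwise_def f_def orthogonal_def by (auto)
  have "card (f ` C) = card B"
    using min_card[of "f ` C"] card_image_le[of C f] C spanf by simp
  moreover have "norm x = 1" if xC: "x \<in> f ` C" for x
  proof -
    obtain y where "y \<in> C" "x = y /\<^sub>R norm y" using xC unfolding f_def by blast
    moreover from this have "y \<noteq> 0" using \<open>0 \<notin> C\<close> by auto
    ultimately show ?thesis by simp
  qed
  ultimately show thesis
    using that[of "f ` C"] C(1,3) spanf orth by blast
qed

lemma eigenvectors_orthogonal:
  fixes T :: "'a::real_inner \<Rightarrow> 'a"
  assumes "\<forall>x y. inner (T x) y = inner x (T y)"
    and "T x = \<mu> *\<^sub>R x" "T y = \<nu> *\<^sub>R y" "\<mu> \<noteq> \<nu>"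
  shows "inner x y = 0"
proof -
  have "\<mu> * inner x y = \<nu> * inner x y"
    using assms(1)[rule_format, of x y] assms(2,3) by simp
  then show ?thesis using assms(4) by simp
qed

text \<open>Norm-maximising unit vectors \<open>x\<^sub>n\<close> in \<open>V\<close> are approximate eigenvectors of \<open>T\<^sup>2\<close>, because
  \<open>\<parallel>T\<^sup>2 x\<^sub>n - M\<^sup>2 x\<^sub>n\<parallel>\<^sup>2 \<le> M\<^sup>4 - M\<^sup>2 \<parallel>T x\<^sub>n\<parallel>\<^sup>2\<close>; compactness makes them converge, and positivity
  excludes the eigenvalue \<open>-M\<close> of \<open>T\<close>.\<close>

lemma positive_compact_eigenvector:
  fixes T :: "'a::real_inner \<Rightarrow> 'a"
  assumes cpt: "compact_operator T"
    and selfadj: "\<forall>x y. inner (T x) y = inner x (T y)"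
    and pos: "\<forall>x. inner (T x) x \<ge> 0"
    and V: "subspace V" "closed V" and inv: "\<And>x. x \<in> V \<Longrightarrow> T x \<in> V"
    and ne: "v \<in> V" "T v \<noteq> 0"
  obtains x M where "x \<in> V" "norm x = 1" "M > 0" "T x = M *\<^sub>R x"
    "\<And>y. y \<in> V \<Longrightarrow> norm (T y) \<le> M * norm y"
proof -
  have bl: "bounded_linear T" and cK: "compact (closure (T ` cball 0 1))"
    using cpt unfolding compact_operator_def by auto
  interpret T: bounded_linear T by (rule bl)
  obtain Kb where Kb: "\<And>x. norm (T x) \<le> norm x * Kb" using T.bounded by blast
  define S where "S = {norm (T x) | x. x \<in> V \<and> norm x = 1}"
  define M where "M = Sup S"
  have bdd: "bdd_above S" unfolding S_def bdd_above_def using Kb by (auto intro!: exI[of _ Kb]) (metis mult_1)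
  have v0: "v \<noteq> 0" using ne(2) T.zero by auto
  have inS: "norm (T v) / norm v \<in> S"
    unfolding S_def using ne v0 V(1)
    by (auto intro!: exI[of _ "v /\<^sub>R norm v"] simp: T.scaleR subspace_scale divide_inverse mult.commute)
  have Mpos: "M > 0"
    using cSup_upper[OF inS bdd] ne(2) v0 unfolding M_def
    by (smt (verit, best) divide_pos_pos zero_less_norm_iff)
  have M: "norm (T y) \<le> M * norm y" if "y \<in> V" for y
  proof (cases "y = 0")
    case False
    have "norm (T y) / norm y \<in> S"
      unfolding S_def using that False V(1)
      by (auto intro!: exI[of _ "y /\<^sub>R norm y"] simp: T.scaleR subspace_scale divide_inverse mult.commute)
    then have "norm (T y) / norm y \<le> M" unfolding M_def by (rule cSup_upper[OF _ bdd])
    then show ?thesis using False by (simp add: field_simps)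
  qed (simp add: T.zero)
  have "\<exists>x. x \<in> V \<and> norm x = 1 \<and> norm (T x) > M - inverse (real (Suc n))" for n
  proof -
    have "S \<noteq> {}" using inS by auto
    then have "\<exists>s\<in>S. M - inverse (real (Suc n)) < s"
      unfolding M_def by (intro less_cSupD) (auto)
    then show ?thesis unfolding S_def by auto
  qed
  then obtain X where X: "\<And>n. X n \<in> V" "\<And>n. norm (X n) = 1"
    "\<And>n. norm (T (X n)) > M - inverse (real (Suc n))" by metis
  have limM: "(\<lambda>n. norm (T (X n))) \<longlonglongrightarrow> M"
  proof (rule tendsto_sandwich[of "\<lambda>n. M - inverse (real (Suc n))" _ _ "\<lambda>_. M"])
    show "(\<lambda>n. M - inverse (real (Suc n))) \<longlonglongrightarrow> M"
      using tendsto_diff[OF tendsto_const LIMSEQ_inverse_real_of_nat, of M] by simp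
    show "\<forall>\<^sub>F n in sequentially. norm (T (X n)) \<le> M"
      using M[OF X(1)] by (simp add: X(2))
    show "\<forall>\<^sub>F n in sequentially. M - inverse (real (Suc n)) \<le> norm (T (X n))"
      using X(3) by (intro always_eventually allI less_imp_le)
  qed simp
  have "\<forall>n. T (X n) \<in> closure (T ` cball 0 1)"
  proof
    fix n
    have "T (X n) \<in> T ` cball 0 1" using X(2)[of n] by simp
    then show "T (X n) \<in> closure (T ` cball 0 1)" by (rule subsetD[OF closure_subset])
  qed
  then obtain l r where lr: "strict_mono r" "((\<lambda>n. T (X n)) \<circ> r) \<longlonglongrightarrow> l"
    using cK unfolding compact_eq_seq_compact_metric by (meson seq_compactE)
  define Y where "Y n = X (r n)" for n
  have TY: "(\<lambda>n. T (Y n)) \<longlonglongrightarrow> l" using lr(2) by (simp add: Y_def o_def)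
  have nTY: "(\<lambda>n. norm (T (Y n))) \<longlonglongrightarrow> M"
    using LIMSEQ_subseq_LIMSEQ[OF limM lr(1)] by (simp add: Y_def o_def)
  have Y: "Y n \<in> V" "norm (Y n) = 1" for n using X by (auto simp: Y_def)
  have est: "(norm (T (T (Y n)) - M\<^sup>2 *\<^sub>R Y n))\<^sup>2 \<le> M^4 - M\<^sup>2 * (norm (T (Y n)))\<^sup>2" for n
  proof -
    have "(norm (T (T (Y n)) - M\<^sup>2 *\<^sub>R Y n))\<^sup>2
        = (norm (T (T (Y n))))\<^sup>2 - 2 * M\<^sup>2 * inner (T (T (Y n))) (Y n) + M^4 * (norm (Y n))\<^sup>2"
      unfolding power2_norm_eq_inner
      by (simp add: inner_diff_left inner_diff_right inner_commute algebra_simps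
          power4_eq_xxxx power2_eq_square)
    also have "inner (T (T (Y n))) (Y n) = (norm (T (Y n)))\<^sup>2"
      using selfadj by (simp add: power2_norm_eq_inner)
    also have "(norm (T (T (Y n))))\<^sup>2 \<le> (M * norm (T (Y n)))\<^sup>2"
      by (intro power_mono M inv Y) auto
    finally show ?thesis using Y(2) by (simp add: power_mult_distrib)
  qed
  have "(\<lambda>n. M^4 - M\<^sup>2 * (norm (T (Y n)))\<^sup>2) \<longlonglongrightarrow> M^4 - M\<^sup>2 * M\<^sup>2"
    by (intro tendsto_intros nTY)
  then have "(\<lambda>n. M^4 - M\<^sup>2 * (norm (T (Y n)))\<^sup>2) \<longlonglongrightarrow> 0" by (simp add: power4_eq_xxxx power2_eq_square)
  then have "(\<lambda>n. (norm (T (T (Y n)) - M\<^sup>2 *\<^sub>R Y n))\<^sup>2) \<longlonglongrightarrow> 0"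
    by (rule tendsto_sandwich[OF _ _ tendsto_const, rotated 2]) (use est in auto)
  from tendsto_real_sqrt[OF this] have d0: "(\<lambda>n. T (T (Y n)) - M\<^sup>2 *\<^sub>R Y n) \<longlonglongrightarrow> 0"
    by (simp add: tendsto_norm_zero_iff)
  have TTY: "(\<lambda>n. T (T (Y n))) \<longlonglongrightarrow> T l" by (rule T.tendsto[OF TY])
  \<comment> \<open>Convergence passes from \<open>T (Y n)\<close> to \<open>Y n\<close> itself:
    \<open>T (T (Y n))\<close> converges and differs from \<open>M\<^sup>2 *\<^sub>R Y n\<close> by
    a null sequence.\<close>
  have "(\<lambda>n. (1/M\<^sup>2) *\<^sub>R (T (T (Y n)) - (T (T (Y n)) - M\<^sup>2 *\<^sub>R Y n))) \<longlonglongrightarrow> (1/M\<^sup>2) *\<^sub>R (T l - 0)"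
    by (intro tendsto_intros TTY d0)
  moreover define z where "z = (1/M\<^sup>2) *\<^sub>R T l"
  ultimately have Yz: "Y \<longlonglongrightarrow> z" using Mpos by simp
  have zV: "z \<in> V" using Yz V(2) Y(1) closed_sequentially by blast
  have nz: "norm z = 1"
    using tendsto_norm[OF Yz] by (simp add: Y(2) LIMSEQ_const_iff)
  have TzL: "T z = l" using T.tendsto[OF Yz] TY LIMSEQ_unique by blast
  have TTz: "T (T z) = M\<^sup>2 *\<^sub>R z" using Mpos by (simp add: TzL) (simp add: z_def)
  \<comment> \<open>Since \<open>T\<^sup>2 - M\<^sup>2\<close> factors as
    \<open>(T + M) (T - M)\<close>, the vector \<open>w\<close> lies in the kernel of
    \<open>T + M\<close>.\<close>
  define w where "w = T z - M *\<^sub>R z"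
  have "T w = - M *\<^sub>R w"
    unfolding w_def by (simp add: T.diff T.scaleR TTz scaleR_diff_right power2_eq_square)
  then have "- M * (norm w)\<^sup>2 \<ge> 0"
    using pos[rule_format, of w] by (simp add: power2_norm_eq_inner)
  then have "w = 0" using Mpos by (smt (verit) mult_neg_pos zero_less_norm_iff zero_less_power)
  then have "T z = M *\<^sub>R z" by (simp add: w_def)
  then show thesis using that[OF zV nz Mpos] M by blast
qed

text \<open>The listing only equates cardinalities, and \<open>card\<close> is 0 on infinite sets.
  With \<open>fin\<close> the equality becomes a bijection between an orthonormal basis of each
  eigenspace and the indices carrying that eigenvalue; these bijections glue to one sequence,
  orthogonal across eigenspaces by self-adjointness.\<close>

lemma eigenbasis_of_listing:
  fixes T :: "'a::real_inner \<Rightarrow> 'a" and lam :: "nat \<Rightarrow> real"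
  assumes selfadj: "\<forall>x y. inner (T x) y = inner x (T y)"
    and eig: "eigenvalue_listing T lam"
    and fin: "\<And>\<mu>. is_eigenvalue T \<mu> \<Longrightarrow> finite {n. 1 \<le> n \<and> lam n = \<mu>}"
  obtains e :: "nat \<Rightarrow> 'a"
  where "\<And>n. n \<ge> 1 \<Longrightarrow> T (e n) = lam n *\<^sub>R e n"
    and "\<And>m n. m \<ge> 1 \<Longrightarrow> n \<ge> 1 \<Longrightarrow> inner (e m) (e n) = (if m = n then 1 else 0)"
    and "\<And>\<mu>. is_eigenvalue T \<mu> \<Longrightarrow> eigenspace T \<mu> = span (e ` {n. 1 \<le> n \<and> lam n = \<mu>})"
proof -
  let ?J = "\<lambda>\<mu>. {n. 1 \<le> n \<and> lam n = \<mu>}"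
  have "\<exists>f. pairwise orthogonal (f ` ?J \<mu>) \<and> inj_on f (?J \<mu>) \<and> (\<forall>n\<in>?J \<mu>. norm (f n) = 1)
          \<and> span (f ` ?J \<mu>) = eigenspace T \<mu>" if ev: "is_eigenvalue T \<mu>" for \<mu>
  proof -
    obtain B where B: "finite B" "independent B" "span B = eigenspace T \<mu>" "card B = card (?J \<mu>)"
      using eig ev unfolding eigenvalue_listing_def by blast
    obtain C where C: "finite C" "card C = card B" "span C = span B"
      "pairwise orthogonal C" "\<And>x. x \<in> C \<Longrightarrow> norm x = 1"
      using finite_orthonormal_basis[OF B(1,2)] by blast
    obtain f where "bij_betw f (?J \<mu>) C"
      using finite_same_card_bij[OF fin[OF ev] C(1)] C(2) B(4) by auto
    then show ?thesis using C B(3) unfolding bij_betw_def by (intro exI[of _ f]) auto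
  qed
  then have "\<exists>f. \<forall>\<mu>. is_eigenvalue T \<mu> \<longrightarrow> pairwise orthogonal (f \<mu> ` ?J \<mu>)
      \<and> inj_on (f \<mu>) (?J \<mu>) \<and> (\<forall>n\<in>?J \<mu>. norm (f \<mu> n) = 1) \<and> span (f \<mu> ` ?J \<mu>) = eigenspace T \<mu>"
    by (intro choice) blast
  then obtain f where f: "\<And>\<mu>. is_eigenvalue T \<mu> \<Longrightarrow> pairwise orthogonal (f \<mu> ` ?J \<mu>)"
    "\<And>\<mu>. is_eigenvalue T \<mu> \<Longrightarrow> inj_on (f \<mu>) (?J \<mu>)"
    "\<And>\<mu> n. is_eigenvalue T \<mu> \<Longrightarrow> n \<in> ?J \<mu> \<Longrightarrow> norm (f \<mu> n) = 1"
    "\<And>\<mu>. is_eigenvalue T \<mu> \<Longrightarrow> span (f \<mu> ` ?J \<mu>) = eigenspace T \<mu>"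
    by blast
  define e where "e n = f (lam n) n" for n
  have ev: "is_eigenvalue T (lam n)" if "n \<ge> 1" for n
    using eig that unfolding eigenvalue_listing_def by blast
  have e_img: "e ` ?J \<mu> = f \<mu> ` ?J \<mu>" for \<mu> unfolding e_def by (rule image_cong) auto
  have e1: "T (e n) = lam n *\<^sub>R e n" if "n \<ge> 1" for n
  proof -
    have "e n \<in> eigenspace T (lam n)"
      using f(4)[OF ev[OF that]] that span_superset[of "f (lam n) ` ?J (lam n)"] unfolding e_def by auto
    then show ?thesis by (simp add: eigenspace_def)
  qed
  have e2: "inner (e m) (e n) = (if m = n then 1 else 0)" if mn: "m \<ge> 1" "n \<ge> 1" for m n
  proof (cases "m = n")
    case True
    have "norm (e n) = 1" unfolding e_def using f(3)[OF ev[OF mn(2)]] mn by auto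
    then show ?thesis using True by (simp add: norm_eq_1)
  next
    case False
    show ?thesis
    proof (cases "lam m = lam n")
      case True
      then have "e m \<noteq> e n" using f(2)[OF ev[OF mn(2)]] False mn
        unfolding e_def inj_on_def by auto
      then have "orthogonal (e m) (e n)"
        using f(1)[OF ev[OF mn(2)]] True mn unfolding pairwise_def e_def by auto
      then show ?thesis using False by (simp add: orthogonal_def)
    next
      case ne: False
      then show ?thesis using eigenvectors_orthogonal[OF selfadj e1 e1 ne] mn False by auto
    qed
  qed
  show thesis
    by (rule that[of e]) (use e1 e2 f(4) e_img in auto)
qed

text \<open>Takes the place of the spectral theorem. The complement of the first \<open>D\<close>
  eigenvectors is closed and invariant; if the bound failed, the norm of \<open>T\<close> on it
  would be an eigenvalue \<open>M > lam (Suc D)\<close>. Such an \<open>M\<close> is listed only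
  among the first \<open>D\<close> indices, so its eigenvector would lie in the span to which it is
  orthogonal.\<close>

lemma norm_le_eigenvalue_on_complement:
  fixes T :: "'a::real_inner \<Rightarrow> 'a" and lam :: "nat \<Rightarrow> real"
  assumes cpt: "compact_operator T"
    and selfadj: "\<forall>x y. inner (T x) y = inner x (T y)"
    and pos: "\<forall>x. inner (T x) x \<ge> 0"
    and eig: "eigenvalue_listing T lam"
    and lam_pos: "\<forall>n\<ge>1. lam n > 0"
    and e1: "\<And>n. n \<ge> 1 \<Longrightarrow> T (e n) = lam n *\<^sub>R e n"
    and e3: "\<And>\<mu>. is_eigenvalue T \<mu> \<Longrightarrow> eigenspace T \<mu> = span (e ` {n. 1 \<le> n \<and> lam n = \<mu>})"
    and x: "\<And>n. n \<in> {1..D} \<Longrightarrow> inner x (e n) = 0"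
  shows "norm (T x) \<le> lam (Suc D) * norm x"
proof (rule ccontr)
  assume neg: "\<not> norm (T x) \<le> lam (Suc D) * norm x"
  have lamD: "lam (Suc D) > 0" using lam_pos by simp
  define V where "V = {y. \<forall>n\<in>{1..D}. inner y (e n) = 0}"
  have V: "subspace V" unfolding V_def subspace_def by (auto simp: inner_add_left)
  have "V = (\<Inter>n\<in>{1..D}. {y. inner y (e n) = 0})" unfolding V_def by auto
  moreover have "closed {y. inner y (e n) = 0}" for n
    by (intro closed_Collect_eq continuous_intros)
  ultimately have cV: "closed V" by auto
  have inv: "T y \<in> V" if "y \<in> V" for y
    using that selfadj e1 unfolding V_def by auto
  have "x \<in> V" using x by (auto simp: V_def)
  moreover have "T x \<noteq> 0"
    using neg lamD by auto
  ultimately obtain z M where z: "z \<in> V" "norm z = 1" "M > 0" "T z = M *\<^sub>R z"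
    "\<And>y. y \<in> V \<Longrightarrow> norm (T y) \<le> M * norm y"
    using positive_compact_eigenvector[OF cpt selfadj pos V cV inv] by metis
  have "lam (Suc D) * norm x < M * norm x" using z(5)[OF \<open>x \<in> V\<close>] neg by linarith
  then have Mgt: "lam (Suc D) < M" by (simp add: mult_less_cancel_right)
  have mono: "lam n \<le> lam (Suc D)" if "n \<ge> Suc D" for n
    using that
  proof (induction rule: dec_induct)
    case (step m)
    have "lam (Suc m) \<le> lam m" using eig step(1) unfolding eigenvalue_listing_def by auto
    then show ?case using step.IH by linarith
  qed simp
  have ev: "is_eigenvalue T M" unfolding is_eigenvalue_def using z by (intro exI[of _ z]) auto
  have sub: "{n. 1 \<le> n \<and> lam n = M} \<subseteq> {1..D}"
  proof
    fix n assume "n \<in> {n. 1 \<le> n \<and> lam n = M}"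
    then show "n \<in> {1..D}" using mono[of n] Mgt by (cases "n \<le> D") auto
  qed
  have "z \<in> span (e ` {n. 1 \<le> n \<and> lam n = M})"
    using e3[OF ev] z(4) by (auto simp: eigenspace_def)
  then have "z \<in> span (e ` {1..D})" using span_mono[OF image_mono[OF sub]] by blast
  moreover have "subspace {y. inner z y = 0}" unfolding subspace_def by (auto simp: inner_add_right)
  moreover have "e ` {1..D} \<subseteq> {y. inner z y = 0}" using z(1) unfolding V_def by auto
  ultimately have "inner z z = 0" using span_minimal by blast
  then show False using z(2) by simp
qed

section \<open>Volumes of balls and ellipsoids\<close>

text \<open>On boxes the claim is a product of one-dimensional scalings, and boxes determine the
  product measure. All ellipsoids and balls are reduced to one unit ball by it.\<close>

lemma emeasure_PiM_lborel_affine: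
  fixes I :: "nat set" and s t :: "nat \<Rightarrow> real"
  assumes I: "finite I" and s: "\<And>i. i \<in> I \<Longrightarrow> s i > 0"
    and A: "A \<in> sets (PiM I (\<lambda>_. lborel))"
  shows "emeasure (PiM I (\<lambda>_. lborel)) A =
    ennreal (\<Prod>i\<in>I. s i) * emeasure (PiM I (\<lambda>_. lborel))
      {x \<in> space (PiM I (\<lambda>_. lborel)). (\<lambda>i\<in>I. t i + s i * x i) \<in> A}"
proof -
  let ?L = "PiM I (\<lambda>_. lborel :: real measure)"
  let ?f = "\<lambda>x. \<lambda>i\<in>I. t i + s i * x i"
  interpret product_sigma_finite "\<lambda>_::nat. lborel :: real measure"
    by standard
  have f[measurable]: "?f \<in> measurable ?L ?L" by measurable
  define P where "P = density (distr ?L ?L ?f) (\<lambda>_. ennreal (\<Prod>i\<in>I. s i))"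
  have eq: "P = ?L"
  proof (rule PiM_eqI[OF I])
    show "sets P = sets ?L" by (simp add: P_def)
    fix B :: "nat \<Rightarrow> real set" assume B: "\<And>i. i \<in> I \<Longrightarrow> B i \<in> sets lborel"
    have meas: "Pi\<^sub>E I B \<in> sets ?L" using B I by (intro sets_PiM_I_finite) auto
    have pre: "?f -` (Pi\<^sub>E I B) \<inter> space ?L = Pi\<^sub>E I (\<lambda>i. (\<lambda>x. t i + s i * x) -` B i)"
      by (auto simp: space_PiM PiE_def Pi_def extensional_def restrict_def)
    have B': "(\<lambda>x. t i + s i * x) -` B i \<in> sets lborel" if "i \<in> I" for i
    proof -
      have "(\<lambda>x. t i + s i * x) \<in> borel_measurable borel" by measurable
      from measurable_sets[OF this, of "B i"] B[OF that] show ?thesis by simp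
    qed
    have one: "emeasure lborel (B i) = ennreal (s i) * emeasure lborel ((\<lambda>x. t i + s i * x) -` B i)"
      if "i \<in> I" for i
    proof -
      have "emeasure lborel (B i) =
          emeasure (density (distr lborel borel (\<lambda>x. t i + s i * x)) (\<lambda>_. ennreal (abs (s i)))) (B i)"
        using lborel_real_affine[of "s i" "t i"] s[OF that] by simp
      also have "\<dots> = ennreal (s i) * emeasure lborel ((\<lambda>x. t i + s i * x) -` B i)"
        using B[OF that] s[OF that] by (simp add: emeasure_density_const emeasure_distr)
      finally show ?thesis .
    qed
    have "emeasure P (Pi\<^sub>E I B) = ennreal (\<Prod>i\<in>I. s i) * emeasure ?L (Pi\<^sub>E I (\<lambda>i. (\<lambda>x. t i + s i * x) -` B i))"
      unfolding P_def using meas pre by (simp add: emeasure_density_const emeasure_distr)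
    also have "\<dots> = (\<Prod>i\<in>I. ennreal (s i)) * (\<Prod>i\<in>I. emeasure lborel ((\<lambda>x. t i + s i * x) -` B i))"
      using emeasure_PiM[OF I B'] s by (subst prod_ennreal) (auto intro: less_imp_le)
    also have "\<dots> = (\<Prod>i\<in>I. emeasure lborel (B i))"
      unfolding prod.distrib[symmetric] by (rule prod.cong) (use one in auto)
    finally show "emeasure P (Pi\<^sub>E I B) = (\<Prod>i\<in>I. emeasure lborel (B i))" .
  qed
  have "emeasure ?L A = emeasure P A" by (simp add: eq)
  also have "\<dots> = ennreal (\<Prod>i\<in>I. s i) * emeasure ?L (?f -` A \<inter> space ?L)"
    unfolding P_def using A by (simp add: emeasure_density_const emeasure_distr)
  also have "?f -` A \<inter> space ?L = {x \<in> space ?L. ?f x \<in> A}" by auto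
  finally show ?thesis .
qed

text \<open>Functions on an index set serve as coordinate space because the dimension grows as the
  precision tends to 0, and the blocks are varying subsets of one family of coordinates.\<close>

abbreviation lborel_on :: "nat set \<Rightarrow> (nat \<Rightarrow> real) measure" where
  "lborel_on I \<equiv> PiM I (\<lambda>_. lborel)"

definition L2_ball :: "nat set \<Rightarrow> (nat \<Rightarrow> real) \<Rightarrow> real \<Rightarrow> (nat \<Rightarrow> real) set" where
  "L2_ball I c r = {x \<in> space (lborel_on I). L2_set (\<lambda>i. x i - c i) I \<le> r}"

lemma L2_set_measurable [measurable]:
  assumes "finite I" "\<And>i. i \<in> I \<Longrightarrow> f i \<in> borel_measurable M"
  shows "(\<lambda>x. L2_set (\<lambda>i. f i x) I) \<in> borel_measurable M"
  unfolding L2_set_def using assms by measurable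

lemma L2_ball_measurable [measurable]: "finite I \<Longrightarrow> L2_ball I c r \<in> sets (lborel_on I)"
  unfolding L2_ball_def by measurable

lemma L2_set_scale: "c \<ge> 0 \<Longrightarrow> L2_set (\<lambda>i. c * f i) I = c * L2_set f I"
  by (simp add: L2_set_right_distrib)

lemma L2_set_minus_commute: "L2_set (\<lambda>i. f i - g i) I = L2_set (\<lambda>i. g i - f i) I"
  unfolding L2_set_def by (simp add: power2_commute)

lemma L2_set_triangle3:
  "L2_set (\<lambda>i. f i - h i) I \<le> L2_set (\<lambda>i. f i - g i) I + L2_set (\<lambda>i. g i - h i) I"
  using L2_set_triangle_ineq[of "\<lambda>i. f i - g i" "\<lambda>i. g i - h i" I] by simp

definition ellipsoid :: "nat set \<Rightarrow> (nat \<Rightarrow> real) \<Rightarrow> (nat \<Rightarrow> real) set" where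
  "ellipsoid I a = {x \<in> space (lborel_on I). L2_set (\<lambda>i. x i / a i) I \<le> 1}"

lemma emeasure_ellipsoid:
  assumes I: "finite I" and a: "\<And>i. i \<in> I \<Longrightarrow> a i > 0"
  shows "emeasure (lborel_on I) (ellipsoid I a) =
    ennreal (\<Prod>i\<in>I. a i) * emeasure (lborel_on I) (L2_ball I (\<lambda>_. 0) 1)"
proof -
  have m: "ellipsoid I a \<in> sets (lborel_on I)" unfolding ellipsoid_def using I by measurable
  have "{x \<in> space (lborel_on I). (\<lambda>i\<in>I. 0 + a i * x i) \<in> ellipsoid I a} = L2_ball I (\<lambda>_. 0) 1"
  proof -
    have "L2_set (\<lambda>i. (\<lambda>i\<in>I. 0 + a i * x i) i / a i) I = L2_set x I" for x
      by (rule L2_set_cong) (use a in force)+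
    then show ?thesis unfolding ellipsoid_def L2_ball_def by (auto simp: space_PiM)
  qed
  then show ?thesis using emeasure_PiM_lborel_affine[OF I _ m, of a "\<lambda>_. 0"] a by simp
qed

lemma emeasure_L2_ball:
  assumes I: "finite I" and r: "r > 0"
  shows "emeasure (lborel_on I) (L2_ball I c r) =
    ennreal (r ^ card I) * emeasure (lborel_on I) (L2_ball I (\<lambda>_. 0) 1)"
proof -
  have "{x \<in> space (lborel_on I). (\<lambda>i\<in>I. c i + r * x i) \<in> L2_ball I c r} = L2_ball I (\<lambda>_. 0) 1"
  proof -
    have "L2_set (\<lambda>i. (\<lambda>i\<in>I. c i + r * x i) i - c i) I = r * L2_set x I" for x
      unfolding L2_set_scale[OF less_imp_le[OF r], symmetric]
      by (rule L2_set_cong) auto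
    then show ?thesis unfolding L2_ball_def using r by (auto simp: space_PiM mult_le_cancel_left1)
  qed
  then show ?thesis
    using emeasure_PiM_lborel_affine[OF I _ L2_ball_measurable[OF I], of "\<lambda>_. r" c r c] r by simp
qed

lemma emeasure_L2_unit_ball_finite:
  assumes I: "finite I"
  shows "emeasure (lborel_on I) (L2_ball I (\<lambda>_. 0) 1) < \<infinity>"
proof -
  interpret product_sigma_finite "\<lambda>_::nat. lborel :: real measure" by standard
  have sub: "L2_ball I (\<lambda>_. 0) 1 \<subseteq> Pi\<^sub>E I (\<lambda>_. {-1..1})"
  proof
    fix x assume x: "x \<in> L2_ball I (\<lambda>_. 0) 1"
    have "\<bar>x i\<bar> \<le> 1" if "i \<in> I" for i
    proof -
      have "L2_set x I = L2_set (\<lambda>i. \<bar>x i\<bar>) I" by (simp add: L2_set_def)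
      then show ?thesis
        using member_le_L2_set[OF I that, of "\<lambda>i. \<bar>x i\<bar>"] x by (simp add: L2_ball_def)
    qed
    then show "x \<in> Pi\<^sub>E I (\<lambda>_. {-1..1})" using x
      unfolding L2_ball_def space_PiM PiE_def by (auto simp: abs_le_iff minus_le_iff)
  qed
  have "emeasure (lborel_on I) (L2_ball I (\<lambda>_. 0) 1) \<le> emeasure (lborel_on I) (Pi\<^sub>E I (\<lambda>_. {-1..1}))"
    by (rule emeasure_mono[OF sub]) (use I in \<open>auto intro!: sets_PiM_I_finite\<close>)
  also have "\<dots> = (\<Prod>i\<in>I. emeasure lborel {-1..1::real})" by (rule emeasure_PiM[OF I]) auto
  also have "\<dots> < \<infinity>" by (simp add: power_less_top_ennreal)
  finally show ?thesis .
qed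

lemma emeasure_L2_unit_ball_pos:
  assumes I: "finite I"
  shows "emeasure (lborel_on I) (L2_ball I (\<lambda>_. 0) 1) > 0"
proof -
  interpret product_sigma_finite "\<lambda>_::nat. lborel :: real measure" by standard
  \<comment> \<open>The cube of half-side \<open>s\<close> lies in the unit ball because the L2 norm
    is at most the L1 norm; the summand 1 keeps \<open>s\<close> positive when \<open>I\<close> is
    empty.\<close>
  define s where "s = 1 / (real (card I) + 1)"
  have s: "s > 0" by (simp add: s_def)
  have sub: "Pi\<^sub>E I (\<lambda>_. {-s..s}) \<subseteq> L2_ball I (\<lambda>_. 0) 1"
  proof
    fix x assume x: "x \<in> Pi\<^sub>E I (\<lambda>_. {-s..s})"
    have "L2_set x I \<le> (\<Sum>i\<in>I. \<bar>x i\<bar>)" by (rule L2_set_le_sum_abs)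
    also have "\<dots> \<le> (\<Sum>i\<in>I. s)" by (rule sum_mono) (use x in \<open>auto simp: PiE_def Pi_def abs_le_iff minus_le_iff\<close>)
    also have "\<dots> \<le> 1" by (simp add: s_def)
    finally show "x \<in> L2_ball I (\<lambda>_. 0) 1" using x by (auto simp: L2_ball_def space_PiM)
  qed
  have "0 < (\<Prod>i\<in>I. ennreal (2 * s))" using s I by (simp add: zero_less_iff_neq_zero prod_zero_iff)
  also have "\<dots> = (\<Prod>i\<in>I. emeasure lborel {-s..s})" using s by (simp add: emeasure_lborel_Icc)
  also have "\<dots> = emeasure (lborel_on I) (Pi\<^sub>E I (\<lambda>_. {-s..s}))" by (rule emeasure_PiM[OF I, symmetric]) auto
  also have "\<dots> \<le> emeasure (lborel_on I) (L2_ball I (\<lambda>_. 0) 1)"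
    by (rule emeasure_mono[OF sub L2_ball_measurable[OF I]])
  finally show ?thesis .
qed

lemma measure_L2_unit_ball_pos:
  "finite I \<Longrightarrow> measure (lborel_on I) (L2_ball I (\<lambda>_. 0) 1) > 0"
  using emeasure_L2_unit_ball_pos emeasure_L2_unit_ball_finite
  by (simp add: measure_def enn2real_positive_iff)

lemma measure_L2_ball:
  assumes "finite I" "r > 0"
  shows "measure (lborel_on I) (L2_ball I c r) = r ^ card I * measure (lborel_on I) (L2_ball I (\<lambda>_. 0) 1)"
  unfolding measure_def emeasure_L2_ball[OF assms] using assms(2) by (simp add: enn2real_mult)

lemma L2_ball_fmeasurable:
  assumes "finite I" "r > 0"
  shows "L2_ball I c r \<in> fmeasurable (lborel_on I)"
  using assms emeasure_L2_ball[OF assms, of c] emeasure_L2_unit_ball_finite[OF assms(1)]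
  by (intro fmeasurableI) (auto simp: ennreal_mult_less_top)

text \<open>Volume comparison: the volume of the unit ball is a factor on both sides and cancels, so
  its value is never computed.\<close>

lemma ellipsoid_cover_card_ge:
  assumes I: "finite I" and a: "\<And>i. i \<in> I \<Longrightarrow> a i > 0" and eps: "eps > 0"
    and C: "finite C"
    and cover: "\<And>x. x \<in> ellipsoid I a \<Longrightarrow> \<exists>c\<in>C. L2_set (\<lambda>i. x i - c i) I \<le> eps"
  shows "(\<Prod>i\<in>I. a i) \<le> real (card C) * eps ^ card I"
proof -
  let ?L = "lborel_on I" and ?V = "measure (lborel_on I) (L2_ball I (\<lambda>_. 0) 1)"
  have "ellipsoid I a \<subseteq> (\<Union>c\<in>C. L2_ball I c eps)"
    using cover unfolding L2_ball_def ellipsoid_def by blast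
  moreover have "(\<Union>c\<in>C. L2_ball I c eps) \<in> fmeasurable ?L"
    using C L2_ball_fmeasurable[OF I eps] by (intro fmeasurable.finite_UN)
  moreover have "ellipsoid I a \<in> sets ?L" unfolding ellipsoid_def using I by measurable
  ultimately have "measure ?L (ellipsoid I a) \<le> measure ?L (\<Union>c\<in>C. L2_ball I c eps)"
    by (intro measure_mono_fmeasurable)
  also have "\<dots> \<le> (\<Sum>c\<in>C. measure ?L (L2_ball I c eps))"
    by (rule measure_UNION_le[OF C]) (use I in auto)
  also have "\<dots> = real (card C) * eps ^ card I * ?V" by (simp add: measure_L2_ball[OF I eps])
  also have "measure ?L (ellipsoid I a) = (\<Prod>i\<in>I. a i) * ?V"
    using a emeasure_ellipsoid[OF I, of a]
    by (simp add: measure_def enn2real_mult prod_nonneg less_imp_le)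
  finally show ?thesis using measure_L2_unit_ball_pos[OF I] by simp
qed

section \<open>Covering balls\<close>

lemma L2_set_le_iff: "h \<ge> 0 \<Longrightarrow> L2_set f I \<le> h \<longleftrightarrow> (\<Sum>i\<in>I. (f i)\<^sup>2) \<le> h\<^sup>2"
  unfolding L2_set_def by (metis real_sqrt_le_iff real_sqrt_abs abs_of_nonneg)

text \<open>First moment argument: the number of sets containing a point, averaged over
  \<open>A\<close>, is at least \<open>p * card F\<close>, and its maximum is at least the average.
  The maximum is attained because only finitely many values occur.\<close>

lemma exists_point_in_many_sets:
  fixes U :: "'b \<Rightarrow> 'a set"
  assumes A: "A \<in> fmeasurable M" "measure M A > 0" and F: "finite F"
    and U: "\<And>f. f \<in> F \<Longrightarrow> U f \<in> sets M"
    and p: "\<And>f. f \<in> F \<Longrightarrow> measure M (A \<inter> U f) \<ge> p * measure M A"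
  shows "\<exists>y\<in>A. real (card {f \<in> F. y \<in> U f}) \<ge> p * real (card F)"
proof -
  define N where "N y = card {f \<in> F. y \<in> U f}" for y
  have "A \<noteq> {}" using A(2) by auto
  have finN: "finite (N ` A)"
    by (rule finite_subset[of _ "{..card F}"]) (auto simp: N_def F intro: card_mono)
  then have "Max (N ` A) \<in> N ` A" using \<open>A \<noteq> {}\<close> by (intro Max_in) auto
  then obtain y where y: "y \<in> A" "N y = Max (N ` A)" by auto
  have max: "N z \<le> N y" if "z \<in> A" for z using that y finN by auto
  have fm: "A \<inter> U f \<in> fmeasurable M" if "f \<in> F" for f
    using A(1) U[OF that] by (rule fmeasurable_Int_fmeasurable)
  have "p * real (card F) * measure M A = (\<Sum>f\<in>F. p * measure M A)" by simp
  also have "\<dots> \<le> (\<Sum>f\<in>F. measure M (A \<inter> U f))" by (intro sum_mono p)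
  also have "\<dots> = (\<Sum>f\<in>F. \<integral>z. indicator (A \<inter> U f) z \<partial>M)"
    using fm by (intro sum.cong) (auto simp: fmeasurable_def Int_absorb2 sets.sets_into_space)
  also have "\<dots> = (\<integral>z. (\<Sum>f\<in>F. indicator (A \<inter> U f) z) \<partial>M)"
    using fm by (intro Bochner_Integration.integral_sum[symmetric]) (auto simp: fmeasurable_def)
  also have "\<dots> \<le> (\<integral>z. real (N y) * indicator A z \<partial>M)"
  proof (rule integral_mono)
    show "integrable M (\<lambda>z. \<Sum>f\<in>F. indicator (A \<inter> U f) z :: real)"
      using fm by (intro Bochner_Integration.integrable_sum) (auto simp: fmeasurable_def)
    show "integrable M (\<lambda>z. real (N y) * indicator A z)"
      using A(1) by (auto simp: fmeasurable_def)
    fix z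
    have "(\<Sum>f\<in>F. indicator (A \<inter> U f) z) = indicator A z * real (N z)"
      unfolding N_def using F
      by (auto simp: indicator_def sum.If_cases Int_def)
    also have "\<dots> \<le> real (N y) * indicator A z"
      using max by (auto simp: indicator_def)
    finally show "(\<Sum>f\<in>F. indicator (A \<inter> U f) z) \<le> real (N y) * indicator A z" .
  qed
  also have "\<dots> = real (N y) * measure M A"
    using A(1) by (simp add: fmeasurable_def Int_absorb2 sets.sets_into_space)
  finally have "p * real (card F) \<le> real (N y)" using A(2) by simp
  then show ?thesis using y(1) unfolding N_def by blast
qed

text \<open>Each step adds a point that lies in a fraction \<open>p\<close> of the sets not yet hit,
  so their number shrinks by the factor \<open>1 - p\<close>. The size of the family enters only
  through its logarithm, so crude nets may be used.\<close>

lemma greedy_hitting_set: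
  fixes U :: "'b \<Rightarrow> 'a set"
  assumes A: "A \<in> fmeasurable M" "measure M A > 0" and F: "finite F" "card F > 0"
    and U: "\<And>f. f \<in> F \<Longrightarrow> U f \<in> sets M"
    and p: "\<And>f. f \<in> F \<Longrightarrow> measure M (A \<inter> U f) \<ge> p * measure M A" and p01: "0 < p" "p \<le> 1"
  shows "\<exists>C. finite C \<and> real (card C) \<le> ln (real (card F)) / p + 2 \<and> (\<forall>f\<in>F. \<exists>c\<in>C. c \<in> U f)"
proof -
  have step: "\<exists>C. finite C \<and> card C \<le> k \<and> real (card {f\<in>F. C \<inter> U f = {}}) \<le> (1 - p) ^ k * real (card F)" for k
  proof (induction k)
    case 0
    then show ?case by (intro exI[of _ "{}"]) auto
  next
    case (Suc k)
    then obtain C where C: "finite C" "card C \<le> k"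
      "real (card {f\<in>F. C \<inter> U f = {}}) \<le> (1 - p) ^ k * real (card F)" by blast
    define G where "G = {f\<in>F. C \<inter> U f = {}}"
    have G: "finite G" "G \<subseteq> F" using F by (auto simp: G_def)
    obtain y where y: "y \<in> A" "real (card {f \<in> G. y \<in> U f}) \<ge> p * real (card G)"
      using exists_point_in_many_sets[OF A G(1), of U p] U p G(2) by blast
    have "{f\<in>F. insert y C \<inter> U f = {}} = G - {f \<in> G. y \<in> U f}" by (auto simp: G_def)
    then have "real (card {f\<in>F. insert y C \<inter> U f = {}}) = real (card G) - real (card {f \<in> G. y \<in> U f})"
      using G(1) by (simp add: card_Diff_subset card_mono of_nat_diff)
    also have "\<dots> \<le> (1 - p) * real (card G)" using y(2) by (simp add: algebra_simps)
    also have "\<dots> \<le> (1 - p) * ((1 - p) ^ k * real (card F))"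
      using C(3) p01 unfolding G_def by (intro mult_left_mono) auto
    finally show ?case using C(1,2)
      by (intro exI[of _ "insert y C"]) (auto simp: card_insert_if)
  qed
  define L where "L = ln (real (card F)) / p"
  have L0: "L \<ge> 0" using F p01 by (simp add: L_def)
  \<comment> \<open>\<open>k\<close> exceeds \<open>L\<close> strictly, so fewer than one set, hence
    none, remains.\<close>
  define k where "k = nat \<lfloor>L\<rfloor> + 1"
  have k: "real k > L" "real k \<le> L + 1" unfolding k_def using L0 by linarith+
  obtain C where C: "finite C" "card C \<le> k" "real (card {f\<in>F. C \<inter> U f = {}}) \<le> (1 - p) ^ k * real (card F)"
    using step by blast
  have "(1 - p) ^ k \<le> exp (- p) ^ k" using p01 exp_ge_add_one_self[of "-p"] by (intro power_mono) auto
  also have "\<dots> = exp (- (p * real k))" by (simp add: exp_of_nat_mult[symmetric] mult.commute)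
  also have "\<dots> < exp (- (p * L))" using k p01 by simp
  also have "\<dots> = 1 / real (card F)" using p01 F by (simp add: L_def exp_minus field_simps)
  finally have "(1 - p) ^ k * real (card F) < 1" using F by (simp add: field_simps)
  then have "card {f\<in>F. C \<inter> U f = {}} = 0" using C(3) by linarith
  then have "{f\<in>F. C \<inter> U f = {}} = {}" using F by simp
  then show ?thesis using C k unfolding L_def by (intro exI[of _ C]) auto
qed

section \<open>Slabs and lenses in a ball\<close>

lemma measure_PiM_lborel_translate:
  assumes I: "finite I" and A: "A \<in> sets (lborel_on I)"
  shows "measure (lborel_on I) A = measure (lborel_on I) {x \<in> space (lborel_on I). (\<lambda>i\<in>I. t i + x i) \<in> A}"
  using emeasure_PiM_lborel_affine[OF I _ A, of "\<lambda>_. 1" t] by (simp add: measure_def)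

text \<open>A slab of the ball at distance \<open>j h / n\<close> from the centre is translated towards the centre into
  the slab \<open>j = 0\<close>, so the latter carries at least the \<open>n\<close>-th part of the half ball.\<close>

lemma measure_half_L2_ball_le:
  assumes I: "finite I" "I \<noteq> {}" and n: "n = card I" and h: "h > 0"
    and u: "(\<Sum>i\<in>I. (u i)\<^sup>2) = 1"
  shows "measure (lborel_on I) {y \<in> L2_ball I c h. 0 \<le> (\<Sum>i\<in>I. u i * (y i - c i))}
     \<le> real n * measure (lborel_on I) {y \<in> L2_ball I c h. \<bar>\<Sum>i\<in>I. u i * (y i - c i)\<bar> \<le> h / real n}"
proof -
  have n0: "n > 0" using I n by (simp add: card_gt_0_iff)
  let ?L = "lborel_on I"
  define \<phi> where "\<phi> y = (\<Sum>i\<in>I. u i * (y i - c i))" for y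
  define S where "S j = {y \<in> L2_ball I c h. real j * h / n \<le> \<phi> y \<and> \<phi> y \<le> real (Suc j) * h / n}" for j
  define S0 where "S0 = {y \<in> L2_ball I c h. \<bar>\<phi> y\<bar> \<le> h / real n}"
  have bm[measurable]: "L2_ball I c h \<in> sets ?L" using I by simp
  have phim[measurable]: "\<phi> \<in> borel_measurable ?L" unfolding \<phi>_def using I by measurable
  have bsub: "L2_ball I c h \<subseteq> space ?L" by (auto simp: L2_ball_def)
  have Sm: "S j \<in> sets ?L" for j
  proof -
    have "S j = L2_ball I c h \<inter> {y \<in> space ?L. real j * h / n \<le> \<phi> y \<and> \<phi> y \<le> real (Suc j) * h / n}"
      using bsub unfolding S_def by auto
    also have "\<dots> \<in> sets ?L" by measurable
    finally show ?thesis .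
  qed
  have S0m: "S0 \<in> sets ?L"
  proof -
    have "S0 = L2_ball I c h \<inter> {y \<in> space ?L. \<bar>\<phi> y\<bar> \<le> h / real n}"
      using bsub unfolding S0_def by auto
    also have "\<dots> \<in> sets ?L" by measurable
    finally show ?thesis .
  qed
  have S0f: "S0 \<in> fmeasurable ?L"
    by (rule fmeasurableI2[OF L2_ball_fmeasurable[OF I(1) h]]) (use S0m S0_def in auto)
  have le: "measure ?L (S j) \<le> measure ?L S0" for j
  proof -
    define \<tau> where "\<tau> = real j * h / n"
    define t where "t i = \<tau> * u i" for i
    have "{x \<in> space ?L. (\<lambda>i\<in>I. t i + x i) \<in> S j} \<subseteq> S0"
    proof
      fix x assume x: "x \<in> {x \<in> space ?L. (\<lambda>i\<in>I. t i + x i) \<in> S j}"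
      define y where "y = (\<lambda>i\<in>I. t i + x i)"
      have y: "L2_set (\<lambda>i. y i - c i) I \<le> h" "\<tau> \<le> \<phi> y" "\<phi> y \<le> \<tau> + h / n"
        using x by (auto simp: y_def S_def L2_ball_def \<tau>_def distrib_right add_divide_distrib)
      have "\<phi> x = (\<Sum>i\<in>I. u i * (y i - c i) - \<tau> * (u i)\<^sup>2)"
        unfolding \<phi>_def by (rule sum.cong) (auto simp: y_def t_def algebra_simps power2_eq_square)
      also have "\<dots> = \<phi> y - \<tau>"
        using u by (simp add: sum_subtractf sum_distrib_left[symmetric] \<phi>_def)
      finally have px: "\<phi> x = \<phi> y - \<tau>" .
      \<comment> \<open>Moving \<open>y\<close> back along \<open>u\<close> by
        \<open>\<tau> \<le> \<phi> y\<close> changes its squared distance from \<open>c\<close> by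
        \<open>- \<tau> * (2 * \<phi> y - \<tau>)\<close>, which is not positive; the translate
        stays in the ball.\<close>
      have "(\<Sum>i\<in>I. (x i - c i)\<^sup>2)
          = (\<Sum>i\<in>I. (y i - c i)\<^sup>2 - 2 * \<tau> * (u i * (y i - c i)) + \<tau>\<^sup>2 * (u i)\<^sup>2)"
        by (rule sum.cong) (auto simp: y_def t_def algebra_simps power2_eq_square)
      also have "\<dots> = (\<Sum>i\<in>I. (y i - c i)\<^sup>2) - 2 * \<tau> * \<phi> y + \<tau>\<^sup>2"
        using u by (simp add: sum.distrib sum_subtractf sum_distrib_left[symmetric] \<phi>_def)
      also have "\<dots> \<le> h\<^sup>2 - \<tau> * (2 * \<phi> y - \<tau>)"
        using y(1) h by (simp add: L2_set_le_iff algebra_simps power2_eq_square)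
      also have "\<dots> \<le> h\<^sup>2"
      proof -
        have "0 \<le> \<tau>" using h by (simp add: \<tau>_def)
        then have "0 \<le> \<tau> * (2 * \<phi> y - \<tau>)"
          using y(2) by (intro mult_nonneg_nonneg) linarith+
        then show ?thesis by linarith
      qed
      finally have "L2_set (\<lambda>i. x i - c i) I \<le> h" using h by (simp add: L2_set_le_iff)
      moreover have "\<bar>\<phi> x\<bar> \<le> h / n" using px y(2,3) by linarith
      ultimately show "x \<in> S0" using x by (auto simp: S0_def L2_ball_def)
    qed
    then have "measure ?L {x \<in> space ?L. (\<lambda>i\<in>I. t i + x i) \<in> S j} \<le> measure ?L S0"
    proof (rule measure_mono_fmeasurable[OF _ _ S0f])
      have [measurable]: "(\<lambda>x. \<lambda>i\<in>I. t i + x i) \<in> measurable ?L ?L" by measurable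
      show "{x \<in> space ?L. (\<lambda>i\<in>I. t i + x i) \<in> S j} \<in> sets ?L"
        using Sm[of j] by measurable
    qed
    then show ?thesis using measure_PiM_lborel_translate[OF I(1) Sm, of j t] by simp
  qed
  have Sf: "S j \<in> fmeasurable ?L" for j
    by (rule fmeasurableI2[OF L2_ball_fmeasurable[OF I(1) h]]) (use Sm S_def in auto)
  have cov: "{y \<in> L2_ball I c h. 0 \<le> \<phi> y} \<subseteq> (\<Union>j<n. S j)"
  proof
    fix y assume y: "y \<in> {y \<in> L2_ball I c h. 0 \<le> \<phi> y}"
    have "\<phi> y \<le> (\<Sum>i\<in>I. \<bar>u i\<bar> * \<bar>y i - c i\<bar>)"
      unfolding \<phi>_def by (intro sum_mono) (metis abs_ge_self abs_mult)
    also have "\<dots> \<le> L2_set u I * L2_set (\<lambda>i. y i - c i) I" by (rule L2_set_mult_ineq)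
    also have "L2_set u I = 1" using u by (simp add: L2_set_def)
    finally have yh: "\<phi> y \<le> h" using y by (simp add: L2_ball_def)
    define a where "a = \<phi> y * n / h"
    have a: "0 \<le> a" "a \<le> n" using y yh h n0 by (auto simp: a_def field_simps)
    have pa: "\<phi> y = a * h / n" using h n0 by (simp add: a_def)
    \<comment> \<open>At the outermost point \<open>a = n\<close> the floor would name a slab beyond
      the last one.\<close>
    define j where "j = (if a = n then n - 1 else nat \<lfloor>a\<rfloor>)"
    have "real j \<le> a \<and> a \<le> real (Suc j) \<and> j < n"
      using a n0 unfolding j_def by (auto simp: of_nat_diff) linarith+
    then have "j < n" "real j * h / n \<le> \<phi> y" "\<phi> y \<le> real (Suc j) * h / n"
      unfolding pa using h n0 by (auto intro!: divide_right_mono mult_right_mono)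
    then show "y \<in> (\<Union>j<n. S j)" using y by (auto simp: S_def)
  qed
  have "{y \<in> L2_ball I c h. 0 \<le> \<phi> y} = L2_ball I c h \<inter> {y \<in> space ?L. 0 \<le> \<phi> y}" using bsub by auto
  also have "\<dots> \<in> sets ?L" by measurable
  finally have "measure ?L {y \<in> L2_ball I c h. 0 \<le> \<phi> y} \<le> measure ?L (\<Union>j<n. S j)"
    using Sf by (intro measure_mono_fmeasurable[OF cov]) auto
  also have "\<dots> \<le> (\<Sum>j<n. measure ?L (S j))" by (rule measure_UNION_le) (use Sm in auto)
  also have "\<dots> \<le> (\<Sum>j<n. measure ?L S0)" by (intro sum_mono le)
  also have "\<dots> = real n * measure ?L S0" by simp
  finally show ?thesis unfolding S0_def \<phi>_def .
qed

text \<open>The half-ball bound for \<open>u\<close> and for \<open>- u\<close>. It is a cheap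
  substitute for concentration of measure: a slab much thinner than the natural width
  \<open>h / sqrt n\<close> still has a share of the volume that is only polynomially small, which
  is all that is needed.\<close>

lemma measure_slab_ge:
  assumes I: "finite I" "I \<noteq> {}" and n: "n = card I" and h: "h > 0"
    and u: "(\<Sum>i\<in>I. (u i)\<^sup>2) = 1"
  shows "measure (lborel_on I) {y \<in> L2_ball I c h. \<bar>\<Sum>i\<in>I. u i * (y i - c i)\<bar> \<le> h / real n}
     \<ge> measure (lborel_on I) (L2_ball I c h) / (2 * real n)"
proof -
  let ?L = "lborel_on I"
  have n0: "n > 0" using I n by (simp add: card_gt_0_iff)
  define \<phi> where "\<phi> y = (\<Sum>i\<in>I. u i * (y i - c i))" for y
  define P where "P = {y \<in> L2_ball I c h. 0 \<le> \<phi> y}"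
  define Q where "Q = {y \<in> L2_ball I c h. 0 \<le> - \<phi> y}"
  have bm[measurable]: "L2_ball I c h \<in> sets ?L" using I by simp
  have phim[measurable]: "\<phi> \<in> borel_measurable ?L" unfolding \<phi>_def using I by measurable
  have bsub: "L2_ball I c h \<subseteq> space ?L" by (auto simp: L2_ball_def)
  have "P = L2_ball I c h \<inter> {y \<in> space ?L. 0 \<le> \<phi> y}" using bsub by (auto simp: P_def)
  then have Pm: "P \<in> sets ?L" by simp
  have "Q = L2_ball I c h \<inter> {y \<in> space ?L. 0 \<le> - \<phi> y}" using bsub by (auto simp: Q_def)
  then have Qm: "Q \<in> sets ?L" by simp
  have neg: "(\<Sum>i\<in>I. - u i * (y i - c i)) = - \<phi> y" for y
    by (simp add: \<phi>_def sum_negf)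
  let ?s = "measure ?L {y \<in> L2_ball I c h. \<bar>\<phi> y\<bar> \<le> h / real n}"
  have 1: "measure ?L P \<le> real n * ?s"
    using measure_half_L2_ball_le[OF I n h u, of c] by (simp add: P_def \<phi>_def)
  have 2: "measure ?L Q \<le> real n * ?s"
    using measure_half_L2_ball_le[OF I n h, of "\<lambda>i. - u i" c] u
    unfolding neg by (simp add: Q_def)
  have "L2_ball I c h = P \<union> Q" unfolding P_def Q_def by auto
  then have "measure ?L (L2_ball I c h) \<le> measure ?L P + measure ?L Q"
    using measure_Un_le[OF Pm Qm] by simp
  with 1 2 have "measure ?L (L2_ball I c h) \<le> 2 * real n * ?s" by linarith
  then show ?thesis using n0 unfolding \<phi>_def by (simp add: field_simps)
qed

text \<open>Balls of radii \<open>r\<close> and \<open>e\<close> whose centres have distance \<open>R = sqrt (r\<^sup>2 + e\<^sup>2)\<close> intersect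
  orthogonally in a disc of radius \<open>h = r e / R\<close>.\<close>

lemma measure_lens_ge:
  assumes I: "finite I" "I \<noteq> {}" and n: "n = card I"
    and e: "0 < e" "e < R" and r: "r = sqrt (R\<^sup>2 - e\<^sup>2)"
    and x: "e \<le> L2_set x I" "L2_set x I \<le> R"
  shows "measure (lborel_on I) (L2_ball I (\<lambda>_. 0) (r * (1 + 1 / n)) \<inter> L2_ball I x (e * (1 + 1 / n)))
     \<ge> (r * e / R) ^ n * measure (lborel_on I) (L2_ball I (\<lambda>_. 0) 1) / (2 * real n)"
proof -
  let ?L = "lborel_on I"
  have n0: "n > 0" using I n by (simp add: card_gt_0_iff)
  have r2: "r\<^sup>2 + e\<^sup>2 = R\<^sup>2" and r0: "r > 0" using e r by (auto simp: power_strict_mono)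
  have R0: "R > 0" using e by simp
  define h where "h = r * e / R"
  have h0: "h > 0" using r0 e R0 by (simp add: h_def)
  define \<rho> where "\<rho> = L2_set x I"
  have rho: "e \<le> \<rho>" "\<rho> \<le> R" using x by (auto simp: \<rho>_def)
  have rho2: "(\<Sum>i\<in>I. (x i)\<^sup>2) = \<rho>\<^sup>2" unfolding \<rho>_def L2_set_def by (simp add: sum_nonneg)
  define u where "u i = x i / \<rho>" for i
  have u: "(\<Sum>i\<in>I. (u i)\<^sup>2) = 1"
    using rho2 rho e by (simp add: u_def power_divide sum_divide_distrib[symmetric])
  have xu: "x i = \<rho> * u i" for i using rho e by (simp add: u_def)
  \<comment> \<open>\<open>c = k u\<close> is the centre of the disc when \<open>x\<close> has norm
    \<open>R\<close>. For shorter \<open>x\<close> it keeps the distance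
    \<open>e\<^sup>2 / R\<close> from \<open>x\<close> and only moves closer to the origin;
    \<open>k \<ge> 0\<close> is where \<open>e \<le> L2_set x I\<close> enters.\<close>
  define k where "k = \<rho> - e\<^sup>2 / R"
  have "e\<^sup>2 / R \<le> e" using e by (simp add: field_simps power2_eq_square)
  then have k0: "k \<ge> 0" using rho by (simp add: k_def)
  have "R - e\<^sup>2 / R = r\<^sup>2 / R" using r2 R0 by (simp add: field_simps power2_eq_square)
  then have k1: "k \<le> r\<^sup>2 / R" using rho by (simp add: k_def)
  define c where "c i = k * u i" for i
  have two: "2 * r * e \<le> R\<^sup>2" using r2 sum_squares_bound[of r e] by simp
  have hh: "2 * h / R \<le> 1" using two R0 by (simp add: h_def field_simps power2_eq_square)
  let ?S = "{y \<in> L2_ball I c h. \<bar>\<Sum>i\<in>I. u i * (y i - c i)\<bar> \<le> h / real n}"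
  have sub: "?S \<subseteq> L2_ball I (\<lambda>_. 0) (r * (1 + 1 / n)) \<inter> L2_ball I x (e * (1 + 1 / n))"
  proof
    fix z assume z: "z \<in> ?S"
    define \<phi> where "\<phi> = (\<Sum>i\<in>I. u i * (z i - c i))"
    have p: "\<bar>\<phi>\<bar> \<le> h / n" using z by (simp add: \<phi>_def)
    have zc: "(\<Sum>i\<in>I. (z i - c i)\<^sup>2) \<le> h\<^sup>2" using z h0 by (simp add: L2_ball_def L2_set_le_iff)
    \<comment> \<open>The flat disc has measure 0, so it is thickened to a slab. The cross term
      \<open>2 * q * \<phi>\<close> is the price; for both balls it is at most the squared radius
      divided by \<open>n\<close>, since \<open>2 * r * e \<le> R\<^sup>2\<close>. The factors
      \<open>1 + 1 / n\<close> in the radii absorb it.\<close>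
    have gen: "(\<Sum>i\<in>I. (z i - c i + q * u i)\<^sup>2) \<le> h\<^sup>2 + 2 * \<bar>q\<bar> * (h / n) + q\<^sup>2" for q
    proof -
      have "(\<Sum>i\<in>I. (z i - c i + q * u i)\<^sup>2)
          = (\<Sum>i\<in>I. (z i - c i)\<^sup>2 + 2 * q * (u i * (z i - c i)) + q\<^sup>2 * (u i)\<^sup>2)"
        by (rule sum.cong) (auto simp: algebra_simps power2_eq_square)
      also have "\<dots> = (\<Sum>i\<in>I. (z i - c i)\<^sup>2) + 2 * q * \<phi> + q\<^sup>2"
        using u by (simp add: sum.distrib sum_distrib_left[symmetric] \<phi>_def)
      finally have eq: "(\<Sum>i\<in>I. (z i - c i + q * u i)\<^sup>2) = (\<Sum>i\<in>I. (z i - c i)\<^sup>2) + 2 * q * \<phi> + q\<^sup>2" .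
      have "q * \<phi> \<le> \<bar>q\<bar> * (h / n)"
        using p by (metis abs_ge_self abs_ge_zero abs_mult mult_left_mono order_trans)
      then show ?thesis using zc unfolding eq by linarith
    qed
    have fin: "(\<Sum>i\<in>I. (f i)\<^sup>2) \<le> b\<^sup>2 * (1 + 1 / n) \<Longrightarrow> b > 0 \<Longrightarrow> L2_set f I \<le> b * (1 + 1 / n)" for f b
    proof -
      assume a: "(\<Sum>i\<in>I. (f i)\<^sup>2) \<le> b\<^sup>2 * (1 + 1 / n)" "b > 0"
      have "(1 + 1 / real n) \<le> (1 + 1 / real n)\<^sup>2" by (rule self_le_power) auto
      then have "b\<^sup>2 * (1 + 1 / real n) \<le> (b * (1 + 1 / n))\<^sup>2"
        by (simp add: power_mult_distrib mult_left_mono)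
      then show ?thesis using a by (subst L2_set_le_iff) auto
    qed
    have "(\<Sum>i\<in>I. (z i)\<^sup>2) \<le> h\<^sup>2 + 2 * k * (h / n) + k\<^sup>2"
      using gen[of k] k0 by (simp add: c_def)
    also have "\<dots> \<le> h\<^sup>2 + 2 * (r\<^sup>2 / R) * (h / n) + (r\<^sup>2 / R)\<^sup>2"
      using k0 k1 h0 by (intro add_mono mult_right_mono power_mono) auto
    also have "\<dots> = r\<^sup>2 * ((e\<^sup>2 + r\<^sup>2) / R\<^sup>2) + r\<^sup>2 * (2 * h / R) / n"
      using R0 by (simp add: h_def field_simps power2_eq_square)
    also have "\<dots> = r\<^sup>2 + r\<^sup>2 * (2 * h / R) / n" using r2 R0 by (simp add: add.commute)
    also have "\<dots> \<le> r\<^sup>2 + r\<^sup>2 * 1 / n"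
      using hh by (intro add_left_mono divide_right_mono mult_left_mono) auto
    finally have A: "L2_set z I \<le> r * (1 + 1 / n)"
      using r0 by (intro fin) (auto simp: algebra_simps)
    have "(\<Sum>i\<in>I. (z i - x i)\<^sup>2) = (\<Sum>i\<in>I. (z i - c i + (- (e\<^sup>2 / R)) * u i)\<^sup>2)"
      by (rule sum.cong) (auto simp: c_def xu k_def algebra_simps)
    also have "\<dots> \<le> h\<^sup>2 + 2 * (e\<^sup>2 / R) * (h / n) + (e\<^sup>2 / R)\<^sup>2"
      using gen[of "- (e\<^sup>2 / R)"] R0 by simp
    also have "\<dots> = e\<^sup>2 * ((r\<^sup>2 + e\<^sup>2) / R\<^sup>2) + e\<^sup>2 * (2 * h / R) / n"
      using R0 by (simp add: h_def field_simps power2_eq_square)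
    also have "\<dots> = e\<^sup>2 + e\<^sup>2 * (2 * h / R) / n" using r2 R0 by (simp add: add.commute)
    also have "\<dots> \<le> e\<^sup>2 + e\<^sup>2 * 1 / n"
      using hh by (intro add_left_mono divide_right_mono mult_left_mono) auto
    finally have B: "L2_set (\<lambda>i. z i - x i) I \<le> e * (1 + 1 / n)"
      using e by (intro fin) (auto simp: algebra_simps)
    show "z \<in> L2_ball I (\<lambda>_. 0) (r * (1 + 1 / n)) \<inter> L2_ball I x (e * (1 + 1 / n))"
      using A B z by (auto simp: L2_ball_def)
  qed
  have Sm: "?S \<in> sets ?L"
  proof -
    have "?S = L2_ball I c h \<inter> {y \<in> space ?L. \<bar>\<Sum>i\<in>I. u i * (y i - c i)\<bar> \<le> h / real n}"
      by (auto simp: L2_ball_def)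
    also have "\<dots> \<in> sets ?L" using I by measurable
    finally show ?thesis .
  qed
  have "h ^ n * measure ?L (L2_ball I (\<lambda>_. 0) 1) / (2 * real n) = measure ?L (L2_ball I c h) / (2 * real n)"
    by (simp add: measure_L2_ball[OF I(1) h0] n)
  also have "\<dots> \<le> measure ?L ?S" by (rule measure_slab_ge[OF I n h0 u])
  also have "\<dots> \<le> measure ?L (L2_ball I (\<lambda>_. 0) (r * (1 + 1 / n)) \<inter> L2_ball I x (e * (1 + 1 / n)))"
    using r0 I by (intro measure_mono_fmeasurable[OF sub Sm] fmeasurable_Int_fmeasurable L2_ball_fmeasurable L2_ball_measurable)
       (auto intro!: mult_pos_pos add_pos_nonneg)
  finally show ?thesis by (simp add: h_def)
qed

text \<open>A cubic grid with step \<open>d / n\<close> is wasteful but sufficient: rounding each of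
  \<open>n\<close> coordinates moves a point by at most \<open>d\<close> even in the L1 norm, and
  only the logarithm of the grid size will matter.\<close>

lemma L2_ball_grid:
  assumes I: "finite I" "I \<noteq> {}" and n: "n = card I" and d: "d > 0" and R: "R > 0"
  obtains G where "finite G" "card G > 0" "ln (real (card G)) \<le> real n * (2 * (R * n / d + 1))"
    "\<And>x. L2_set x I \<le> R \<Longrightarrow> \<exists>g\<in>G. L2_set (\<lambda>i. x i - g i) I \<le> d"
proof -
  have n0: "n > 0" using I n by (simp add: card_gt_0_iff)
  define m where "m = nat \<lceil>R * n / d\<rceil>"
  have m: "R * n / d \<le> real m" "real m \<le> R * n / d + 1"
  proof -
    have "R * n / d \<ge> 0" using R d by simp
    then show "R * n / d \<le> real m" "real m \<le> R * n / d + 1" unfolding m_def by linarith+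
  qed
  define P where "P = Pi\<^sub>E I (\<lambda>_. {- int m..int m})"
  define G where "G = (\<lambda>k i. (d / n) * real_of_int (k i)) ` P"
  have finP: "finite P" unfolding P_def using I by (intro finite_PiE) auto
  have cardP: "card P = (2 * m + 1) ^ n"
    unfolding P_def n using I by (simp add: card_PiE nat_add_distrib nat_mult_distrib)
  have finG: "finite G" using finP by (simp add: G_def)
  have "P \<noteq> {}" using cardP by auto
  then have cG: "card G > 0" unfolding G_def using finP by (simp add: card_gt_0_iff)
  have "ln (real (card G)) \<le> ln (real (card P))"
    using cG card_image_le[OF finP] unfolding G_def by (subst ln_le_cancel_iff) (auto simp: card_gt_0_iff finP)
  also have "\<dots> = n * ln (1 + 2 * real m)" unfolding cardP by (simp add: ln_realpow add.commute)
  also have "\<dots> \<le> n * (2 * real m)" by (intro mult_left_mono ln_add_one_self_le_self) auto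
  also have "\<dots> \<le> n * (2 * (R * n / d + 1))" using m by (intro mult_left_mono) auto
  finally have lnG: "ln (real (card G)) \<le> real n * (2 * (R * n / d + 1))" .
  have cover: "\<exists>g\<in>G. L2_set (\<lambda>i. x i - g i) I \<le> d" if x: "L2_set x I \<le> R" for x
  proof -
    define k where "k = (\<lambda>i\<in>I. \<lfloor>x i * n / d\<rfloor>)"
    have xi: "\<bar>x i\<bar> \<le> R" if "i \<in> I" for i
    proof -
      have "L2_set x I = L2_set (\<lambda>i. \<bar>x i\<bar>) I" by (simp add: L2_set_def)
      then show ?thesis using member_le_L2_set[OF I(1) that, of "\<lambda>i. \<bar>x i\<bar>"] x by simp
    qed
    have "k i \<in> {- int m..int m}" if "i \<in> I" for i
    proof -
      have "\<bar>x i * n / d\<bar> \<le> R * n / d"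
        using xi[OF that] d n0 by (simp add: abs_mult divide_right_mono mult_right_mono)
      then have "- real m \<le> x i * n / d" "x i * n / d \<le> real m" using m(1) by linarith+
      then show ?thesis using that unfolding k_def by (auto simp: le_floor_iff floor_le_iff)
    qed
    then have kP: "k \<in> P" unfolding P_def k_def by auto
    have "\<bar>x i - (d / n) * real_of_int (k i)\<bar> \<le> d / n" if "i \<in> I" for i
    proof -
      have "\<bar>x i * n / d - real_of_int (k i)\<bar> \<le> 1" using that unfolding k_def by (simp, linarith)
      moreover have "x i - (d / n) * real_of_int (k i) = (d / n) * (x i * n / d - real_of_int (k i))"
        using d n0 by (simp add: field_simps)
      ultimately show ?thesis using d n0 by (simp add: abs_mult mult_le_cancel_left1 divide_right_mono)
    qed
    then have "(\<Sum>i\<in>I. \<bar>x i - (d / n) * real_of_int (k i)\<bar>) \<le> (\<Sum>i\<in>I. d / n)" by (intro sum_mono)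
    also have "\<dots> = d" using n0 n by simp
    finally have "L2_set (\<lambda>i. x i - (d / n) * real_of_int (k i)) I \<le> d"
      by (rule order_trans[OF L2_set_le_sum_abs])
    moreover have "(\<lambda>i. (d / n) * real_of_int (k i)) \<in> G" using kP unfolding G_def by (rule imageI)
    ultimately show ?thesis by (rule bexI)
  qed
  show thesis by (rule that[OF finG cG lnG cover])
qed

section \<open>Covering a ball with polynomial loss\<close>

lemma one_plus_over_power_le: "n > 0 \<Longrightarrow> x \<ge> 0 \<Longrightarrow> (1 + x / real n) ^ n \<le> exp x"
proof -
  assume "n > 0" "x \<ge> 0"
  then have "(1 + x / real n) ^ n \<le> exp (x / real n) ^ n" by (intro power_mono) auto
  also have "\<dots> = exp x" using \<open>n > 0\<close> by (simp add: exp_of_nat_mult[symmetric])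
  finally show ?thesis .
qed

text \<open>The roles are exchanged: a centre serves the net point \<open>f\<close> when it lies in
  the ball \<open>U f\<close>, and every \<open>U f\<close> fills a fraction of at least about
  \<open>(e / R) ^ n\<close> of the ball \<open>A\<close> of possible centres. Enlarging radii by
  factors \<open>1 + O (1 / n)\<close> changes \<open>n\<close>-th powers by constants only. The
  exponent \<open>n + 1\<close> instead of \<open>n\<close> comes from the factor
  \<open>R / eps\<close> in the logarithm of the net size.\<close>

lemma L2_ball_cover:
  fixes I :: "nat set"
  assumes I: "finite I" "I \<noteq> {}" and n: "n = card I" and eps: "0 < eps" "eps \<le> R"
  obtains C where "finite C" "real (card C) \<le> 1000 * real n ^ 4 * (R / eps) ^ (n + 1)"
    "\<And>x. L2_set x I \<le> R \<Longrightarrow> \<exists>c\<in>C. L2_set (\<lambda>i. x i - c i) I \<le> eps"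
proof -
  have n0: "n > 0" using I n by (simp add: card_gt_0_iff)
  then have n1: "real n \<ge> 1" by simp
  \<comment> \<open>The room \<open>2 / n\<close> is shared by the enlarged radius
    \<open>e * (1 + 1 / n)\<close> of \<open>U f\<close> and the mesh \<open>2 * d = e / n\<close>
    of the net.\<close>
  define e where "e = eps / (1 + 2 / n)"
  have e0: "e > 0" using eps by (simp add: e_def add_pos_nonneg)
  have eeps: "e * (1 + 2 / n) = eps"
  proof -
    have "1 + 2 / real n > 0" by (simp add: add_pos_nonneg)
    then show ?thesis by (simp add: e_def)
  qed
  have "e < e * (1 + 2 / n)" using e0 n0 by simp
  then have eR: "e < R" using eeps eps by simp
  define d where "d = e / (2 * n)"
  have d0: "d > 0" using e0 n0 by (simp add: d_def)
  \<comment> \<open>The lens estimate requires norm at least \<open>e\<close>; shorter vectors are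
    covered by the centre 0, added in \<open>C'\<close>.\<close>
  define S where "S = {x. e \<le> L2_set x I \<and> L2_set x I \<le> R}"
  define Q where "Q = R / eps"
  have Q1: "Q \<ge> 1" using eps by (simp add: Q_def)
  have R0: "R > 0" using eps by simp
  obtain G where G: "finite G" "card G > 0" "ln (real (card G)) \<le> real n * (2 * (R * n / d + 1))"
    "\<And>x. L2_set x I \<le> R \<Longrightarrow> \<exists>g\<in>G. L2_set (\<lambda>i. x i - g i) I \<le> d"
    using L2_ball_grid[OF I n d0 R0] by metis
  define rep where "rep g = (SOME x. x \<in> S \<and> L2_set (\<lambda>i. x i - g i) I \<le> d)" for g
  define G' where "G' = {g\<in>G. \<exists>x. x \<in> S \<and> L2_set (\<lambda>i. x i - g i) I \<le> d}"
  define F where "F = rep ` G'"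
  have rep: "rep g \<in> S \<and> L2_set (\<lambda>i. rep g i - g i) I \<le> d" if "g \<in> G'" for g
  proof -
    have "\<exists>x. x \<in> S \<and> L2_set (\<lambda>i. x i - g i) I \<le> d" using that by (simp add: G'_def)
    then show ?thesis unfolding rep_def by (rule someI_ex)
  qed
  have finF: "finite F" unfolding F_def G'_def using G(1) by auto
  have cardF: "card F \<le> card G"
    unfolding F_def by (rule order_trans[OF card_image_le card_mono]) (use G(1) in \<open>auto simp: G'_def\<close>)
  have FS: "F \<subseteq> S" using rep by (auto simp: F_def)
  have Fnet: "\<exists>f\<in>F. L2_set (\<lambda>i. x i - f i) I \<le> 2 * d" if "x \<in> S" for x
  proof -
    obtain g where g: "g \<in> G" "L2_set (\<lambda>i. x i - g i) I \<le> d" using G(4) \<open>x \<in> S\<close> by (auto simp: S_def)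
    then have g': "g \<in> G'" using \<open>x \<in> S\<close> by (auto simp: G'_def)
    have "L2_set (\<lambda>i. x i - rep g i) I \<le> L2_set (\<lambda>i. x i - g i) I + L2_set (\<lambda>i. g i - rep g i) I"
      by (rule L2_set_triangle3)
    also have "\<dots> \<le> 2 * d" using g(2) rep[OF g'] L2_set_minus_commute[of g "rep g" I] by simp
    finally show ?thesis using g' by (auto simp: F_def)
  qed
  define r where "r = sqrt (R\<^sup>2 - e\<^sup>2)"
  have r0: "r > 0" using e0 eR by (simp add: r_def power_strict_mono)
  define L where "L = lborel_on I"
  define A where "A = L2_ball I (\<lambda>_. 0) (r * (1 + 1 / n))"
  define U where "U f = L2_ball I f (e * (1 + 1 / n))" for f
  define V where "V = measure L (L2_ball I (\<lambda>_. 0) 1)"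
  have V0: "V > 0" unfolding V_def L_def by (rule measure_L2_unit_ball_pos[OF I(1)])
  have t0: "1 + 1 / real n > 0" by (simp add: add_pos_nonneg)
  \<comment> \<open>\<open>6 * n\<close> is \<open>2 * n\<close> from the slab times 3, a bound for
    the factor \<open>(1 + 1 / n) ^ n\<close> by which the enlarged radius raises the volume of
    \<open>A\<close>.\<close>
  define p where "p = (e / R) ^ n / (6 * n)"
  have p0: "p > 0" using e0 R0 n0 by (simp add: p_def)
  have "(e / R) ^ n \<le> 1" using e0 eR by (intro power_le_one) auto
  then have p1: "p \<le> 1" using n1 by (simp add: p_def divide_le_eq)
  have mA: "measure L A = r ^ n * (1 + 1 / n) ^ n * V"
    unfolding A_def L_def V_def using measure_L2_ball[OF I(1), of "r * (1 + 1 / n)"] r0 t0 n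
    by (simp add: power_mult_distrib)
  have mA0: "measure L A > 0" unfolding mA using r0 t0 V0 by simp
  have Af: "A \<in> fmeasurable L" unfolding A_def L_def using r0 t0 I by (intro L2_ball_fmeasurable) auto
  have e3: "(1 + 1 / real n) ^ n \<le> 3"
    using one_plus_over_power_le[OF n0, of 1] exp_le by simp
  have pU: "p * measure L A \<le> measure L (A \<inter> U f)" if "f \<in> F" for f
  proof -
    have "p * measure L A = ((r * e / R) ^ n * V / (2 * n)) * ((1 + 1 / n) ^ n / 3)"
      unfolding p_def mA by (simp add: power_mult_distrib power_divide mult_ac)
    also have "\<dots> \<le> ((r * e / R) ^ n * V / (2 * n)) * 1"
      using e3 r0 e0 R0 V0 by (intro mult_left_mono) auto
    also have "\<dots> \<le> measure L (A \<inter> U f)"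
      using measure_lens_ge[OF I n e0 eR r_def, of f] that FS
      unfolding A_def U_def L_def V_def S_def by auto
    finally show ?thesis .
  qed
  have "\<exists>C. finite C \<and> real (card C) \<le> ln (real (card G)) / p + 2 \<and> (\<forall>f\<in>F. \<exists>c\<in>C. c \<in> U f)"
  proof (cases "F = {}")
    case True
    then show ?thesis using G(2) p0 by (intro exI[of _ "{}"]) auto
  next
    case False
    then have cF: "card F > 0" using finF by (simp add: card_gt_0_iff)
    obtain C where C: "finite C" "real (card C) \<le> ln (real (card F)) / p + 2" "\<forall>f\<in>F. \<exists>c\<in>C. c \<in> U f"
      using greedy_hitting_set[OF Af mA0 finF cF, of U p] pU p0 p1 I(1)
      unfolding U_def L_def by (auto simp: L2_ball_measurable)
    have "ln (real (card F)) / p \<le> ln (real (card G)) / p"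
      using cardF cF p0 by (intro divide_right_mono) auto
    then show ?thesis using C by (intro exI[of _ C]) auto
  qed
  then obtain C where C: "finite C" "real (card C) \<le> ln (real (card G)) / p + 2" "\<forall>f\<in>F. \<exists>c\<in>C. c \<in> U f"
    by blast
  define C' where "C' = insert (\<lambda>_. 0) C"
  have "1 / e = (1 + 2 / n) / eps" using eps by (simp add: e_def)
  then have "R * (1 / e) = R * ((1 + 2 / n) / eps)" by (rule arg_cong)
  then have Re: "R / e = Q * (1 + 2 / n)" by (simp add: Q_def)
  have "1 + 2 / real n \<le> 3" using n1 by (simp add: field_simps)
  then have Re3: "R / e \<le> 3 * Q" unfolding Re using Q1 by (simp add: mult.commute)
  have e9: "(1 + 2 / real n) ^ n \<le> 9"
  proof -
    have "exp (2::real) = exp 1 * exp 1" by (simp add: exp_add[symmetric])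
    also have "\<dots> \<le> 3 * 3" using exp_le by (intro mult_mono) auto
    finally show ?thesis using one_plus_over_power_le[OF n0, of 2] by simp
  qed
  have n2: "real n \<le> real n ^ 3" using n1 self_le_power[of "real n" 3] by simp
  have "real n * (2 * (R * n / d + 1)) = real n * (4 * (R / e) * real n ^ 2 + 2)"
    using n0 e0 by (simp add: d_def field_simps power2_eq_square)
  also have "\<dots> \<le> real n * (4 * (3 * Q) * real n ^ 2 + 2)"
    using Re3 by (intro mult_left_mono add_right_mono mult_right_mono) auto
  also have "\<dots> = 12 * Q * real n ^ 3 + 2 * real n" by (simp add: algebra_simps power2_eq_square power3_eq_cube)
  also have "\<dots> \<le> 12 * Q * real n ^ 3 + 2 * (Q * real n ^ 3)"
    using n2 Q1 mult_mono[of 1 Q "real n" "real n ^ 3"] by simp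
  finally have lnG: "ln (real (card G)) \<le> 14 * Q * real n ^ 3" using G(3) by simp
  have ip: "1 / p = 6 * n * (Q ^ n * (1 + 2 / n) ^ n)"
    unfolding p_def power_mult_distrib[symmetric] Re[symmetric] by (simp add: power_divide)
  have "ln (real (card G)) / p \<le> (14 * Q * real n ^ 3) * (1 / p)"
    using lnG p0 by (simp add: divide_right_mono)
  also have "\<dots> \<le> (14 * Q * real n ^ 3) * (6 * n * (Q ^ n * 9))"
    unfolding ip using e9 Q1 by (intro mult_left_mono) auto
  also have "\<dots> = 756 * (real n ^ 4 * Q ^ (n + 1))" by (simp add: algebra_simps power4_eq_xxxx power3_eq_cube)
  finally have "real (card C) \<le> 756 * (real n ^ 4 * Q ^ (n + 1)) + 2" using C(2) by linarith
  moreover have "real n ^ 4 * Q ^ (n + 1) \<ge> 1"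
    using mult_mono[OF one_le_power[OF n1, of 4] one_le_power[OF Q1, of "n+1"]] by simp
  moreover have "real (card C') \<le> real (card C) + 1"
    unfolding C'_def using C(1) by (simp add: card_insert_if)
  \<comment> \<open>\<open>756 = 14 * 6 * 9\<close>; the 2 of the greedy bound and the extra centre
    0 fit below 1000 because \<open>real n ^ 4 * Q ^ (n + 1) \<ge> 1\<close>.\<close>
  ultimately have card: "real (card C') \<le> 1000 * real n ^ 4 * (R / eps) ^ (n + 1)" unfolding Q_def by linarith
  have cover: "\<exists>c\<in>C'. L2_set (\<lambda>i. x i - c i) I \<le> eps" if x: "L2_set x I \<le> R" for x
  proof (cases "L2_set x I < e")
    case True
    have "e \<le> eps" using eeps \<open>e < e * (1 + 2 / n)\<close> by simp
    then show ?thesis using True unfolding C'_def by (intro bexI[of _ "\<lambda>_. 0"]) auto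
  next
    case False
    then have "x \<in> S" using x by (simp add: S_def)
    then obtain f where f: "f \<in> F" "L2_set (\<lambda>i. x i - f i) I \<le> 2 * d" using Fnet by blast
    then obtain c where c: "c \<in> C" "c \<in> U f" using C(3) by blast
    have "L2_set (\<lambda>i. x i - c i) I \<le> L2_set (\<lambda>i. x i - f i) I + L2_set (\<lambda>i. f i - c i) I"
      by (rule L2_set_triangle3)
    also have "L2_set (\<lambda>i. f i - c i) I \<le> e * (1 + 1 / n)"
      using c(2) L2_set_minus_commute[of f c I] by (simp add: U_def L2_ball_def)
    also have "L2_set (\<lambda>i. x i - f i) I \<le> e / n" using f(2) by (simp add: d_def)
    also have "e / n + e * (1 + 1 / n) = eps" unfolding eeps[symmetric] by (simp add: algebra_simps)
    finally show ?thesis using c(1) by (auto simp: C'_def)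
  qed
  show thesis by (rule that[OF _ card cover]) (use C(1) in \<open>auto simp: C'_def\<close>)
qed

section \<open>Entropy bounds for diagonal operators\<close>

text \<open>Pythagoras with the energy outside \<open>I\<close> kept as a remainder, so completeness
  of \<open>e\<close> is not presupposed. With \<open>y = 0\<close> it gives norms of finite sums,
  with \<open>a\<close> the coefficients of \<open>y\<close> it gives Bessel's inequality.\<close>

lemma norm_diff_orthonormal_sum:
  fixes e :: "nat \<Rightarrow> 'a::real_inner"
  assumes e: "\<And>m n. inner (e m) (e n) = (if m = n then 1 else 0)" and I: "finite I"
  shows "(norm (y - (\<Sum>i\<in>I. a i *\<^sub>R e i)))\<^sup>2
     = (norm y)\<^sup>2 - (\<Sum>i\<in>I. (inner y (e i))\<^sup>2) + (\<Sum>i\<in>I. (inner y (e i) - a i)\<^sup>2)"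
proof -
  let ?s = "\<Sum>i\<in>I. a i *\<^sub>R e i"
  have ys: "inner y ?s = (\<Sum>i\<in>I. a i * inner y (e i))"
    by (simp add: inner_sum_right)
  have "inner ?s ?s = (\<Sum>i\<in>I. a i * inner (e i) ?s)"
    by (simp add: inner_sum_left)
  also have "\<dots> = (\<Sum>i\<in>I. a i * a i)"
  proof (rule sum.cong)
    fix i assume "i \<in> I"
    have "inner (e i) ?s = (\<Sum>j\<in>I. if i = j then a j else 0)"
      unfolding inner_sum_right by (rule sum.cong) (auto simp: e)
    then show "a i * inner (e i) ?s = a i * a i" using I \<open>i \<in> I\<close> by simp
  qed simp
  finally have ss: "inner ?s ?s = (\<Sum>i\<in>I. a i * a i)" .
  have "(norm (y - ?s))\<^sup>2 = inner y y - 2 * inner y ?s + inner ?s ?s"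
    by (simp add: power2_norm_eq_inner inner_diff_left inner_diff_right inner_commute)
  also have "\<dots> = inner y y + (\<Sum>i\<in>I. (inner y (e i) - a i)\<^sup>2 - (inner y (e i))\<^sup>2)"
    unfolding ys ss by (simp add: sum_distrib_left sum.distrib[symmetric] sum_subtractf[symmetric]
        power2_eq_square algebra_simps)
  finally show ?thesis by (simp add: power2_norm_eq_inner sum_subtractf)
qed

lemma bessel_inequality:
  fixes e :: "nat \<Rightarrow> 'a::real_inner"
  assumes e: "\<And>m n. inner (e m) (e n) = (if m = n then 1 else 0)" and I: "finite I"
  shows "(\<Sum>i\<in>I. (inner y (e i))\<^sup>2) \<le> (norm y)\<^sup>2"
  using norm_diff_orthonormal_sum[OF e I, of y "\<lambda>i. inner y (e i)"]
    zero_le_power2[of "norm (y - (\<Sum>i\<in>I. inner y (e i) *\<^sub>R e i))"] by simp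

section \<open>Covering numbers of compact sets\<close>

lemma compact_finite_cball_cover:
  fixes S :: "'a::metric_space set"
  assumes "compact S" "eps > 0"
  shows "\<exists>C. finite C \<and> S \<subseteq> (\<Union>c\<in>C. cball c eps)"
proof -
  have "S \<subseteq> (\<Union>c\<in>S. ball c eps)" using assms(2) by auto
  then obtain C where "C \<subseteq> S" "finite C" "S \<subseteq> (\<Union>c\<in>C. ball c eps)"
    using compactE_image[OF assms(1), of S "\<lambda>c. ball c eps"] by auto
  moreover have "(\<Union>c\<in>C. ball c eps) \<subseteq> (\<Union>c\<in>C. cball c eps)" by (intro UN_mono ball_subset_cball) simp
  ultimately show ?thesis by (meson order_trans)
qed

text \<open>The \<open>LEAST\<close> in the definition describes an actual cover only once some
  finite cover exists, which is what compactness supplies.\<close>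

lemma covering_number_attained:
  fixes S :: "'a::metric_space set"
  assumes "compact S" "eps > 0"
  obtains C where "finite C" "card C = covering_number eps S" "S \<subseteq> (\<Union>c\<in>C. cball c eps)"
proof -
  have "\<exists>N C. finite C \<and> card C = N \<and> S \<subseteq> (\<Union>c\<in>C. cball c eps)"
    using compact_finite_cball_cover[OF assms] by auto
  then have "\<exists>C. finite C \<and> card C = covering_number eps S \<and> S \<subseteq> (\<Union>c\<in>C. cball c eps)"
    unfolding covering_number_def by (rule LeastI_ex)
  then show thesis using that by blast
qed

lemma covering_number_le:
  assumes "finite C" "S \<subseteq> (\<Union>c\<in>C. cball c eps)"
  shows "covering_number eps S \<le> card C"
  unfolding covering_number_def using assms by (intro Least_le) auto

lemma covering_number_antimono:
  fixes S :: "'a::metric_space set"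
  assumes "compact S" "0 < eps" "eps \<le> eps'"
  shows "covering_number eps' S \<le> covering_number eps S"
proof -
  obtain C where C: "finite C" "card C = covering_number eps S" "S \<subseteq> (\<Union>c\<in>C. cball c eps)"
    using covering_number_attained[OF assms(1,2)] by blast
  have "S \<subseteq> (\<Union>c\<in>C. cball c eps')" 
  proof
    fix x assume "x \<in> S"
    then obtain c where "c \<in> C" "dist c x \<le> eps" using C(3) by auto
    then show "x \<in> (\<Union>c\<in>C. cball c eps')" using assms(3) by (auto intro!: bexI[of _ c])
  qed
  then show ?thesis using covering_number_le[OF C(1)] C(2) by metis
qed

lemma covering_number_pos:
  fixes S :: "'a::metric_space set"
  assumes "compact S" "S \<noteq> {}" "0 < eps"
  shows "covering_number eps S > 0"
proof -
  obtain C where C: "finite C" "card C = covering_number eps S" "S \<subseteq> (\<Union>c\<in>C. cball c eps)"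
    using covering_number_attained[OF assms(1,3)] by blast
  then have "C \<noteq> {}" using assms(2) by auto
  then show ?thesis using C by (metis card_gt_0_iff)
qed

text \<open>\<open>tail_bound\<close> carries all the spectral information beyond the eigenvectors
  themselves. Indices start at 0, so that \<open>{..<d}\<close> are the first \<open>d\<close> axes
  and \<open>mu d\<close> bounds everything after them.\<close>

locale diagonal_operator =
  fixes T :: "'a::real_inner \<Rightarrow> 'a" and e :: "nat \<Rightarrow> 'a" and mu :: "nat \<Rightarrow> real"
  assumes compact_op: "compact_operator T"
    and selfadjoint: "inner (T x) y = inner x (T y)"
    and orthonormal: "inner (e m) (e n) = (if m = n then 1 else 0)"
    and eigen: "T (e n) = mu n *\<^sub>R e n"
    and mu_pos: "mu n > 0" and mu_antimono: "m \<le> n \<Longrightarrow> mu n \<le> mu m"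
    and tail_bound: "(\<And>n. n < D \<Longrightarrow> inner x (e n) = 0) \<Longrightarrow> norm (T x) \<le> mu D * norm x"
begin

abbreviation "K \<equiv> closure (T ` cball 0 1)"

lemma bounded_linear_T: "bounded_linear T" and compact_K: "compact K"
  using compact_op unfolding compact_operator_def by auto

sublocale T: bounded_linear T by (rule bounded_linear_T)

lemma mu_nonzero: "mu n \<noteq> 0" using mu_pos[of n] by simp

lemma K_nonempty: "K \<noteq> {}" by auto

text \<open>Taking the first \<open>d\<close> coordinates does not increase distances, by Bessel,
  and every point of the ellipsoid is reached from \<open>K\<close>; so a cover of \<open>K\<close>
  projects to a cover of the ellipsoid with no more elements. The dimension \<open>d\<close> remains
  free.\<close>

lemma entropy_lower_bound:
  assumes eps: "eps > 0"
  shows "(\<Sum>n<d. ln (mu n / eps)) \<le> ln (real (covering_number eps K))"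
proof -
  let ?N = "covering_number eps K"
  obtain C where C: "finite C" "card C = ?N" "K \<subseteq> (\<Union>c\<in>C. cball c eps)"
    using covering_number_attained[OF compact_K eps] by blast
  define C' where "C' = (\<lambda>c i. inner c (e i)) ` C"
  have "\<exists>c\<in>C'. L2_set (\<lambda>i. x i - c i) {..<d} \<le> eps" if x: "x \<in> ellipsoid {..<d} mu" for x
  proof -
    define v where "v = (\<Sum>i<d. (x i / mu i) *\<^sub>R e i)"
    have "(norm v)\<^sup>2 = (\<Sum>i<d. (x i / mu i)\<^sup>2)"
      using norm_diff_orthonormal_sum[OF orthonormal, of "{..<d}" 0 "\<lambda>i. x i / mu i"] by (simp add: v_def)
    also have "\<dots> \<le> 1" using x by (simp add: ellipsoid_def L2_set_le_iff)
    finally have "norm v \<le> 1" by (simp add: power_le_one_iff abs_square_le_1)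
    then have "T v \<in> K" by (intro subsetD[OF closure_subset] imageI) simp
    then obtain c where c: "c \<in> C" "norm (T v - c) \<le> eps"
      using C(3) by (auto simp: dist_norm norm_minus_commute)
    have Tv: "T v = (\<Sum>i<d. x i *\<^sub>R e i)" unfolding v_def by (simp add: T.sum T.scaleR eigen mu_nonzero)
    have "inner (T v) (e i) = x i" if "i < d" for i
    proof -
      have "inner (T v) (e i) = (\<Sum>j<d. if j = i then x j else 0)"
        unfolding Tv inner_sum_left by (rule sum.cong) (auto simp: orthonormal)
      then show ?thesis using that by simp
    qed
    then have "(\<Sum>i<d. (x i - inner c (e i))\<^sup>2) = (\<Sum>i<d. (inner (T v - c) (e i))\<^sup>2)"
      by (intro sum.cong) (auto simp: inner_diff_left)
    also have "\<dots> \<le> (norm (T v - c))\<^sup>2" by (rule bessel_inequality[OF orthonormal]) simp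
    also have "\<dots> \<le> eps\<^sup>2" using c by (intro power_mono) auto
    finally have "L2_set (\<lambda>i. x i - inner c (e i)) {..<d} \<le> eps" using eps by (simp add: L2_set_le_iff)
    then show ?thesis unfolding C'_def using c(1) by (rule_tac x="\<lambda>i. inner c (e i)" in bexI) auto
  qed
  then have "(\<Prod>i<d. mu i) \<le> real (card C') * eps ^ card {..<d}"
    using C(1) mu_pos eps by (intro ellipsoid_cover_card_ge) (auto simp: C'_def)
  also have "\<dots> \<le> real ?N * eps ^ d"
    using card_image_le[OF C(1), of "\<lambda>c i. inner c (e i)"] C(2) eps
    by (intro mult_mono) (auto simp: C'_def)
  finally have "(\<Prod>i<d. mu i) / eps ^ d \<le> real ?N" using eps by (simp add: divide_le_eq)
  then have "(\<Prod>i<d. mu i / eps) \<le> real ?N" by (simp add: prod_dividef)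
  moreover have "(\<Prod>i<d. mu i / eps) > 0" using mu_pos eps by (intro prod_pos) auto
  ultimately have "ln (\<Prod>i<d. mu i / eps) \<le> ln (real ?N)" by (simp add: ln_le_cancel_iff)
  moreover have "ln (\<Prod>i<d. mu i / eps) = (\<Sum>i<d. ln (mu i / eps))"
    using mu_nonzero eps by (intro ln_prod) auto
  ultimately show ?thesis by simp
qed

text \<open>The image of the unit ball is cut into \<open>k\<close> blocks of \<open>q\<close> coordinates and a tail. A block
  that carries the part \<open>w\<close> of the total energy lies in a ball of radius \<open>sqrt w a\<close> and is covered
  with precision \<open>sqrt w \<delta>\<close>, so the number of balls needed does not depend on \<open>w\<close>, while the
  squared errors add up to \<open>\<delta>\<^sup>2\<close>. The energies are rounded up to multiples of \<open>1 / M\<close>.\<close>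

lemma covering_number_block_bound:
  assumes q: "q > 0" and M: "M > 0" and \<delta>: "\<delta> > 0" and D: "mu (k * q) \<le> \<delta>"
  shows "real (covering_number (\<delta> * sqrt (1 + real k / real M)) K) \<le>
    (real M + 1) ^ k * (\<Prod>b<k. 1000 * real q ^ 4 * (max (mu (b * q)) \<delta> / \<delta>) ^ (q + 1))"
proof -
  define I where "I b = {b * q..<b * q + q}" for b
  \<comment> \<open>Blocks whose axes are already shorter than \<open>\<delta>\<close> get the
    radius \<open>\<delta>\<close>, since the ball covering needs a radius not below the
    precision.\<close>
  define a where "a b = max (mu (b * q)) \<delta>" for b
  have I: "finite (I b)" "I b \<noteq> {}" "q = card (I b)" for b using q by (auto simp: I_def)
  have a: "\<delta> \<le> a b" "0 < a b" for b using \<delta> by (auto simp: a_def)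
  have "\<exists>C. finite C \<and> real (card C) \<le> 1000 * real q ^ 4 * (a b / \<delta>) ^ (q + 1) \<and>
     (\<forall>x. L2_set x (I b) \<le> a b \<longrightarrow> (\<exists>c\<in>C. L2_set (\<lambda>i. x i - c i) (I b) \<le> \<delta>))" for b
    using L2_ball_cover[OF I \<delta> a(1)[of b]] by metis
  then obtain C where C: "\<And>b. finite (C b)" "\<And>b. real (card (C b)) \<le> 1000 * real q ^ 4 * (a b / \<delta>) ^ (q + 1)"
    "\<And>b x. L2_set x (I b) \<le> a b \<Longrightarrow> \<exists>c\<in>C b. L2_set (\<lambda>i. x i - c i) (I b) \<le> \<delta>"
    by metis
  define J where "J = Pi\<^sub>E {..<k} (\<lambda>_. {0..M})"
  define P where "P = Pi\<^sub>E {..<k} C"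
  define coef where "coef j c i = sqrt (real (j (i div q)) / real M) * c (i div q) i"
    for j :: "nat \<Rightarrow> nat" and c :: "nat \<Rightarrow> nat \<Rightarrow> real" and i :: nat
  define cent where "cent j c = (\<Sum>i<k * q. coef j c i *\<^sub>R e i)" for j c
  define Z where "Z = (\<lambda>(j, c). cent j c) ` (J \<times> P)"
  have finJ: "finite J" "finite P" unfolding J_def P_def using C(1) by (auto intro: finite_PiE)
  have divq: "i div q = b" if "i \<in> I b" for i b
    using that unfolding I_def by (intro div_nat_eqI) (auto simp: algebra_simps)
  have group: "(\<Sum>i<k * q. f i) = (\<Sum>b<k. \<Sum>i\<in>I b. f i)" for f :: "nat \<Rightarrow> real"
    unfolding I_def by (rule sum.nat_group[symmetric])
  have cover: "\<exists>z\<in>Z. norm (T x - z) \<le> \<delta> * sqrt (1 + real k / real M)" if x: "norm x \<le> 1" for x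
  proof -
    define xc where "xc i = inner x (e i)" for i
    define y where "y i = inner (T x) (e i)" for i
    have yx: "y i = mu i * xc i" for i
      unfolding y_def xc_def using selfadjoint[of x "e i"] by (simp add: eigen)
    \<comment> \<open>Energy of the block relative to its largest admissible radius. As
      \<open>mu i \<le> a b\<close> on the block, it is at most the energy of \<open>x\<close>
      there, so the weights sum to at most 1.\<close>
    define w where "w b = (\<Sum>i\<in>I b. (y i)\<^sup>2) / (a b)\<^sup>2" for b
    have w0: "w b \<ge> 0" for b by (simp add: w_def sum_nonneg)
    have wx: "w b \<le> (\<Sum>i\<in>I b. (xc i)\<^sup>2)" for b
    proof -
      have "(\<Sum>i\<in>I b. (y i)\<^sup>2) \<le> (\<Sum>i\<in>I b. (a b)\<^sup>2 * (xc i)\<^sup>2)"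
      proof (rule sum_mono)
        fix i assume "i \<in> I b"
        then have "mu i \<le> a b" using mu_antimono[of "b * q" i] by (auto simp: I_def a_def)
        then show "(y i)\<^sup>2 \<le> (a b)\<^sup>2 * (xc i)\<^sup>2"
          unfolding yx power_mult_distrib using mu_pos[of i] by (intro mult_right_mono power_mono) auto
      qed
      then show ?thesis unfolding w_def using a(2)[of b]
        by (simp add: divide_le_eq sum_distrib_left[symmetric] mult.commute)
    qed
    have sumx: "(\<Sum>b<k. \<Sum>i\<in>I b. (xc i)\<^sup>2) \<le> 1"
    proof -
      have "(\<Sum>i<k * q. (xc i)\<^sup>2) \<le> (norm x)\<^sup>2"
        unfolding xc_def by (rule bessel_inequality[OF orthonormal]) simp
      also have "\<dots> \<le> 1" using x by (simp add: power_le_one)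
      finally show ?thesis by (simp add: group)
    qed
    have w1: "w b \<le> 1" if "b < k" for b
    proof -
      have "(\<Sum>i\<in>I b. (xc i)\<^sup>2) \<le> (\<Sum>b<k. \<Sum>i\<in>I b. (xc i)\<^sup>2)"
        using that by (intro member_le_sum) (auto simp: sum_nonneg)
      then show ?thesis using wx[of b] sumx by linarith
    qed
    \<comment> \<open>Rounding up keeps \<open>w b \<le> j b / M\<close>, so the chosen ball
      contains the block; the overshoot of at most \<open>1 / M\<close> per block accumulates to
      \<open>k / M\<close>.\<close>
    define j where "j = (\<lambda>b\<in>{..<k}. nat \<lceil>real M * w b\<rceil>)"
    have jw: "real M * w b \<le> real (j b)" "real (j b) \<le> real M * w b + 1" if "b < k" for b
    proof -
      have "real M * w b \<ge> 0" using w0 by simp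
      then show "real M * w b \<le> real (j b)" "real (j b) \<le> real M * w b + 1"
        using that unfolding j_def by simp_all
    qed
    have jJ: "j \<in> J" unfolding J_def
    proof
      fix b assume b: "b \<in> {..<k}"
      have "real M * w b \<le> real M * 1" using w1 b by (intro mult_left_mono) auto
      then have "\<lceil>real M * w b\<rceil> \<le> int M" by (simp add: ceiling_le_iff)
      then show "j b \<in> {0..M}" using b unfolding j_def by (simp del: ceiling_le_iff add: nat_le_iff)
    qed (auto simp: j_def)
    have "\<exists>c\<in>C b. (\<Sum>i\<in>I b. (y i - sqrt (real (j b) / real M) * c i)\<^sup>2) \<le> \<delta>\<^sup>2 * (real (j b) / real M)"
      if b: "b < k" for b
    proof -
      define s where "s = sqrt (real (j b) / real M)"
      have s2: "s\<^sup>2 = real (j b) / real M" by (simp add: s_def)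
      have "w b \<le> s\<^sup>2" unfolding s2 using jw(1)[OF b] M by (simp add: field_simps)
      then have ys: "(\<Sum>i\<in>I b. (y i)\<^sup>2) \<le> s\<^sup>2 * (a b)\<^sup>2"
        unfolding w_def using a(2)[of b] by (simp add: divide_le_eq)
      show ?thesis
      proof (cases "s = 0")
        case True
        \<comment> \<open>Here the block of \<open>y\<close> vanishes and the centre is multiplied
          by 0, so any element of \<open>C b\<close> will do; covering the zero vector shows that
          there is one.\<close>
        obtain c where "c \<in> C b" using C(3)[of "\<lambda>_. 0" b] a(2)[of b] by (auto simp: L2_set_def)
        then show ?thesis using ys True s2 unfolding s_def[symmetric] by (intro bexI[of _ c]) auto
      next
        case False
        then have s0: "s > 0" unfolding s_def by (metis less_eq_real_def of_nat_0_le_iff divide_nonneg_nonneg real_sqrt_ge_zero)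
        have "(\<Sum>i\<in>I b. (y i / s)\<^sup>2) \<le> (a b)\<^sup>2"
          using ys s0 by (simp add: power_divide sum_divide_distrib[symmetric] divide_le_eq mult.commute)
        then have "L2_set (\<lambda>i. y i / s) (I b) \<le> a b" using a(2)[of b] by (simp add: L2_set_le_iff)
        then obtain c where c: "c \<in> C b" "L2_set (\<lambda>i. y i / s - c i) (I b) \<le> \<delta>" using C(3) by blast
        have "(\<Sum>i\<in>I b. (y i - s * c i)\<^sup>2) = (\<Sum>i\<in>I b. s\<^sup>2 * (y i / s - c i)\<^sup>2)"
          using s0 by (intro sum.cong) (auto simp: power_mult_distrib[symmetric] right_diff_distrib)
        also have "\<dots> = s\<^sup>2 * (\<Sum>i\<in>I b. (y i / s - c i)\<^sup>2)" by (simp add: sum_distrib_left)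
        also have "\<dots> \<le> s\<^sup>2 * \<delta>\<^sup>2" using c(2) \<delta> by (intro mult_left_mono) (auto simp: L2_set_le_iff)
        finally have "(\<Sum>i\<in>I b. (y i - s * c i)\<^sup>2) \<le> \<delta>\<^sup>2 * (real (j b) / real M)"
          unfolding s2 by (simp add: mult.commute)
        then show ?thesis using c(1) unfolding s_def by (rule bexI)
      qed
    qed
    then obtain c0 where c0: "\<And>b. b < k \<Longrightarrow> c0 b \<in> C b"
      "\<And>b. b < k \<Longrightarrow> (\<Sum>i\<in>I b. (y i - sqrt (real (j b) / real M) * c0 b i)\<^sup>2) \<le> \<delta>\<^sup>2 * (real (j b) / real M)"
      by metis
    define c where "c = (\<lambda>b\<in>{..<k}. c0 b)"
    have cP: "c \<in> P" unfolding P_def c_def using c0(1) by auto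
    have blk: "(\<Sum>i\<in>I b. (y i - coef j c i)\<^sup>2) \<le> \<delta>\<^sup>2 * (w b + 1 / real M)" if b: "b < k" for b
    proof -
      have "(\<Sum>i\<in>I b. (y i - coef j c i)\<^sup>2) = (\<Sum>i\<in>I b. (y i - sqrt (real (j b) / real M) * c0 b i)\<^sup>2)"
        using b by (intro sum.cong) (auto simp: coef_def divq c_def)
      also have "\<dots> \<le> \<delta>\<^sup>2 * (real (j b) / real M)" by (rule c0(2)[OF b])
      also have "\<dots> \<le> \<delta>\<^sup>2 * (w b + 1 / real M)"
        using jw(2)[OF b] M by (intro mult_left_mono) (auto simp: field_simps)
      finally show ?thesis .
    qed
    define xt where "xt = x - (\<Sum>i<k * q. xc i *\<^sub>R e i)"
    have xt2: "(norm xt)\<^sup>2 = (norm x)\<^sup>2 - (\<Sum>i<k * q. (xc i)\<^sup>2)"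
      using norm_diff_orthonormal_sum[OF orthonormal, of "{..<k * q}" x xc] by (simp add: xt_def xc_def)
    have "inner xt (e n) = 0" if "n < k * q" for n
    proof -
      have "inner (\<Sum>i<k * q. xc i *\<^sub>R e i) (e n) = (\<Sum>i<k * q. if i = n then xc i else 0)"
        unfolding inner_sum_left by (rule sum.cong) (auto simp: orthonormal)
      then show ?thesis using that by (simp add: xt_def inner_diff_left xc_def)
    qed
    then have "norm (T xt) \<le> mu (k * q) * norm xt" by (rule tail_bound)
    also have "\<dots> \<le> \<delta> * norm xt" using D by (intro mult_right_mono) auto
    finally have Txt: "(norm (T xt))\<^sup>2 \<le> \<delta>\<^sup>2 * (norm xt)\<^sup>2"
      unfolding power_mult_distrib[symmetric] by (intro power_mono) auto
    have "T xt = T x - (\<Sum>i<k * q. y i *\<^sub>R e i)"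
      unfolding xt_def by (simp add: T.diff T.sum T.scaleR eigen yx mult.commute)
    then have tail: "(norm (T x))\<^sup>2 - (\<Sum>i<k * q. (y i)\<^sup>2) = (norm (T xt))\<^sup>2"
      using norm_diff_orthonormal_sum[OF orthonormal, of "{..<k * q}" "T x" y] by (simp add: y_def)
    have "(norm (T x - cent j c))\<^sup>2 = (norm (T xt))\<^sup>2 + (\<Sum>b<k. \<Sum>i\<in>I b. (y i - coef j c i)\<^sup>2)"
      unfolding cent_def norm_diff_orthonormal_sum[OF orthonormal finite_lessThan]
      using tail by (simp add: y_def group)
    also have "\<dots> \<le> \<delta>\<^sup>2 * (norm xt)\<^sup>2 + (\<Sum>b<k. \<delta>\<^sup>2 * (w b + 1 / real M))"
      using blk by (intro add_mono Txt sum_mono) auto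
    also have "\<dots> = \<delta>\<^sup>2 * ((norm xt)\<^sup>2 + (\<Sum>b<k. w b) + real k / real M)"
      unfolding sum_distrib_left[symmetric] sum.distrib by (simp add: distrib_left)
    \<comment> \<open>Tail and blocks share one budget: \<open>norm xt\<close> squared and the
      weights \<open>w b\<close> together are at most \<open>norm x\<close> squared, so cutting off
      the tail adds nothing to the total error.\<close>
    also have "\<dots> \<le> \<delta>\<^sup>2 * (1 + real k / real M)"
    proof (intro mult_left_mono)
      have "(norm x)\<^sup>2 \<le> 1" using x by (simp add: power_le_one)
      moreover have "(\<Sum>b<k. w b) \<le> (\<Sum>b<k. \<Sum>i\<in>I b. (xc i)\<^sup>2)" by (intro sum_mono wx)
      ultimately show "(norm xt)\<^sup>2 + (\<Sum>b<k. w b) + real k / real M \<le> 1 + real k / real M"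
        unfolding xt2 group by simp
    qed simp
    also have "\<dots> = (\<delta> * sqrt (1 + real k / real M))\<^sup>2" by (simp add: power_mult_distrib)
    finally have "norm (T x - cent j c) \<le> \<delta> * sqrt (1 + real k / real M)"
      by (rule power2_le_imp_le) (use \<delta> in auto)
    then show ?thesis unfolding Z_def using jJ cP by (intro bexI[of _ "cent j c"]) auto
  qed
  have finZ: "finite Z" unfolding Z_def using finJ by auto
  have "T ` cball 0 1 \<subseteq> (\<Union>z\<in>Z. cball z (\<delta> * sqrt (1 + real k / real M)))"
  proof
    fix y assume "y \<in> T ` cball 0 1"
    then obtain x where "y = T x" "norm x \<le> 1" by auto
    then show "y \<in> (\<Union>z\<in>Z. cball z (\<delta> * sqrt (1 + real k / real M)))"
      using cover[of x] by (auto simp: dist_norm norm_minus_commute)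
  qed
  then have "K \<subseteq> (\<Union>z\<in>Z. cball z (\<delta> * sqrt (1 + real k / real M)))"
    by (rule closure_minimal) (use finZ in auto)
  then have "covering_number (\<delta> * sqrt (1 + real k / real M)) K \<le> card Z"
    by (rule covering_number_le[OF finZ])
  also have "\<dots> \<le> card (J \<times> P)" unfolding Z_def using finJ by (intro card_image_le) auto
  also have "\<dots> = (M + 1) ^ k * (\<Prod>b<k. card (C b))"
    unfolding J_def P_def by (simp add: card_cartesian_product card_PiE)
  finally have "real (covering_number (\<delta> * sqrt (1 + real k / real M)) K)
      \<le> real ((M + 1) ^ k * (\<Prod>b<k. card (C b)))" by (rule of_nat_mono)
  also have "\<dots> = (real M + 1) ^ k * (\<Prod>b<k. real (card (C b)))" by (simp add: add.commute)
  also have "\<dots> \<le> (real M + 1) ^ k * (\<Prod>b<k. 1000 * real q ^ 4 * (a b / \<delta>) ^ (q + 1))"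
    using C(2) by (intro mult_left_mono prod_mono) auto
  finally show ?thesis by (simp add: a_def)
qed

section \<open>Logarithmic excess of the axes over the precision\<close>

definition excess :: "real \<Rightarrow> nat \<Rightarrow> real" where
  "excess \<delta> n = ln (max (mu n) \<delta> / \<delta>)"

lemma excess_nonneg: "\<delta> > 0 \<Longrightarrow> excess \<delta> n \<ge> 0"
  by (simp add: excess_def)

lemma excess_antimono: "\<delta> > 0 \<Longrightarrow> m \<le> n \<Longrightarrow> excess \<delta> n \<le> excess \<delta> m"
  unfolding excess_def using mu_antimono[of m n]
  by (subst ln_le_cancel_iff) (auto intro!: divide_right_mono divide_pos_pos)

text \<open>By monotonicity the value at the start of a block is at most every value in the
  preceding block. Only the first block has no predecessor; it is charged
  \<open>q * excess \<delta> 0\<close>.\<close>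

lemma sum_excess_blocks_le:
  assumes "\<delta> > 0"
  shows "(\<Sum>b<k. real q * excess \<delta> (b * q)) \<le> real q * excess \<delta> 0 + (\<Sum>n<k * q. excess \<delta> n)"
proof -
  have "(\<Sum>b<Suc k. real q * excess \<delta> (b * q)) \<le> real q * excess \<delta> 0 + (\<Sum>n<k * q. excess \<delta> n)" for k
  proof (induction k)
    case (Suc k)
    have "real q * excess \<delta> (Suc k * q) = (\<Sum>n\<in>{k * q..<k * q + q}. excess \<delta> (Suc k * q))" by simp
    also have "\<dots> \<le> (\<Sum>n\<in>{k * q..<k * q + q}. excess \<delta> n)"
      by (intro sum_mono excess_antimono assms) auto
    also have "(\<Sum>n<Suc k * q. excess \<delta> n) = (\<Sum>n<k * q. excess \<delta> n) + (\<Sum>n\<in>{k * q..<k * q + q}. excess \<delta> n)"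
      unfolding sum.nat_group[symmetric] by simp
    ultimately show ?case using Suc.IH by simp
  qed simp
  from this[of k] show ?thesis using excess_nonneg[OF assms, of "k * q"] by (simp add: mult_nonneg_nonneg order_trans[rotated])
qed

text \<open>Of the exponent \<open>q + 1\<close> in the block bound, \<open>q\<close> yields the
  main sum; the remaining 1 joins the overhead per block, together with the \<open>M + 1\<close>
  energy levels and the polynomial factor.\<close>

lemma entropy_upper_bound:
  assumes q: "q > 0" and M: "M > 0" and \<delta>: "\<delta> > 0" and D: "mu (k * q) \<le> \<delta>"
  shows "ln (real (covering_number (\<delta> * sqrt (1 + real k / real M)) K)) \<le>
    (\<Sum>n<k * q. excess \<delta> n) + real q * excess \<delta> 0
     + real k * (ln (real M + 1) + ln 1000 + 4 * ln (real q) + excess \<delta> 0)"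
proof -
  let ?N = "covering_number (\<delta> * sqrt (1 + real k / real M)) K"
  have "1 + real k / real M > 0" by (simp add: add_pos_nonneg)
  then have "?N > 0" using covering_number_pos[OF compact_K K_nonempty] \<delta> by simp
  then have "ln (real ?N) \<le> ln ((real M + 1) ^ k * (\<Prod>b<k. 1000 * real q ^ 4 * (max (mu (b * q)) \<delta> / \<delta>) ^ (q + 1)))"
    using covering_number_block_bound[OF assms] by (subst ln_le_cancel_iff) auto
  also have "\<dots> = real k * ln (real M + 1) + (\<Sum>b<k. ln (1000 * real q ^ 4 * (max (mu (b * q)) \<delta> / \<delta>) ^ (q + 1)))"
    using q \<delta> by (subst ln_mult) (auto intro!: prod_pos mult_pos_pos zero_less_power divide_pos_pos simp: ln_realpow ln_prod less_max_iff_disj)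
  also have "\<dots> = real k * ln (real M + 1) + (\<Sum>b<k. ln 1000 + 4 * ln (real q) + excess \<delta> (b * q) + real q * excess \<delta> (b * q))"
  proof -
    have "ln (1000 * real q ^ 4 * (max (mu (b * q)) \<delta> / \<delta>) ^ (q + 1))
        = ln 1000 + 4 * ln (real q) + excess \<delta> (b * q) + real q * excess \<delta> (b * q)" for b
    proof -
      have pos: "max (mu (b * q)) \<delta> / \<delta> > 0" using \<delta> by (auto intro!: divide_pos_pos simp: less_max_iff_disj)
      have "ln (1000 * real q ^ 4 * (max (mu (b * q)) \<delta> / \<delta>) ^ (q + 1))
          = ln (1000 * real q ^ 4) + real (q + 1) * excess \<delta> (b * q)"
        using q zero_less_power[OF pos, of "q + 1"] unfolding excess_def
        by (subst ln_mult) (auto simp: ln_realpow simp del: power_Suc power_Suc2)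
      also have "ln (1000 * real q ^ 4) = ln 1000 + 4 * ln (real q)"
        using q by (simp add: ln_mult ln_realpow)
      finally show ?thesis by (simp add: algebra_simps)
    qed
    then show ?thesis by simp
  qed
  also have "\<dots> \<le> real k * ln (real M + 1) + (\<Sum>b<k. ln 1000 + 4 * ln (real q) + excess \<delta> 0 + real q * excess \<delta> (b * q))"
    by (intro add_left_mono sum_mono add_right_mono excess_antimono \<delta>) auto
  also have "\<dots> = real k * (ln (real M + 1) + ln 1000 + 4 * ln (real q) + excess \<delta> 0) + (\<Sum>b<k. real q * excess \<delta> (b * q))"
    by (simp add: sum.distrib algebra_simps)
  also have "\<dots> \<le> real k * (ln (real M + 1) + ln 1000 + 4 * ln (real q) + excess \<delta> 0)
      + (real q * excess \<delta> 0 + (\<Sum>n<k * q. excess \<delta> n))"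
    using sum_excess_blocks_le[OF \<delta>, of q k] by simp
  finally show ?thesis by simp
qed

end

section \<open>Sums and limits\<close>

text \<open>The increments of \<open>a - l * b\<close> are eventually at most \<open>r / 2\<close>
  times those of \<open>b\<close>; they telescope, and the divergence of \<open>b\<close> absorbs
  the initial value.\<close>

lemma stolz_cesaro:
  fixes a b :: "nat \<Rightarrow> real"
  assumes b: "strict_mono b" "filterlim b at_top sequentially"
    and lim: "(\<lambda>n. (a (Suc n) - a n) / (b (Suc n) - b n)) \<longlonglongrightarrow> l"
  shows "(\<lambda>n. a n / b n) \<longlonglongrightarrow> l"
proof (rule tendstoI)
  fix r :: real assume r: "r > 0"
  have db: "b (Suc n) - b n > 0" for n using b(1) by (simp add: strict_mono_Suc_iff)
  obtain N where N: "\<And>n. n \<ge> N \<Longrightarrow> \<bar>(a (Suc n) - a n) / (b (Suc n) - b n) - l\<bar> < r / 2"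
    using tendstoD[OF lim, of "r / 2"] r unfolding eventually_sequentially dist_real_def by auto
  define f where "f n = a n - l * b n" for n
  have inc: "\<bar>f (Suc n) - f n\<bar> \<le> r / 2 * b (Suc n) - r / 2 * b n" if "n \<ge> N" for n
  proof -
    have "f (Suc n) - f n = ((a (Suc n) - a n) / (b (Suc n) - b n) - l) * (b (Suc n) - b n)"
      using db[of n] by (simp add: f_def field_simps)
    then have "\<bar>f (Suc n) - f n\<bar> \<le> r / 2 * (b (Suc n) - b n)"
      using N[OF that] db[of n] by (simp add: abs_mult mult_right_mono)
    then show ?thesis by (simp add: right_diff_distrib)
  qed
  have tele: "\<bar>f n - f N\<bar> \<le> r / 2 * b n - r / 2 * b N" if "n \<ge> N" for n
    using that
  proof (induction n rule: dec_induct)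
    case (step n)
    then show ?case using inc[of n] by linarith
  qed simp
  define c where "c = \<bar>f N\<bar> - r / 2 * b N"
  have "\<forall>\<^sub>F n in sequentially. b n > max 1 (2 * c / r)"
    using b(2) unfolding filterlim_at_top_dense by blast
  moreover have "\<forall>\<^sub>F n in sequentially. n \<ge> N" by (rule eventually_ge_at_top)
  ultimately show "\<forall>\<^sub>F n in sequentially. dist (a n / b n) l < r"
  proof eventually_elim
    case (elim n)
    then have bn: "b n > 0" "c < r / 2 * b n" using r by (auto simp: field_simps)
    have "\<bar>a n - l * b n\<bar> \<le> c + r / 2 * b n" using tele[of n] elim unfolding c_def f_def by linarith
    also have "\<dots> < r * b n" using bn by simp
    finally have "\<bar>a n - l * b n\<bar> / b n < r" using bn by (simp add: field_simps)
    moreover have "a n / b n - l = (a n - l * b n) / b n" using bn by (simp add: field_simps)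
    ultimately show ?case using bn by (simp add: dist_real_def)
  qed
qed

lemma sum_powr_asymptotics:
  fixes g :: "nat \<Rightarrow> real"
  assumes \<beta>: "0 \<le> \<beta>" "\<beta> < 1" and g: "(\<lambda>n. g n * real n powr \<beta>) \<longlonglongrightarrow> \<gamma>"
  shows "(\<lambda>d. (\<Sum>n<d. g (Suc n)) / real d powr (1 - \<beta>)) \<longlonglongrightarrow> \<gamma> / (1 - \<beta>)"
proof (rule stolz_cesaro)
  show "strict_mono (\<lambda>d. real d powr (1 - \<beta>))"
    using \<beta> by (intro strict_monoI) (simp add: powr_less_mono2)
  show "filterlim (\<lambda>d. real d powr (1 - \<beta>)) at_top sequentially"
    using \<beta> by real_asymp
  have 1: "(\<lambda>d. real (Suc d) powr \<beta> * (real (Suc d) powr (1 - \<beta>) - real d powr (1 - \<beta>))) \<longlonglongrightarrow> 1 - \<beta>"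
    using \<beta> by real_asymp
  have 2: "(\<lambda>d. g (Suc d) * real (Suc d) powr \<beta>) \<longlonglongrightarrow> \<gamma>"
    using g by (rule LIMSEQ_Suc)
  have "(\<lambda>d. (g (Suc d) * real (Suc d) powr \<beta>) /
      (real (Suc d) powr \<beta> * (real (Suc d) powr (1 - \<beta>) - real d powr (1 - \<beta>)))) \<longlonglongrightarrow> \<gamma> / (1 - \<beta>)"
    using \<beta> by (intro tendsto_divide 1 2) auto
  then show "(\<lambda>n. ((\<Sum>n<Suc n. g (Suc n)) - (\<Sum>n<n. g (Suc n))) /
      (real (Suc n) powr (1 - \<beta>) - real n powr (1 - \<beta>))) \<longlonglongrightarrow> \<gamma> / (1 - \<beta>)"
    by (simp add: mult.commute)
qed

text \<open>\<open>x ^ d / d!\<close> is a single term of the exponential series. That the bound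
  holds for every \<open>d\<close> is the point: the upper estimate needs no precise count of the
  long axes.\<close>

lemma sum_ln_over_le:
  assumes "x > 0"
  shows "(\<Sum>n<d. ln (x / real (Suc n))) \<le> x"
proof -
  have "(\<Sum>n<d. ln (x / real (Suc n))) = ln (\<Prod>n<d. x / real (Suc n))"
    using assms by (intro ln_prod[symmetric]) auto
  also have "(\<Prod>n<d. x / real (Suc n)) = x ^ d / fact d"
    by (simp add: prod_dividef fact_prod_Suc lessThan_atLeast0)
  also have "\<dots> \<le> exp x"
  proof -
    have s: "summable (\<lambda>n. inverse (fact n) * x ^ n)" by (rule summable_exp)
    have "inverse (fact d) * x ^ d = (\<Sum>n\<in>{d}. inverse (fact n) * x ^ n)" by simp
    also have "\<dots> \<le> (\<Sum>n. inverse (fact n) * x ^ n)"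
      using assms by (intro sum_le_suminf[OF s]) auto
    also have "\<dots> = exp x" by (simp add: exp_def)
    finally show ?thesis by (simp add: divide_inverse mult.commute)
  qed
  then have "ln (x ^ d / fact d) \<le> ln (exp x)" using assms by (subst ln_le_cancel_iff) auto
  finally show ?thesis by simp
qed

text \<open>After replacing \<open>x\<close> by \<open>d\<close>, this is the elementary part of
  Stirling's formula, by induction from \<open>(n + 1) * (ln (n + 1) - ln n) \<ge> 1\<close>. The
  logarithmic loss is below the order of the second term.\<close>

lemma sum_ln_over_ge:
  assumes "d \<ge> 1" "real d \<le> x"
  shows "(\<Sum>n<d. ln (x / real (Suc n))) \<ge> real d - ln (real d) - 1"
proof -
  have fact: "(\<Sum>n<d. ln (real (Suc n))) \<le> real d * ln (real d) - real d + ln (real d) + 1"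
    using assms(1)
  proof (induction d rule: dec_induct)
    case (step n)
    have "ln (real n / real (Suc n)) \<le> real n / real (Suc n) - 1"
      using step by (intro ln_le_minus_one) auto
    also have "\<dots> = - 1 / real (Suc n)" by (simp add: field_simps)
    finally have "ln (real (Suc n)) - ln (real n) \<ge> 1 / real (Suc n)"
      using step by (simp add: ln_div)
    then have "real (Suc n) * (ln (real (Suc n)) - ln (real n)) \<ge> 1"
      by (simp add: field_simps)
    then have "real (Suc n) * ln (real n) + 1 \<le> real (Suc n) * ln (real (Suc n))"
      by (simp add: right_diff_distrib)
    then show ?case using step.IH by (simp add: algebra_simps)
  qed simp
  have "(\<Sum>n<d. ln (x / real (Suc n))) = (\<Sum>n<d. ln x - ln (real (Suc n)))"
    using assms by (intro sum.cong) (auto simp: ln_div)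
  also have "\<dots> = real d * ln x - (\<Sum>n<d. ln (real (Suc n)))" by (simp add: sum_subtractf)
  also have "\<dots> \<ge> real d * ln (real d) - (\<Sum>n<d. ln (real (Suc n)))"
    using assms by (intro diff_right_mono mult_left_mono) auto
  finally show ?thesis using fact by linarith
qed

text \<open>Writing the ratio as \<open>1 + v n\<close>, the expansion says that
  \<open>v n * n powr \<beta>\<close> tends to \<open>c2 / c1\<close>. Since
  \<open>ln (1 + v) - v = O (v\<^sup>2)\<close>, the logarithm has the same limit once
  \<open>v\<close> tends to 0; for \<beta> = 0 the latter comes from \<open>c2 = 0\<close>.\<close>

lemma ln_ratio_asymptotics:
  fixes lam :: "nat \<Rightarrow> real"
  assumes asym: "(\<lambda>n. lam n - (c1 / real n powr \<alpha>1 + c2 / real n powr \<alpha>2))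
                 \<in> o[sequentially](\<lambda>n. 1 / real n powr \<alpha>2)"
    and c1: "c1 > 0" and exps: "\<alpha>1 < \<alpha>2 \<or> \<alpha>1 = \<alpha>2 \<and> c2 = 0"
  shows "(\<lambda>n. lam n * real n powr \<alpha>1 / c1) \<longlonglongrightarrow> 1"
    and "(\<lambda>n. ln (lam n * real n powr \<alpha>1 / c1) * real n powr (\<alpha>2 - \<alpha>1)) \<longlonglongrightarrow> c2 / c1"
proof -
  define \<beta> where "\<beta> = \<alpha>2 - \<alpha>1"
  define v where "v n = lam n * real n powr \<alpha>1 / c1 - 1" for n
  have "(\<lambda>n. (lam n - (c1 / real n powr \<alpha>1 + c2 / real n powr \<alpha>2)) / (1 / real n powr \<alpha>2)) \<longlonglongrightarrow> 0"
    using asym by (rule smalloD_tendsto)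
  then have "(\<lambda>n. c2 / c1 + (lam n - (c1 / real n powr \<alpha>1 + c2 / real n powr \<alpha>2)) / (1 / real n powr \<alpha>2) / c1) \<longlonglongrightarrow> c2 / c1 + 0 / c1"
    using c1 by (intro tendsto_intros) auto
  moreover have "\<forall>\<^sub>F n in sequentially. c2 / c1 + (lam n - (c1 / real n powr \<alpha>1 + c2 / real n powr \<alpha>2)) / (1 / real n powr \<alpha>2) / c1
      = v n * real n powr \<beta>"
    using eventually_gt_at_top[of 0]
  proof eventually_elim
    case (elim n)
    then have n: "real n > 0" by simp
    have b: "real n powr \<alpha>2 = real n powr \<alpha>1 * real n powr \<beta>"
      by (simp add: \<beta>_def powr_add[symmetric])
    have p: "real n powr \<alpha>1 > 0" "real n powr \<beta> > 0" using n by auto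
    show ?case unfolding v_def b using p c1 by (simp add: field_simps)
  qed
  ultimately have v: "(\<lambda>n. v n * real n powr \<beta>) \<longlonglongrightarrow> c2 / c1"
    by (simp add: tendsto_cong)
  have v0: "v \<longlonglongrightarrow> 0"
  proof (cases "\<beta> = 0")
    case True
    then have "c2 = 0" using exps by (auto simp: \<beta>_def)
    then have "(\<lambda>n. v n * real n powr 0) \<longlonglongrightarrow> 0" using v True by simp
    then show ?thesis
      by (rule Lim_transform_eventually) (use eventually_gt_at_top[of 0] in eventually_elim, auto)
  next
    case False
    then have "\<beta> > 0" using exps by (auto simp: \<beta>_def)
    then have "(\<lambda>n. real n powr (- \<beta>)) \<longlonglongrightarrow> 0" by real_asymp
    from tendsto_mult[OF v this] have "(\<lambda>n. v n * real n powr \<beta> * real n powr (- \<beta>)) \<longlonglongrightarrow> 0" by simp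
    then show ?thesis
    proof (rule Lim_transform_eventually)
      show "\<forall>\<^sub>F n in sequentially. v n * real n powr \<beta> * real n powr (- \<beta>) = v n"
        using eventually_gt_at_top[of 0] by eventually_elim (simp add: powr_minus)
    qed
  qed
  then have "(\<lambda>n. v n + 1) \<longlonglongrightarrow> 0 + 1" by (intro tendsto_intros)
  then show "(\<lambda>n. lam n * real n powr \<alpha>1 / c1) \<longlonglongrightarrow> 1" by (simp add: v_def)
  have "\<forall>\<^sub>F n in sequentially. \<bar>v n\<bar> < 1 / 2"
    using tendstoD[OF v0, of "1/2"] by simp
  then have "\<forall>\<^sub>F n in sequentially. norm ((ln (1 + v n) - v n) * real n powr \<beta>) \<le> \<bar>v n\<bar> * 2 * \<bar>v n * real n powr \<beta>\<bar>"
  proof eventually_elim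
    case (elim n)
    have "\<bar>ln (1 + v n) - v n\<bar> \<le> 2 * (v n)\<^sup>2" using elim by (intro abs_ln_one_plus_x_minus_x_bound) auto
    then have "\<bar>ln (1 + v n) - v n\<bar> * real n powr \<beta> \<le> 2 * (v n)\<^sup>2 * real n powr \<beta>" by (intro mult_right_mono) auto
    also have "2 * (v n)\<^sup>2 * real n powr \<beta> = 2 * (\<bar>v n\<bar> * \<bar>v n\<bar>) * real n powr \<beta>"
      by (simp only: abs_mult_self_eq power2_eq_square)
    finally show ?case by (simp add: abs_mult mult_ac)
  qed
  moreover have "(\<lambda>n. \<bar>v n\<bar> * 2 * \<bar>v n * real n powr \<beta>\<bar>) \<longlonglongrightarrow> \<bar>0\<bar> * 2 * \<bar>c2 / c1\<bar>"
    by (intro tendsto_intros v0 v)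
  then have "(\<lambda>n. \<bar>v n\<bar> * 2 * \<bar>v n * real n powr \<beta>\<bar>) \<longlonglongrightarrow> 0"
    by (simp only: abs_zero mult_zero_left)
  ultimately have "(\<lambda>n. (ln (1 + v n) - v n) * real n powr \<beta>) \<longlonglongrightarrow> 0"
    by (rule Lim_null_comparison)
  from tendsto_add[OF this v] have "(\<lambda>n. ln (1 + v n) * real n powr \<beta>) \<longlonglongrightarrow> c2 / c1"
    by (simp add: algebra_simps)
  then show "(\<lambda>n. ln (lam n * real n powr \<alpha>1 / c1) * real n powr (\<alpha>2 - \<alpha>1)) \<longlonglongrightarrow> c2 / c1"
    by (simp add: v_def \<beta>_def)
qed

text \<open>This is where the gap \<open>\<alpha>2 - \<alpha>1\<close> has to stay below 1/2: the
  block error \<open>sqrt x * ln x\<close> must be of smaller order than the second term.\<close>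

lemma sqrt_ln_negligible:
  fixes A B \<beta> :: real
  assumes "\<beta> < 1 / 2"
  shows "((\<lambda>x. sqrt x * (A + B * ln x) / x powr (1 - \<beta>)) \<longlongrightarrow> 0) at_top"
proof -
  have k: "1 / 2 - \<beta> > 0" using assms by simp
  have "((\<lambda>x. A * x powr - (1 / 2 - \<beta>) + B * (ln x * x powr - (1 / 2 - \<beta>))) \<longlongrightarrow> A * 0 + B * 0) at_top"
    using k by (intro tendsto_intros) real_asymp+
  then have "((\<lambda>x. A * x powr - (1 / 2 - \<beta>) + B * (ln x * x powr - (1 / 2 - \<beta>))) \<longlongrightarrow> 0) at_top" by simp
  then show ?thesis
  proof (rule Lim_transform_eventually)
    show "\<forall>\<^sub>F x in at_top. A * x powr - (1 / 2 - \<beta>) + B * (ln x * x powr - (1 / 2 - \<beta>))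
        = sqrt x * (A + B * ln x) / x powr (1 - \<beta>)"
      using eventually_gt_at_top[of 0]
    proof eventually_elim
      case (elim x)
      have "x powr - (1 / 2 - \<beta>) = x powr (1 / 2) / x powr (1 - \<beta>)"
        using elim by (simp add: powr_diff[symmetric])
      then show ?case using elim by (simp add: powr_half_sqrt algebra_simps add_divide_distrib)
    qed
  qed
qed

section \<open>Inverting an asymptotic expansion\<close>

text \<open>Shifting the argument by \<open>t * y powr (1 - \<beta>)\<close> moves the main term by
  \<alpha> times the shift and leaves the coefficient \<omega> unchanged, as the argument stays
  asymptotic to \<open>y\<close>. For \<beta> = 0 the shift has the order of \<open>y\<close> itself
  and the ratio tends to \<open>1 + t\<close>; hence the requirements \<omega> = 0 and
  \<open>t > -1\<close>.\<close>

lemma perturbed_argument_limit: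
  fixes h :: "real \<Rightarrow> real"
  assumes lim: "((\<lambda>x. (h x - \<alpha> * x) / x powr (1 - \<beta>)) \<longlongrightarrow> \<omega>) at_top"
    and \<beta>: "0 \<le> \<beta>" "\<beta> < 1" and \<beta>0: "\<beta> = 0 \<Longrightarrow> \<omega> = 0 \<and> t > -1"
  shows "((\<lambda>y. (h (y + t * y powr (1 - \<beta>)) - \<alpha> * y) / y powr (1 - \<beta>)) \<longlongrightarrow> \<alpha> * t + \<omega>) at_top"
    and "\<forall>\<^sub>F y in at_top. y + t * y powr (1 - \<beta>) > 0"
proof -
  define X where "X y = y + t * y powr (1 - \<beta>)" for y
  define l where "l = (if \<beta> = 0 then 1 + t else 1)"
  have l: "l > 0" using \<beta>0 by (auto simp: l_def)
  have "((\<lambda>y. 1 + t * y powr (- \<beta>)) \<longlongrightarrow> l) at_top"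
  proof (cases "\<beta> = 0")
    case True
    have "((\<lambda>y. 1 + t) \<longlongrightarrow> l) at_top" using True by (simp add: l_def)
    then show ?thesis
      by (rule Lim_transform_eventually) (use eventually_gt_at_top[of 0] in eventually_elim, simp add: True)
  next
    case False
    then have "\<beta> > 0" using \<beta> by simp
    then have "((\<lambda>y. y powr (- \<beta>)) \<longlongrightarrow> 0) at_top" by real_asymp
    then have "((\<lambda>y. 1 + t * y powr (- \<beta>)) \<longlongrightarrow> 1 + t * 0) at_top" by (intro tendsto_intros)
    then show ?thesis using False by (simp add: l_def)
  qed
  moreover have "\<forall>\<^sub>F y in at_top. 1 + t * y powr (- \<beta>) = X y / y"
    using eventually_gt_at_top[of 0]
  proof eventually_elim
    case (elim y)
    then have "y powr (1 - \<beta>) = y * y powr (- \<beta>)" using powr_add[of y 1 "- \<beta>"] by simp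
    then show ?case using elim by (simp add: X_def field_simps)
  qed
  ultimately have Xy: "((\<lambda>y. X y / y) \<longlongrightarrow> l) at_top" by (rule Lim_transform_eventually)
  have XX: "filterlim (\<lambda>y. X y / y * y) at_top at_top"
    by (rule filterlim_tendsto_pos_mult_at_top[OF Xy l filterlim_ident])
  have "\<forall>\<^sub>F y in at_top. X y / y * y = X y"
    using eventually_gt_at_top[of "0::real"] by eventually_elim simp
  then have Xtop: "filterlim X at_top at_top"
    by (rule iffD1[OF filterlim_cong[OF refl refl] XX])
  then have Xpos: "\<forall>\<^sub>F y in at_top. X y > 0" unfolding filterlim_at_top_dense by blast
  then show "\<forall>\<^sub>F y in at_top. y + t * y powr (1 - \<beta>) > 0" by (simp add: X_def)
  have "((\<lambda>y. (X y / y) powr (1 - \<beta>)) \<longlongrightarrow> l powr (1 - \<beta>)) at_top"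
    using l by (intro tendsto_powr Xy tendsto_const) auto
  then have "((\<lambda>y. \<alpha> * t + (h (X y) - \<alpha> * X y) / X y powr (1 - \<beta>) * (X y / y) powr (1 - \<beta>))
      \<longlongrightarrow> \<alpha> * t + \<omega> * l powr (1 - \<beta>)) at_top"
    using filterlim_compose[OF lim Xtop] by (intro tendsto_add tendsto_mult tendsto_const)
  moreover have "\<omega> * l powr (1 - \<beta>) = \<omega>" using \<beta>0 by (auto simp: l_def)
  moreover have "\<forall>\<^sub>F y in at_top. \<alpha> * t + (h (X y) - \<alpha> * X y) / X y powr (1 - \<beta>) * (X y / y) powr (1 - \<beta>)
      = (h (X y) - \<alpha> * y) / y powr (1 - \<beta>)"
    using Xpos eventually_gt_at_top[of 0]
  proof eventually_elim
    case (elim y)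
    have p: "X y powr (1 - \<beta>) > 0" "y powr (1 - \<beta>) > 0" using elim by auto
    have "\<alpha> * X y = \<alpha> * y + \<alpha> * t * y powr (1 - \<beta>)" by (simp add: X_def algebra_simps)
    then show ?case using p elim by (simp add: powr_divide field_simps)
  qed
  ultimately show "((\<lambda>y. (h (y + t * y powr (1 - \<beta>)) - \<alpha> * y) / y powr (1 - \<beta>)) \<longlongrightarrow> \<alpha> * t + \<omega>) at_top"
    unfolding X_def[symmetric] by (simp add: Lim_transform_eventually)
qed

text \<open>\<open>H\<close> may jump, so it is trapped rather than inverted. With
  \<open>\<tau> = \<omega> / \<alpha>\<close>, its values at the arguments belonging to
  \<open>y + (- \<tau> - d) * y powr (1 - \<beta>)\<close> and
  \<open>y + (- \<tau> + d) * y powr (1 - \<beta>)\<close> lie on either side of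
  \<open>\<alpha> * y\<close>, and monotonicity puts the infimum between these arguments.
  Linearising the power turns the shift \<open>- \<tau>\<close> into
  \<open>c * \<omega>\<close>.\<close>

lemma generalized_inverse_asymptotics:
  fixes H :: "real \<Rightarrow> real"
  assumes anti: "\<And>e e'. 0 < e \<Longrightarrow> e \<le> e' \<Longrightarrow> H e' \<le> H e"
    and lim: "((\<lambda>x. (H (c * x powr - \<alpha>) - \<alpha> * x) / x powr (1 - \<beta>)) \<longlongrightarrow> \<omega>) at_top"
    and c: "c > 0" and \<alpha>: "\<alpha> > 0" and \<beta>: "0 \<le> \<beta>" "\<beta> < 1" and \<beta>0: "\<beta> = 0 \<Longrightarrow> \<omega> = 0"
  shows "((\<lambda>y. (Inf {e. e > 0 \<and> H e \<le> \<alpha> * y} - c * y powr - \<alpha>) * y powr (\<alpha> + \<beta>)) \<longlongrightarrow> c * \<omega>) at_top"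
proof -
  define E where "E y = Inf {e. e > 0 \<and> H e \<le> \<alpha> * y}" for y
  define x where "x y = (E y / c) powr (- 1 / \<alpha>)" for y
  define \<tau> where "\<tau> = \<omega> / \<alpha>"
  have bounds: "\<forall>\<^sub>F y in at_top. E y > 0 \<and> y > 0 \<and> y + (- \<tau> - d) * y powr (1 - \<beta>) \<le> x y
      \<and> x y \<le> y + (- \<tau> + d) * y powr (1 - \<beta>)" if d: "0 < d" "d < 1" for d
  proof -
    define Xm where "Xm y = y + (- \<tau> - d) * y powr (1 - \<beta>)" for y
    define Xp where "Xp y = y + (- \<tau> + d) * y powr (1 - \<beta>)" for y
    have tm: "\<beta> = 0 \<Longrightarrow> \<omega> = 0 \<and> - \<tau> - d > -1" and tp: "\<beta> = 0 \<Longrightarrow> \<omega> = 0 \<and> - \<tau> + d > -1"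
      using \<beta>0 d by (auto simp: \<tau>_def)
    \<comment> \<open>By the choice of \<tau> the two sides equal \<open>- \<alpha> * d\<close> and
      \<open>\<alpha> * d\<close>.\<close>
    have lm: "\<alpha> * (- \<tau> - d) + \<omega> < 0" and lp: "\<alpha> * (- \<tau> + d) + \<omega> > 0"
      using \<alpha> d by (simp_all add: \<tau>_def algebra_simps)
    have "\<forall>\<^sub>F y in at_top. (H (c * Xm y powr - \<alpha>) - \<alpha> * y) / y powr (1 - \<beta>) < 0"
      unfolding Xm_def by (rule order_tendstoD(2)[OF perturbed_argument_limit(1)[OF lim \<beta> tm] lm])
    moreover have "\<forall>\<^sub>F y in at_top. (H (c * Xp y powr - \<alpha>) - \<alpha> * y) / y powr (1 - \<beta>) > 0"
      unfolding Xp_def by (rule order_tendstoD(1)[OF perturbed_argument_limit(1)[OF lim \<beta> tp] lp])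
    moreover have "\<forall>\<^sub>F y in at_top. Xm y > 0"
      unfolding Xm_def by (rule perturbed_argument_limit(2)[OF lim \<beta> tm])
    moreover have "\<forall>\<^sub>F y in at_top. Xp y > 0"
      unfolding Xp_def by (rule perturbed_argument_limit(2)[OF lim \<beta> tp])
    ultimately show ?thesis using eventually_gt_at_top[of 0]
    proof eventually_elim
      case (elim y)
      let ?S = "{e. e > 0 \<and> H e \<le> \<alpha> * y}"
      have py: "y powr (1 - \<beta>) > 0" using elim by simp
      have Hm: "H (c * Xm y powr - \<alpha>) < \<alpha> * y" and Hp: "\<alpha> * y < H (c * Xp y powr - \<alpha>)"
        using elim(1,2) py by (simp_all add: divide_less_0_iff zero_less_divide_iff)
      have inS: "c * Xm y powr - \<alpha> \<in> ?S" using Hm c elim by simp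
      have lower: "c * Xp y powr - \<alpha> \<le> e" if "e \<in> ?S" for e
      proof (rule ccontr)
        assume "\<not> c * Xp y powr - \<alpha> \<le> e"
        then have "H (c * Xp y powr - \<alpha>) \<le> H e" using that by (intro anti) auto
        then show False using Hp that by auto
      qed
      have E1: "E y \<le> c * Xm y powr - \<alpha>"
        unfolding E_def by (rule cInf_lower[OF inS]) (auto intro!: bdd_belowI[of _ 0])
      have E2: "c * Xp y powr - \<alpha> \<le> E y"
        unfolding E_def using inS lower by (intro cInf_greatest) auto
      have E0: "E y > 0" using E2 c elim(4) by (smt (verit) mult_pos_pos powr_gt_zero)
      have inv: "(Z powr - \<alpha>) powr (- 1 / \<alpha>) = Z" if "Z > 0" for Z :: real
        using that \<alpha> by (simp add: powr_powr)
      have "(Xm y powr - \<alpha>) powr (- 1 / \<alpha>) \<le> x y"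
        unfolding x_def using E0 E1 c \<alpha> by (intro powr_mono2') (auto simp: divide_le_eq mult.commute)
      moreover have "x y \<le> (Xp y powr - \<alpha>) powr (- 1 / \<alpha>)"
        unfolding x_def using E2 c \<alpha> elim(4) by (intro powr_mono2') (auto simp: le_divide_eq mult.commute)
      ultimately show ?case using E0 elim inv by (auto simp: Xm_def Xp_def)
    qed
  qed
  define t where "t y = (x y - y) / y" for y
  have ty: "((\<lambda>y. t y * y powr \<beta>) \<longlongrightarrow> - \<tau>) at_top"
  proof (rule tendstoI)
    fix r :: real assume "r > 0"
    define d where "d = min (r / 2) (1 / 2)"
    have d: "0 < d" "d < 1" "d < r" using \<open>r > 0\<close> by (auto simp: d_def)
    show "\<forall>\<^sub>F y in at_top. dist (t y * y powr \<beta>) (- \<tau>) < r"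
      using bounds[OF d(1,2)]
    proof eventually_elim
      case (elim y)
      define u where "u = y powr (1 - \<beta>)"
      have u0: "u > 0" using elim by (simp add: u_def)
      have "y powr \<beta> * u = y" using elim by (simp add: u_def powr_add[symmetric])
      then have "y powr \<beta> = y / u" using u0 by (simp add: eq_divide_eq)
      then have tu: "t y * y powr \<beta> = (x y - y) / u"
        using elim by (simp add: t_def)
      have "(- \<tau> - d) * u \<le> x y - y" "x y - y \<le> (- \<tau> + d) * u" using elim by (auto simp: u_def)
      then have "- \<tau> - d \<le> (x y - y) / u" "(x y - y) / u \<le> - \<tau> + d"
        using u0 by (simp_all add: le_divide_eq divide_le_eq)
      then show ?case unfolding tu dist_real_def using d by linarith
    qed
  qed
  have t0: "(t \<longlongrightarrow> 0) at_top"
  proof (cases "\<beta> = 0")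
    case True
    then have "((\<lambda>y. t y * y powr 0) \<longlongrightarrow> 0) at_top" using ty \<beta>0 by (simp add: \<tau>_def)
    then show ?thesis
      by (rule Lim_transform_eventually) (use eventually_gt_at_top[of 0] in eventually_elim, simp)
  next
    case False
    then have "\<beta> > 0" using \<beta> by simp
    then have "((\<lambda>y. y powr (- \<beta>)) \<longlongrightarrow> 0) at_top" by real_asymp
    from tendsto_mult[OF ty this] have "((\<lambda>y. t y * y powr \<beta> * y powr (- \<beta>)) \<longlongrightarrow> 0) at_top" by simp
    then show ?thesis
      by (rule Lim_transform_eventually)
        (use eventually_gt_at_top[of 0] in eventually_elim, simp add: powr_minus)
  qed
  \<comment> \<open>Caratheodory's form of the derivative is an exact factorisation with a
    continuous factor \<open>G\<close>, so no remainder has to be estimated.\<close>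
  have "((\<lambda>s. (1 + s) powr - \<alpha>) has_real_derivative - \<alpha>) (at 0)"
    by (auto intro!: derivative_eq_intros)
  then obtain G where G: "\<And>z. (1 + z) powr - \<alpha> - (1 + 0) powr - \<alpha> = G z * (z - 0)" "isCont G 0" "G 0 = - \<alpha>"
    unfolding CARAT_DERIV by blast
  have "((\<lambda>y. G (t y)) \<longlongrightarrow> - \<alpha>) at_top" using isCont_tendsto_compose[OF G(2) t0] G(3) by simp
  then have "((\<lambda>y. c * (G (t y) * (t y * y powr \<beta>))) \<longlongrightarrow> c * (- \<alpha> * (- \<tau>))) at_top"
    by (intro tendsto_mult ty tendsto_const)
  moreover have "- \<alpha> * (- \<tau>) = \<omega>" using \<alpha> by (simp add: \<tau>_def)
  ultimately have "((\<lambda>y. c * (G (t y) * (t y * y powr \<beta>))) \<longlongrightarrow> c * \<omega>) at_top" by (simp only:)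
  moreover have "\<forall>\<^sub>F y in at_top. t y > -1" using order_tendstoD(1)[OF t0, of "-1"] by simp
  with bounds[of "1/2", simplified] have "\<forall>\<^sub>F y in at_top. c * (G (t y) * (t y * y powr \<beta>)) = (E y - c * y powr - \<alpha>) * y powr (\<alpha> + \<beta>)"
  proof eventually_elim
    case (elim y)
    have xy: "x y = y * (1 + t y)" using elim by (simp add: t_def field_simps)
    have "x y powr - \<alpha> = (E y / c)" unfolding x_def using elim c \<alpha> by (simp add: powr_powr)
    then have "E y = c * x y powr - \<alpha>" using c by simp
    also have "\<dots> = c * (y powr - \<alpha> * (1 + t y) powr - \<alpha>)" unfolding xy using elim by (subst powr_mult) auto
    finally have "E y - c * y powr - \<alpha> = c * (y powr - \<alpha> * ((1 + t y) powr - \<alpha> - 1))"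
      by (simp add: algebra_simps)
    also have "(1 + t y) powr - \<alpha> - 1 = G (t y) * t y" using G(1)[of "t y"] by simp
    finally have "(E y - c * y powr - \<alpha>) * y powr (\<alpha> + \<beta>)
        = c * (G (t y) * t y) * (y powr - \<alpha> * y powr (\<alpha> + \<beta>))" by (simp add: algebra_simps)
    also have "y powr - \<alpha> * y powr (\<alpha> + \<beta>) = y powr \<beta>" by (simp add: powr_add[symmetric])
    finally show ?case by (simp add: algebra_simps)
  qed
  ultimately show ?thesis unfolding E_def by (rule Lim_transform_eventually)
qed

section \<open>Power-law eigenvalues\<close>

context diagonal_operator
begin

text \<open>The block construction covers at a precision slightly coarser than its parameter
  \<delta>. This bounds the cost per coordinate of starting from a smaller \<delta>.\<close>

lemma excess_change_precision:
  assumes "0 < \<delta>" "\<delta> \<le> \<epsilon>"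
  shows "excess \<delta> n \<le> excess \<epsilon> n + ln (\<epsilon> / \<delta>)"
proof -
  have p: "max (mu n) \<epsilon> > 0" using assms by (simp add: less_max_iff_disj)
  have "max (mu n) \<delta> / \<delta> \<le> max (mu n) \<epsilon> / \<delta>" using assms by (intro divide_right_mono) auto
  then have "excess \<delta> n \<le> ln (max (mu n) \<epsilon> / \<delta>)"
    unfolding excess_def using assms p
    by (subst ln_le_cancel_iff) (auto intro!: divide_pos_pos simp: less_max_iff_disj)
  also have "\<dots> = ln (max (mu n) \<epsilon> / \<epsilon>) + ln (\<epsilon> / \<delta>)"
    using assms p by (simp add: ln_div)
  finally show ?thesis by (simp add: excess_def)
qed

definition num_axes_above :: "real \<Rightarrow> nat" where
  "num_axes_above \<epsilon> = (LEAST n. mu n \<le> \<epsilon>)"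

context
  assumes mu_null: "mu \<longlonglongrightarrow> 0"
begin

lemma mu_num_axes_above: "\<epsilon> > 0 \<Longrightarrow> mu (num_axes_above \<epsilon>) \<le> \<epsilon>"
proof -
  assume "\<epsilon> > 0"
  then have "\<forall>\<^sub>F n in sequentially. mu n < \<epsilon>" using mu_null by (rule order_tendstoD(2)[rotated])
  then have "\<exists>n. mu n \<le> \<epsilon>" unfolding eventually_sequentially by (meson less_imp_le order_refl)
  then show ?thesis unfolding num_axes_above_def by (rule LeastI_ex)
qed

lemma mu_gt_of_less_num_axes_above: "n < num_axes_above \<epsilon> \<Longrightarrow> mu n > \<epsilon>"
  unfolding num_axes_above_def using not_less_Least by fastforce

text \<open>\<open>excess\<close> vanishes past the long axes, so the bound does not depend on how
  many coordinates \<open>m\<close> the cover uses.\<close>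

lemma sum_excess_le:
  assumes "\<epsilon> > 0"
  shows "(\<Sum>n<m. excess \<epsilon> n) \<le> (\<Sum>n<num_axes_above \<epsilon>. ln (mu n / \<epsilon>))"
proof -
  have "(\<Sum>n<m. excess \<epsilon> n) \<le> (\<Sum>n<max m (num_axes_above \<epsilon>). excess \<epsilon> n)"
    using excess_nonneg[OF assms] by (intro sum_mono2) auto
  also have "\<dots> = (\<Sum>n<num_axes_above \<epsilon>. excess \<epsilon> n)"
  proof (rule sum.mono_neutral_right)
    show "\<forall>n\<in>{..<max m (num_axes_above \<epsilon>)} - {..<num_axes_above \<epsilon>}. excess \<epsilon> n = 0"
    proof
      fix n assume "n \<in> {..<max m (num_axes_above \<epsilon>)} - {..<num_axes_above \<epsilon>}"
      then have "mu n \<le> \<epsilon>" using mu_antimono[of "num_axes_above \<epsilon>" n] mu_num_axes_above[OF assms] by auto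
      then show "excess \<epsilon> n = 0" using assms by (simp add: excess_def max_def)
    qed
  qed auto
  also have "\<dots> = (\<Sum>n<num_axes_above \<epsilon>. ln (mu n / \<epsilon>))"
    by (rule sum.cong) (auto simp: excess_def max_def dest: mu_gt_of_less_num_axes_above)
  finally show ?thesis .
qed

end

end

section \<open>Entropy asymptotics for two-term power laws\<close>

lemma tendsto_0_of_power_law:
  fixes lam :: "nat \<Rightarrow> real"
  assumes c: "c > 0" and \<alpha>: "\<alpha> > 0" and lim: "(\<lambda>n. lam n * real n powr \<alpha> / c) \<longlonglongrightarrow> 1"
  shows "lam \<longlonglongrightarrow> 0"
proof -
  have "(\<lambda>n. c * real n powr - \<alpha>) \<longlonglongrightarrow> 0" using \<alpha> c by real_asymp
  from tendsto_mult[OF lim this]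
  have "(\<lambda>n. lam n * real n powr \<alpha> / c * (c * real n powr - \<alpha>)) \<longlonglongrightarrow> 0" by simp
  then show ?thesis
  proof (rule Lim_transform_eventually)
    show "\<forall>\<^sub>F n in sequentially. lam n * real n powr \<alpha> / c * (c * real n powr - \<alpha>) = lam n"
      using eventually_gt_at_top[of 0] by eventually_elim (use c in \<open>simp add: powr_minus\<close>)
  qed
qed

locale power_law_operator = diagonal_operator T e mu
  for T :: "'a::real_inner \<Rightarrow> 'a" and e :: "nat \<Rightarrow> 'a" and mu :: "nat \<Rightarrow> real" +
  fixes lam :: "nat \<Rightarrow> real" and c \<alpha> \<beta> \<gamma> :: real
  assumes mu_lam: "mu n = lam (Suc n)"
    and c_pos: "c > 0" and \<alpha>_pos: "\<alpha> > 0" and \<beta>: "0 \<le> \<beta>" "\<beta> < 1 / 2"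
    and first_order: "(\<lambda>n. lam n * real n powr \<alpha> / c) \<longlonglongrightarrow> 1"
    and second_order: "(\<lambda>n. ln (lam n * real n powr \<alpha> / c) * real n powr \<beta>) \<longlonglongrightarrow> \<gamma>"
begin

definition log_ratio :: "nat \<Rightarrow> real" where "log_ratio n = ln (lam n * real n powr \<alpha> / c)"

definition log_ratio_sum :: "nat \<Rightarrow> real" where "log_ratio_sum d = (\<Sum>n<d. log_ratio (Suc n))"

lemma mu_tendsto_0: "mu \<longlonglongrightarrow> 0"
  unfolding mu_lam by (rule LIMSEQ_Suc[OF tendsto_0_of_power_law[OF c_pos \<alpha>_pos first_order]])

text \<open>At the scale \<open>c * x powr - \<alpha>\<close> the logarithm splits into a part that
  is the same for all spectra with exponent \<alpha> and a correction independent of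
  \<open>x\<close>, which carries the second-order term.\<close>

lemma ln_mu_over:
  assumes "x > 0"
  shows "ln (mu n / (c * x powr - \<alpha>)) = \<alpha> * ln (x / real (Suc n)) + log_ratio (Suc n)"
proof -
  have "lam (Suc n) > 0" using mu_pos[of n] by (simp add: mu_lam)
  then show ?thesis unfolding log_ratio_def mu_lam using assms c_pos
    by (simp add: ln_div ln_mult ln_powr algebra_simps)
qed

text \<open>Stated for any \<open>d x\<close> asymptotic to \<open>x\<close>, since the two bounds
  truncate differently: at the integer part of \<open>x\<close> from below, at the number of long
  axes from above.\<close>

lemma log_ratio_sum_asymptotics:
  fixes d :: "real \<Rightarrow> nat"
  assumes d: "((\<lambda>x. real (d x) / x) \<longlongrightarrow> 1) at_top"
  shows "((\<lambda>x. log_ratio_sum (d x) / x powr (1 - \<beta>)) \<longlongrightarrow> \<gamma> / (1 - \<beta>)) at_top"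
proof -
  have b: "0 \<le> \<beta>" "\<beta> < 1" using \<beta> by auto
  have G: "(\<lambda>d. log_ratio_sum d / real d powr (1 - \<beta>)) \<longlonglongrightarrow> \<gamma> / (1 - \<beta>)"
    unfolding log_ratio_sum_def by (rule sum_powr_asymptotics[OF b]) (use second_order in \<open>simp add: log_ratio_def\<close>)
  have XX: "filterlim (\<lambda>x. real (d x) / x * x) at_top at_top"
    by (rule filterlim_tendsto_pos_mult_at_top[OF d _ filterlim_ident]) simp
  have "\<forall>\<^sub>F x in at_top. real (d x) / x * x = real (d x)"
    using eventually_gt_at_top[of "0::real"] by eventually_elim simp
  then have "filterlim (\<lambda>x. real (d x)) at_top at_top"
    by (rule iffD1[OF filterlim_cong[OF refl refl] XX])
  then have dtop: "filterlim d at_top at_top"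
    unfolding filterlim_at_top by (metis (mono_tags, lifting) eventually_mono of_nat_le_iff)
  have "((\<lambda>x. log_ratio_sum (d x) / real (d x) powr (1 - \<beta>) * (real (d x) / x) powr (1 - \<beta>))
      \<longlongrightarrow> \<gamma> / (1 - \<beta>) * 1 powr (1 - \<beta>)) at_top"
    by (intro tendsto_mult filterlim_compose[OF G dtop] tendsto_powr d tendsto_const) simp
  then have L: "((\<lambda>x. log_ratio_sum (d x) / real (d x) powr (1 - \<beta>) * (real (d x) / x) powr (1 - \<beta>))
      \<longlongrightarrow> \<gamma> / (1 - \<beta>)) at_top" by simp
  have "\<forall>\<^sub>F x in at_top. d x \<ge> 1" using dtop unfolding filterlim_at_top by blast
  then have "\<forall>\<^sub>F x in at_top. log_ratio_sum (d x) / real (d x) powr (1 - \<beta>) * (real (d x) / x) powr (1 - \<beta>)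
      = log_ratio_sum (d x) / x powr (1 - \<beta>)"
    using eventually_gt_at_top[of 0] by eventually_elim (simp add: powr_divide)
  then show ?thesis by (rule Lim_transform_eventually[OF L])
qed

text \<open>The number \<open>d\<close> of long axes satisfies
  \<open>lam (d + 1) \<le> \<epsilon> < lam d\<close>. Solving both inequalities for
  \<open>d / x\<close> encloses it between \<alpha>-th roots of quantities tending to 1, up to
  \<open>1 / x\<close>.\<close>

lemma num_axes_above_asymptotics: "((\<lambda>x. real (num_axes_above (c * x powr - \<alpha>)) / x) \<longlongrightarrow> 1) at_top"
proof -
  define ds where "ds x = num_axes_above (c * x powr - \<alpha>)" for x
  define \<rho> where "\<rho> n = lam n * real n powr \<alpha> / c" for n
  have \<rho>: "\<rho> \<longlonglongrightarrow> 1" unfolding \<rho>_def by (rule first_order)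
  have lim0: "((\<lambda>x. c * x powr - \<alpha>) \<longlongrightarrow> 0) at_top" using \<alpha>_pos c_pos by real_asymp
  have dtop: "filterlim ds at_top at_top"
    unfolding filterlim_at_top
  proof
    fix N
    have "\<forall>\<^sub>F x in at_top. c * x powr - \<alpha> < mu N" by (rule order_tendstoD(2)[OF lim0 mu_pos])
    then show "\<forall>\<^sub>F x in at_top. N \<le> ds x" using eventually_gt_at_top[of 0]
    proof eventually_elim
      case (elim x)
      have "mu (ds x) \<le> c * x powr - \<alpha>" unfolding ds_def using c_pos elim by (intro mu_num_axes_above mu_tendsto_0) simp
      then show ?case using elim mu_antimono[of "ds x" N] by (cases "N \<le> ds x") auto
    qed
  qed
  have root: "((\<lambda>x. \<rho> (f x) powr (1 / \<alpha>)) \<longlongrightarrow> 1) at_top" if "filterlim f at_top at_top" for f :: "real \<Rightarrow> nat"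
  proof -
    have "((\<lambda>x. \<rho> (f x) powr (1 / \<alpha>)) \<longlongrightarrow> 1 powr (1 / \<alpha>)) at_top"
      by (intro tendsto_powr filterlim_compose[OF \<rho> that] tendsto_const) simp
    then show ?thesis by simp
  qed
  have sds: "filterlim (\<lambda>x. Suc (ds x)) at_top at_top"
    by (rule filterlim_compose[OF filterlim_Suc dtop])
  have up: "\<forall>\<^sub>F x in at_top. real (ds x) / x \<le> \<rho> (ds x) powr (1 / \<alpha>)"
  proof -
    have "\<forall>\<^sub>F x in at_top. ds x \<ge> 1" using dtop unfolding filterlim_at_top by blast
    then show ?thesis using eventually_gt_at_top[of 0]
    proof eventually_elim
      case (elim x)
      have "c * x powr - \<alpha> < mu (ds x - 1)"
        using elim unfolding ds_def by (intro mu_gt_of_less_num_axes_above mu_tendsto_0) simp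
      then have "c * x powr - \<alpha> < lam (ds x)" using elim by (simp add: mu_lam)
      then have "c * x powr - \<alpha> * real (ds x) powr \<alpha> / c \<le> \<rho> (ds x)"
        unfolding \<rho>_def using c_pos by (intro divide_right_mono mult_right_mono) auto
      then have "(real (ds x) / x) powr \<alpha> \<le> \<rho> (ds x)"
        using elim c_pos by (simp add: powr_divide powr_minus field_simps)
      then have "((real (ds x) / x) powr \<alpha>) powr (1 / \<alpha>) \<le> \<rho> (ds x) powr (1 / \<alpha>)"
        using \<alpha>_pos by (intro powr_mono2) auto
      then show ?case using elim \<alpha>_pos by (simp add: powr_powr)
    qed
  qed
  have low: "\<forall>\<^sub>F x in at_top. \<rho> (Suc (ds x)) powr (1 / \<alpha>) - 1 / x \<le> real (ds x) / x"
    using eventually_gt_at_top[of 0]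
  proof eventually_elim
    case (elim x)
    have "mu (ds x) \<le> c * x powr - \<alpha>" unfolding ds_def using c_pos elim by (intro mu_num_axes_above mu_tendsto_0) simp
    then have "lam (Suc (ds x)) \<le> c * x powr - \<alpha>" by (simp add: mu_lam)
    then have "\<rho> (Suc (ds x)) \<le> c * x powr - \<alpha> * real (Suc (ds x)) powr \<alpha> / c"
      unfolding \<rho>_def using c_pos by (intro divide_right_mono mult_right_mono) auto
    also have "\<dots> = (real (Suc (ds x)) / x) powr \<alpha>"
      using elim c_pos by (simp add: powr_divide powr_minus field_simps)
    finally have le: "\<rho> (Suc (ds x)) \<le> (real (Suc (ds x)) / x) powr \<alpha>" .
    have "\<rho> (Suc (ds x)) \<ge> 0" unfolding \<rho>_def using mu_pos[of "ds x"] c_pos by (simp add: mu_lam)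
    then have "\<rho> (Suc (ds x)) powr (1 / \<alpha>) \<le> ((real (Suc (ds x)) / x) powr \<alpha>) powr (1 / \<alpha>)"
      using le \<alpha>_pos by (intro powr_mono2) auto
    also have "\<dots> = real (Suc (ds x)) / x" using elim \<alpha>_pos by (simp add: powr_powr)
    finally show ?case by (simp add: add_divide_distrib)
  qed
  have "((\<lambda>x. \<rho> (Suc (ds x)) powr (1 / \<alpha>) - 1 / x) \<longlongrightarrow> 1 - 0) at_top"
    by (intro tendsto_diff root[OF sds]) real_asymp
  then have "((\<lambda>x. real (ds x) / x) \<longlongrightarrow> 1) at_top"
    using tendsto_sandwich[OF low up _ root[OF dtop]] by simp
  then show ?thesis by (simp add: ds_def)
qed

text \<open>The free dimension is taken as the integer part of \<open>x\<close>, so that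
  \<open>d \<le> x\<close>. The 2 combines the rounding of \<open>x\<close> with the constant of the
  factorial estimate.\<close>

lemma ln_covering_number_ge:
  assumes "x \<ge> 1"
  shows "\<alpha> * x - \<alpha> * (2 + ln x) + log_ratio_sum (nat \<lfloor>x\<rfloor>) \<le> ln (real (covering_number (c * x powr - \<alpha>) K))"
proof -
  define d where "d = nat \<lfloor>x\<rfloor>"
  have d: "d \<ge> 1" "real d \<le> x" "real d \<ge> x - 1" unfolding d_def using assms by linarith+
  have "ln (real d) \<le> ln x" using d by simp
  then have "x - (2 + ln x) \<le> real d - ln (real d) - 1" using d by linarith
  also have "\<dots> \<le> (\<Sum>n<d. ln (x / real (Suc n)))" by (rule sum_ln_over_ge[OF d(1,2)])
  finally have "\<alpha> * (x - (2 + ln x)) \<le> \<alpha> * (\<Sum>n<d. ln (x / real (Suc n)))"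
    using \<alpha>_pos by (intro mult_left_mono) auto
  then have "\<alpha> * x - \<alpha> * (2 + ln x) + log_ratio_sum d \<le> (\<Sum>n<d. ln (mu n / (c * x powr - \<alpha>)))"
    using assms by (simp add: ln_mu_over log_ratio_sum_def sum.distrib sum_distrib_left right_diff_distrib)
  also have "\<dots> \<le> ln (real (covering_number (c * x powr - \<alpha>) K))"
    using assms c_pos by (intro entropy_lower_bound) simp
  finally show ?thesis by (simp add: d_def)
qed

lemma ln_covering_number_le:
  "\<exists>A B. \<forall>\<^sub>F x in at_top. ln (real (covering_number (c * x powr - \<alpha>) K))
     \<le> \<alpha> * x + log_ratio_sum (num_axes_above (c * x powr - \<alpha>)) + sqrt x * (A + B * ln x)"
proof -
  define a0 where "a0 = \<bar>log_ratio 1\<bar> + 1"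
  \<comment> \<open>Past index \<open>2 * x\<close> the axes are at most
    \<open>s * c * (2 * x) powr - \<alpha>\<close>, which is \<open>\<epsilon> / s\<close> because
    \<open>s * s = 2 powr \<alpha>\<close>. One factor \<open>s\<close> pays for the deviation of
    \<open>lam\<close> from its power law, the other for passing from \<epsilon> to the smaller
    \<delta>.\<close>
  define s where "s = 2 powr (\<alpha> / 2)"
  have s1: "s > 1" using \<alpha>_pos by (simp add: s_def)
  have ss: "s * s = 2 powr \<alpha>" by (simp add: s_def powr_add[symmetric])
  obtain N0 where N0: "\<And>n. n \<ge> N0 \<Longrightarrow> lam n * real n powr \<alpha> / c < s"
    using order_tendstoD(2)[OF first_order s1] unfolding eventually_sequentially by blast
  \<comment> \<open>The 1 comes from the change of precision, the factor 2 from
    \<open>q \<le> 2 * sqrt x\<close> and the factor 4 from \<open>k \<le> 4 * sqrt x\<close>; 33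
    appears in \<open>M + 1 \<le> 33 * x\<^sup>2\<close>.\<close>
  define A where "A = 1 + 2 * a0 + 4 * (ln 33 + ln 1000 + 4 * ln 2 + a0)"
  define B where "B = 2 * \<alpha> + 4 * (6 + \<alpha>)"
  \<comment> \<open>\<open>x \<ge> N0\<close> makes the first-order estimate valid from index
    \<open>2 * x\<close> on; the last threshold yields \<open>\<sigma> \<le> s\<close>.\<close>
  have "\<forall>\<^sub>F x in at_top. x \<ge> max 1 (max (real N0) (1 / (s\<^sup>2 - 1)))" by (rule eventually_ge_at_top)
  then have "\<forall>\<^sub>F x in at_top. ln (real (covering_number (c * x powr - \<alpha>) K))
     \<le> \<alpha> * x + log_ratio_sum (num_axes_above (c * x powr - \<alpha>)) + sqrt x * (A + B * ln x)"
  proof eventually_elim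
    case (elim x)
    have x1: "x \<ge> 1" and xN: "x \<ge> real N0" and xs: "x \<ge> 1 / (s\<^sup>2 - 1)" using elim by auto
    define \<epsilon> where "\<epsilon> = c * x powr - \<alpha>"
    have eps: "\<epsilon> > 0" using c_pos x1 by (simp add: \<epsilon>_def)
    have sq1: "sqrt x \<ge> 1" using x1 by simp
    have sqx: "sqrt x * sqrt x = x" using x1 by simp
    define q where "q = nat \<lceil>sqrt x\<rceil>"
    have q: "sqrt x \<le> real q" "real q \<le> 2 * sqrt x" unfolding q_def using sq1 by linarith+
    have q0: "q > 0" using q sq1 by (cases q) auto
    have qx: "x \<le> real q * real q" using mult_mono[OF q(1) q(1)] sqx sq1 by simp
    \<comment> \<open>\<open>k * q \<ge> 2 * x\<close> carries the blocks well past the roughly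
      \<open>x\<close> long axes. The choice of \<open>M\<close> makes
      \<open>k / M = 1 / (k * q)\<close>, so the change of precision, summed over all
      \<open>k * q\<close> coordinates, costs at most 1.\<close>
    define k where "k = 2 * q"
    define M where "M = k * k * q"
    have M0: "M > 0" using q0 by (simp add: M_def k_def)
    have kM: "real k / real M = 1 / (real k * real q)" using q0 by (simp add: M_def k_def)
    define \<sigma> where "\<sigma> = sqrt (1 + real k / real M)"
    have kq: "real k * real q = 2 * (real q * real q)" by (simp add: k_def)
    have kqx: "real k * real q \<ge> 2 * x" unfolding kq using qx by simp
    have "real k / real M \<le> 1 / x" unfolding kM using kqx x1 by (intro divide_left_mono) auto
    also have "1 / x \<le> s\<^sup>2 - 1"
    proof -
      have "s\<^sup>2 - 1 > 0" using s1 by (simp add: one_less_power)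
      then show ?thesis using xs x1 by (simp add: field_simps)
    qed
    finally have "\<sigma> \<le> sqrt (s\<^sup>2)" unfolding \<sigma>_def by (subst real_sqrt_le_iff) linarith
    then have \<sigma>s: "\<sigma> \<le> s" using s1 by simp
    have \<sigma>1: "\<sigma> \<ge> 1" unfolding \<sigma>_def by simp
    have ln\<sigma>: "ln \<sigma> \<le> 1 / (real k * real q)"
    proof -
      have "ln \<sigma> = ln (1 + real k / real M) / 2" unfolding \<sigma>_def by (intro ln_sqrt) (simp add: add_pos_nonneg)
      also have "\<dots> \<le> (real k / real M) / 2" by (intro divide_right_mono ln_add_one_self_le_self) auto
      also have "\<dots> \<le> real k / real M"
      proof -
        have half: "z / 2 \<le> z" if "z \<ge> 0" for z :: real using that by simp
        show ?thesis by (rule half) simp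
      qed
      finally show ?thesis by (simp add: kM)
    qed
    have "1 \<le> real k * real q" using kqx x1 by linarith
    then have ln\<sigma>1: "ln \<sigma> \<le> 1" using ln\<sigma> by (smt (verit) divide_le_eq_1)
    define \<delta> where "\<delta> = \<epsilon> / \<sigma>"
    have \<delta>: "\<delta> > 0" "\<delta> \<le> \<epsilon>" "\<delta> * \<sigma> = \<epsilon>" "\<epsilon> / \<delta> = \<sigma>"
      using eps \<sigma>1 by (auto simp: \<delta>_def divide_le_eq mult_le_cancel_left1)
    have D: "mu (k * q) \<le> \<delta>"
    proof -
      define n where "n = Suc (k * q)"
      have n2: "real n \<ge> 2 * x" using kqx by (simp add: n_def)
      then have "real n \<ge> real N0" using xN x1 by linarith
      then have "lam n * real n powr \<alpha> / c \<le> s" using N0[of n] by simp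
      then have "lam n * real n powr \<alpha> \<le> s * c" using c_pos by (simp add: divide_le_eq)
      moreover have "lam n > 0" using mu_pos[of "k * q"] by (simp add: mu_lam n_def)
      moreover have "(2 * x) powr \<alpha> \<le> real n powr \<alpha>" using n2 x1 \<alpha>_pos by (intro powr_mono2) auto
      ultimately have "lam n * (2 * x) powr \<alpha> \<le> s * c" by (smt (verit) mult_left_mono)
      then have "lam n * (s * s * x powr \<alpha>) \<le> s * c" using x1 by (simp add: powr_mult ss)
      then have "s * (lam n * s * x powr \<alpha>) \<le> s * c" by (simp add: mult_ac)
      then have "lam n * s * x powr \<alpha> \<le> c" using s1 by simp
      then have "lam n * s \<le> \<epsilon>" using x1 by (simp add: \<epsilon>_def powr_minus field_simps)
      then have "lam n \<le> \<epsilon> / s" using s1 by (simp add: le_divide_eq)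
      also have "\<dots> \<le> \<delta>" unfolding \<delta>_def using \<sigma>s \<sigma>1 eps by (intro divide_left_mono) auto
      finally show ?thesis by (simp add: mu_lam n_def)
    qed
    have lnx: "ln x \<ge> 0" using x1 by simp
    have E0: "excess \<delta> 0 \<le> \<alpha> * ln x + a0"
    proof -
      have "excess \<epsilon> 0 \<le> \<alpha> * ln x + \<bar>log_ratio 1\<bar>"
      proof (cases "mu 0 \<le> \<epsilon>")
        case True
        then show ?thesis using eps lnx \<alpha>_pos by (simp add: excess_def max_def)
      next
        case False
        then have "excess \<epsilon> 0 = ln (mu 0 / \<epsilon>)" by (simp add: excess_def max_def)
        also have "\<dots> = \<alpha> * ln x + log_ratio 1" unfolding \<epsilon>_def using ln_mu_over[of x 0] x1 by simp
        finally show ?thesis by simp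
      qed
      then show ?thesis using excess_change_precision[OF \<delta>(1,2), of 0] ln\<sigma>1 \<delta>(4) by (simp add: a0_def)
    qed
    have "(\<Sum>n<k * q. excess \<delta> n) \<le> (\<Sum>n<k * q. excess \<epsilon> n + ln \<sigma>)"
      using excess_change_precision[OF \<delta>(1,2)] \<delta>(4) by (intro sum_mono) simp
    also have "\<dots> = (\<Sum>n<k * q. excess \<epsilon> n) + real k * real q * ln \<sigma>" by (simp add: sum.distrib)
    also have "real k * real q * ln \<sigma> \<le> 1" using ln\<sigma> q0 by (simp add: field_simps k_def)
    also have "(\<Sum>n<k * q. excess \<epsilon> n) \<le> (\<Sum>n<num_axes_above \<epsilon>. ln (mu n / \<epsilon>))"
      by (rule sum_excess_le[OF mu_tendsto_0 eps])
    also have "\<dots> = \<alpha> * (\<Sum>n<num_axes_above \<epsilon>. ln (x / real (Suc n))) + log_ratio_sum (num_axes_above \<epsilon>)"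
      unfolding \<epsilon>_def log_ratio_sum_def using x1 by (simp add: ln_mu_over sum.distrib sum_distrib_left)
    also have "\<dots> \<le> \<alpha> * x + log_ratio_sum (num_axes_above \<epsilon>)"
      using sum_ln_over_le[of x "num_axes_above \<epsilon>"] x1 \<alpha>_pos by (intro add_right_mono mult_left_mono) auto
    finally have S1: "(\<Sum>n<k * q. excess \<delta> n) \<le> \<alpha> * x + log_ratio_sum (num_axes_above \<epsilon>) + 1" by simp
    have q2x: "real q \<le> 2 * x" using q(2) sqx sq1 mult_left_mono[of 1 "sqrt x" "sqrt x"] by simp
    have lnq: "ln (real q) \<le> ln 2 + ln x"
    proof -
      have "ln (real q) \<le> ln (2 * x)" using q2x q0 x1 by (subst ln_le_cancel_iff) auto
      then show ?thesis using x1 by (simp add: ln_mult)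
    qed
    have lnM: "ln (real M + 1) \<le> ln 33 + 2 * ln x"
    proof -
      have "real M = 4 * (real q * real q * real q)" by (simp add: M_def k_def)
      also have "\<dots> \<le> 4 * ((2 * sqrt x) * (2 * sqrt x) * (2 * x))"
        using q q2x sq1 by (intro mult_left_mono mult_mono) auto
      also have "\<dots> = 32 * (x * x)" using sqx by (simp add: mult_ac)
      finally have "real M + 1 \<le> 33 * (x * x)" using mult_mono[OF x1 x1] x1 by simp
      then have "ln (real M + 1) \<le> ln (33 * (x * x))" using x1 by (subst ln_le_cancel_iff) auto
      also have "\<dots> = ln 33 + 2 * ln x" using x1 by (simp add: ln_mult)
      finally show ?thesis .
    qed
    have E0n: "excess \<delta> 0 \<ge> 0" using excess_nonneg[OF \<delta>(1)] .
    have t1: "real q * excess \<delta> 0 \<le> (2 * sqrt x) * (\<alpha> * ln x + a0)"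
      using q E0 E0n sq1 by (intro mult_mono) auto
    have "real k * (ln (real M + 1) + ln 1000 + 4 * ln (real q) + excess \<delta> 0)
        \<le> (4 * sqrt x) * ((ln 33 + 2 * ln x) + ln 1000 + 4 * (ln 2 + ln x) + (\<alpha> * ln x + a0))"
    proof (rule mult_mono)
      have "ln (real q) \<ge> 0" using q0 by simp
      then show "0 \<le> ln (real M + 1) + ln 1000 + 4 * ln (real q) + excess \<delta> 0"
        using E0n by (intro add_nonneg_nonneg) auto
    qed (use q E0 lnM lnq sq1 in \<open>auto simp: k_def intro!: add_mono\<close>)
    moreover have "ln (real (covering_number \<epsilon> K)) \<le> (\<Sum>n<k * q. excess \<delta> n) + real q * excess \<delta> 0
        + real k * (ln (real M + 1) + ln 1000 + 4 * ln (real q) + excess \<delta> 0)"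
      using entropy_upper_bound[OF q0 M0 \<delta>(1) D] \<delta>(3) by (simp add: \<sigma>_def)
    ultimately have "ln (real (covering_number \<epsilon> K)) \<le> \<alpha> * x + log_ratio_sum (num_axes_above \<epsilon>) + sqrt x
        + (2 * sqrt x) * (\<alpha> * ln x + a0)
        + (4 * sqrt x) * ((ln 33 + 2 * ln x) + ln 1000 + 4 * (ln 2 + ln x) + (\<alpha> * ln x + a0))"
      using S1 t1 sq1 by linarith
    also have "\<dots> = \<alpha> * x + log_ratio_sum (num_axes_above \<epsilon>) + sqrt x * (A + B * ln x)"
      by (simp add: A_def B_def algebra_simps)
    finally show ?case by (simp add: \<epsilon>_def)
  qed
  then show ?thesis by blast
qed

lemma ln_covering_number_asymptotics:
  "((\<lambda>x. (ln (real (covering_number (c * x powr - \<alpha>) K)) - \<alpha> * x) / x powr (1 - \<beta>)) \<longlongrightarrow> \<gamma> / (1 - \<beta>)) at_top"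
proof -
  define F where "F x = ln (real (covering_number (c * x powr - \<alpha>) K))" for x
  obtain A B where AB: "\<forall>\<^sub>F x in at_top. F x \<le> \<alpha> * x + log_ratio_sum (num_axes_above (c * x powr - \<alpha>)) + sqrt x * (A + B * ln x)"
    using ln_covering_number_le unfolding F_def by blast
  have up: "\<forall>\<^sub>F x in at_top. (F x - \<alpha> * x) / x powr (1 - \<beta>)
      \<le> log_ratio_sum (num_axes_above (c * x powr - \<alpha>)) / x powr (1 - \<beta>) + sqrt x * (A + B * ln x) / x powr (1 - \<beta>)"
    using AB by eventually_elim (simp add: add_divide_distrib[symmetric] divide_right_mono)
  have low: "\<forall>\<^sub>F x in at_top. log_ratio_sum (nat \<lfloor>x\<rfloor>) / x powr (1 - \<beta>) - \<alpha> * (2 + ln x) / x powr (1 - \<beta>)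
      \<le> (F x - \<alpha> * x) / x powr (1 - \<beta>)"
    using eventually_ge_at_top[of 1]
  proof eventually_elim
    case (elim x)
    then show ?case using ln_covering_number_ge[OF elim]
      by (simp add: F_def diff_divide_distrib[symmetric] divide_right_mono)
  qed
  have "((\<lambda>x. real (nat \<lfloor>x\<rfloor>) / x) \<longlongrightarrow> 1) at_top"
  proof (rule tendsto_sandwich)
    show "\<forall>\<^sub>F x in at_top. (x - 1) / x \<le> real (nat \<lfloor>x\<rfloor>) / x" using eventually_ge_at_top[of 1]
    proof eventually_elim
      case (elim x)
      have "x - 1 \<le> real (nat \<lfloor>x\<rfloor>)" using elim by linarith
      then show ?case using elim by (intro divide_right_mono) auto
    qed
    show "\<forall>\<^sub>F x in at_top. real (nat \<lfloor>x\<rfloor>) / x \<le> 1" using eventually_ge_at_top[of "1::real"]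
    proof eventually_elim
      case (elim x)
      have "real (nat \<lfloor>x\<rfloor>) \<le> x" using elim by linarith
      then show ?case using elim by simp
    qed
    show "((\<lambda>x::real. (x - 1) / x) \<longlongrightarrow> 1) at_top" by real_asymp
  qed simp
  then have G1: "((\<lambda>x. log_ratio_sum (nat \<lfloor>x\<rfloor>) / x powr (1 - \<beta>)) \<longlongrightarrow> \<gamma> / (1 - \<beta>)) at_top"
    by (rule log_ratio_sum_asymptotics)
  have b: "1 - \<beta> > 0" using \<beta> by simp
  then have "((\<lambda>x. \<alpha> * (2 + ln x) / x powr (1 - \<beta>)) \<longlongrightarrow> 0) at_top"
    using \<alpha>_pos by real_asymp
  from tendsto_diff[OF G1 this]
  have L1: "((\<lambda>x. log_ratio_sum (nat \<lfloor>x\<rfloor>) / x powr (1 - \<beta>) - \<alpha> * (2 + ln x) / x powr (1 - \<beta>)) \<longlongrightarrow> \<gamma> / (1 - \<beta>)) at_top"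
    by simp
  from tendsto_add[OF log_ratio_sum_asymptotics[OF num_axes_above_asymptotics] sqrt_ln_negligible[OF \<beta>(2), of A B]]
  have L2: "((\<lambda>x. log_ratio_sum (num_axes_above (c * x powr - \<alpha>)) / x powr (1 - \<beta>) + sqrt x * (A + B * ln x) / x powr (1 - \<beta>))
      \<longlongrightarrow> \<gamma> / (1 - \<beta>)) at_top" by simp
  show ?thesis unfolding F_def[symmetric] by (rule tendsto_sandwich[OF low up L1 L2])
qed

end

section \<open>The expansions\<close>

text \<open>The substitution is undone by \<open>x = (c1 / eps) powr (1 / \<alpha>1)\<close>;
  \<open>N\<close> is the natural logarithm of the covering number, and \<open>ln 2\<close> converts
  the base.\<close>

lemma op_entropy_expansion:
  fixes N :: "real \<Rightarrow> real"
  assumes lim: "((\<lambda>x. (N (c1 * x powr - \<alpha>1) - \<alpha>1 * x) / x powr (1 - (\<alpha>2 - \<alpha>1))) \<longlongrightarrow>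
      c2 / c1 / (1 - (\<alpha>2 - \<alpha>1))) at_top"
    and c1: "c1 > 0" and a1: "\<alpha>1 > 0" and ab: "\<alpha>2 < \<alpha>1 + 1"
  shows "(\<lambda>eps. N eps / ln 2
            - (\<alpha>1 * c1 powr (1/\<alpha>1) / ln 2 * eps powr (-1/\<alpha>1)
               + c2 * c1 powr ((1 - \<alpha>2)/\<alpha>1) / (ln 2 * (\<alpha>1 - \<alpha>2 + 1))
                 * eps powr (-((\<alpha>1 - \<alpha>2 + 1)/\<alpha>1))))
         \<in> o[at_right 0](\<lambda>eps. eps powr (-((\<alpha>1 - \<alpha>2 + 1)/\<alpha>1)))"
proof (rule smalloI_tendsto)
  define \<kappa> where "\<kappa> = \<alpha>1 - \<alpha>2 + 1"
  have \<kappa>: "\<kappa> > 0" using ab by (simp add: \<kappa>_def)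
  have \<kappa>': "1 - (\<alpha>2 - \<alpha>1) = \<kappa>" by (simp add: \<kappa>_def)
  define \<omega> where "\<omega> = c2 / c1 / \<kappa>"
  define X where "X eps = (c1 / eps) powr (1 / \<alpha>1)" for eps
  define A where "A = c1 powr (\<kappa> / \<alpha>1)"
  have lnp: "ln 2 > (0::real)" by simp
  have "filterlim (\<lambda>eps. c1 / eps) at_top (at_right 0)" using c1 by real_asymp
  moreover have "filterlim (\<lambda>z::real. z powr (1 / \<alpha>1)) at_top at_top" using a1 by real_asymp
  ultimately have Xtop: "filterlim X at_top (at_right 0)"
    unfolding X_def by (rule filterlim_compose[rotated])
  have "((\<lambda>eps. (N (c1 * X eps powr - \<alpha>1) - \<alpha>1 * X eps) / X eps powr \<kappa>) \<longlongrightarrow> \<omega>) (at_right 0)"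
    using filterlim_compose[OF lim Xtop] unfolding \<kappa>' \<omega>_def .
  then have "((\<lambda>eps. A / ln 2 * ((N (c1 * X eps powr - \<alpha>1) - \<alpha>1 * X eps) / X eps powr \<kappa> - \<omega>))
      \<longlongrightarrow> A / ln 2 * (\<omega> - \<omega>)) (at_right 0)"
    by (intro tendsto_intros)
  then have L: "((\<lambda>eps. A / ln 2 * ((N (c1 * X eps powr - \<alpha>1) - \<alpha>1 * X eps) / X eps powr \<kappa> - \<omega>))
      \<longlongrightarrow> 0) (at_right 0)" by simp
  have "\<forall>\<^sub>F eps in at_right 0. A / ln 2 * ((N (c1 * X eps powr - \<alpha>1) - \<alpha>1 * X eps) / X eps powr \<kappa> - \<omega>)
      = (N eps / ln 2 - (\<alpha>1 * c1 powr (1/\<alpha>1) / ln 2 * eps powr (-1/\<alpha>1)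
               + c2 * c1 powr ((1 - \<alpha>2)/\<alpha>1) / (ln 2 * \<kappa>) * eps powr (-(\<kappa>/\<alpha>1)))) / eps powr (-(\<kappa>/\<alpha>1))"
    using eventually_at_right_less[of 0]
  proof eventually_elim
    case (elim eps)
    define P where "P = eps powr (-(\<kappa>/\<alpha>1))"
    have P0: "P > 0" using elim by (simp add: P_def)
    have A0: "A > 0" using c1 by (simp add: A_def)
    have "X eps powr - \<alpha>1 = (c1 / eps) powr (-1)" unfolding X_def using a1 by (simp add: powr_powr)
    also have "\<dots> = eps / c1" using elim c1 by (simp add: powr_minus)
    finally have e: "c1 * X eps powr - \<alpha>1 = eps" using c1 by simp
    have X1: "X eps = c1 powr (1/\<alpha>1) * eps powr (-1/\<alpha>1)"
      using powr_divide[of c1 eps "1/\<alpha>1"] powr_minus_divide[of eps "1/\<alpha>1"] elim c1 by (simp add: X_def)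
    have X2: "X eps powr \<kappa> = A * P"
      unfolding X1 A_def P_def using elim c1 by (simp add: powr_mult powr_powr)
    \<comment> \<open>The exponent \<open>(1 - \<alpha>2) / \<alpha>1\<close> of \<open>c1\<close>
      arises here: \<open>\<kappa> / \<alpha>1\<close> from the substitution, less 1 from the ratio
      \<open>c2 / c1\<close>.\<close>
    have "A / c1 = c1 powr (\<kappa> / \<alpha>1 - 1)" unfolding A_def using c1 by (simp add: powr_diff)
    also have "\<kappa> / \<alpha>1 - 1 = (1 - \<alpha>2) / \<alpha>1" using a1 by (simp add: \<kappa>_def field_simps)
    finally have A1: "c1 powr ((1 - \<alpha>2) / \<alpha>1) = A / c1" by simp
    have "A / ln 2 * ((N eps - \<alpha>1 * X eps) / (A * P) - \<omega>) = ((N eps - \<alpha>1 * X eps) / ln 2 - A * \<omega> / ln 2 * P) / P"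
      using A0 P0 lnp by (simp add: field_simps)
    also have "A * \<omega> / ln 2 = c2 * (A / c1) / (ln 2 * \<kappa>)" by (simp add: \<omega>_def mult_ac)
    finally have "A / ln 2 * ((N eps - \<alpha>1 * X eps) / (A * P) - \<omega>)
       = (N eps / ln 2 - (\<alpha>1 * X eps / ln 2 + c2 * (A / c1) / (ln 2 * \<kappa>) * P)) / P"
      by (simp add: diff_divide_distrib diff_diff_eq)
    then show ?case unfolding e X2 A1 P_def[symmetric] by (simp add: X1 mult.assoc)
  qed
  then show "((\<lambda>eps. (N eps / ln 2
            - (\<alpha>1 * c1 powr (1/\<alpha>1) / ln 2 * eps powr (-1/\<alpha>1)
               + c2 * c1 powr ((1 - \<alpha>2)/\<alpha>1) / (ln 2 * (\<alpha>1 - \<alpha>2 + 1))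
                 * eps powr (-((\<alpha>1 - \<alpha>2 + 1)/\<alpha>1)))) / eps powr (-((\<alpha>1 - \<alpha>2 + 1)/\<alpha>1))) \<longlongrightarrow> 0) (at_right 0)"
    unfolding \<kappa>_def[symmetric] by (rule Lim_transform_eventually[OF L])
  show "\<forall>\<^sub>F eps in at_right 0. eps powr (-((\<alpha>1 - \<alpha>2 + 1)/\<alpha>1)) \<noteq> 0"
    using eventually_at_right_less[of 0] by eventually_elim simp
qed

text \<open>The condition \<open>N eps / ln 2 \<le> m\<close> reads
  \<open>N eps \<le> \<alpha>1 * y\<close> with \<open>y = m * ln 2 / \<alpha>1\<close>, so the
  generalized inverse is evaluated along this sequence. Its normalising exponent is
  \<open>\<alpha>1 + (\<alpha>2 - \<alpha>1) = \<alpha>2\<close>.\<close>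

lemma entropy_number_expansion:
  fixes N :: "real \<Rightarrow> real"
  assumes anti: "\<And>e e'. 0 < e \<Longrightarrow> e \<le> e' \<Longrightarrow> N e' \<le> N e"
    and lim: "((\<lambda>x. (N (c1 * x powr - \<alpha>1) - \<alpha>1 * x) / x powr (1 - (\<alpha>2 - \<alpha>1))) \<longlongrightarrow>
      c2 / c1 / (1 - (\<alpha>2 - \<alpha>1))) at_top"
    and c1: "c1 > 0" and a1: "\<alpha>1 > 0" and ab: "\<alpha>1 \<le> \<alpha>2" "\<alpha>2 < \<alpha>1 + 1"
    and c2: "\<alpha>1 = \<alpha>2 \<Longrightarrow> c2 = 0"
  shows "(\<lambda>m. Inf {eps. eps > 0 \<and> N eps / ln 2 \<le> real m}
            - (c1 * (\<alpha>1 / ln 2) powr \<alpha>1 * real m powr (-\<alpha>1)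
               + c2 / (\<alpha>1 - \<alpha>2 + 1) * (\<alpha>1 / ln 2) powr \<alpha>2 * real m powr (-\<alpha>2)))
         \<in> o[sequentially](\<lambda>m. real m powr (-\<alpha>2))"
proof (rule smalloI_tendsto)
  define \<omega> where "\<omega> = c2 / c1 / (1 - (\<alpha>2 - \<alpha>1))"
  have lnp: "ln 2 > (0::real)" by simp
  define y where "y m = real m * (ln 2 / \<alpha>1)" for m
  define E where "E m = Inf {eps. eps > 0 \<and> N eps / ln 2 \<le> real m}" for m
  define A where "A = (\<alpha>1 / ln 2) powr \<alpha>2"
  have E: "E m = Inf {e. e > 0 \<and> N e \<le> \<alpha>1 * y m}" for m
    unfolding E_def y_def using a1 lnp by (simp add: divide_le_eq mult.commute)
  have ytop: "filterlim y at_top sequentially" unfolding y_def using a1 by real_asymp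
  have "((\<lambda>y. (Inf {e. e > 0 \<and> N e \<le> \<alpha>1 * y} - c1 * y powr - \<alpha>1) * y powr (\<alpha>1 + (\<alpha>2 - \<alpha>1))) \<longlongrightarrow> c1 * \<omega>) at_top"
    unfolding \<omega>_def using c1 a1 ab c2 by (intro generalized_inverse_asymptotics anti lim) auto
  from filterlim_compose[OF this ytop]
  have "(\<lambda>m. (E m - c1 * y m powr - \<alpha>1) * y m powr \<alpha>2) \<longlonglongrightarrow> c1 * \<omega>" unfolding E by simp
  from tendsto_mult[OF tendsto_const tendsto_diff[OF this tendsto_const]]
  have "(\<lambda>m. A * ((E m - c1 * y m powr - \<alpha>1) * y m powr \<alpha>2 - c1 * \<omega>)) \<longlonglongrightarrow> A * (c1 * \<omega> - c1 * \<omega>)" .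
  then have L: "(\<lambda>m. A * ((E m - c1 * y m powr - \<alpha>1) * y m powr \<alpha>2 - c1 * \<omega>)) \<longlonglongrightarrow> 0" by simp
  have "\<forall>\<^sub>F m in sequentially. A * ((E m - c1 * y m powr - \<alpha>1) * y m powr \<alpha>2 - c1 * \<omega>)
      = (E m - (c1 * (\<alpha>1 / ln 2) powr \<alpha>1 * real m powr (-\<alpha>1)
               + c2 / (\<alpha>1 - \<alpha>2 + 1) * (\<alpha>1 / ln 2) powr \<alpha>2 * real m powr (-\<alpha>2))) / real m powr (-\<alpha>2)"
    using eventually_gt_at_top[of 0]
  proof eventually_elim
    case (elim m)
    define P where "P = real m powr \<alpha>2"
    have P0: "P > 0" using elim by (simp add: P_def)
    have P1: "real m powr (-\<alpha>2) = 1 / P" by (simp add: P_def powr_minus divide_inverse)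
    have A0: "A > 0" using a1 by (simp add: A_def)
    have y1: "y m powr - \<alpha>1 = (\<alpha>1 / ln 2) powr \<alpha>1 * real m powr - \<alpha>1"
      unfolding y_def using a1 elim by (simp add: powr_mult powr_divide powr_minus field_simps)
    have y2: "A * y m powr \<alpha>2 = P"
      unfolding y_def A_def P_def using a1 elim by (simp add: powr_mult powr_divide)
    have w: "c1 * \<omega> = c2 / (\<alpha>1 - \<alpha>2 + 1)"
    proof -
      have "1 - (\<alpha>2 - \<alpha>1) = \<alpha>1 - \<alpha>2 + 1" by simp
      then show ?thesis unfolding \<omega>_def using c1 by simp
    qed
    have "A * ((E m - c1 * y m powr - \<alpha>1) * y m powr \<alpha>2 - c1 * \<omega>)
        = (E m - c1 * y m powr - \<alpha>1) * (A * y m powr \<alpha>2) - c1 * \<omega> * A" by (simp add: algebra_simps)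
    also have "\<dots> = (E m - c1 * y m powr - \<alpha>1) * P - c1 * \<omega> * A" by (simp only: y2)
    also have "\<dots> = (E m - (c1 * y m powr - \<alpha>1 + c1 * \<omega> * A * (1 / P))) / (1 / P)"
      using P0 by (simp add: field_simps)
    finally show ?case unfolding y1 w P1 A_def by (simp add: mult.assoc)
  qed
  then show "(\<lambda>m. (Inf {eps. eps > 0 \<and> N eps / ln 2 \<le> real m}
            - (c1 * (\<alpha>1 / ln 2) powr \<alpha>1 * real m powr (-\<alpha>1)
               + c2 / (\<alpha>1 - \<alpha>2 + 1) * (\<alpha>1 / ln 2) powr \<alpha>2 * real m powr (-\<alpha>2))) / real m powr (-\<alpha>2)) \<longlonglongrightarrow> 0"
    unfolding E_def[symmetric] by (rule Lim_transform_eventually[OF L])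
  show "\<forall>\<^sub>F m in sequentially. real m powr (-\<alpha>2) \<noteq> 0"
    using eventually_gt_at_top[of 0] by eventually_elim simp
qed

theorem theorem1:
  fixes T :: "'a::{real_inner, complete_space} \<Rightarrow> 'a"
    and lam :: "nat \<Rightarrow> real"
    and c1 c2 \<alpha>1 \<alpha>2 :: real
  assumes sep: "separable_space TYPE('a)"
    and cpt: "compact_operator T"
    and selfadj: "\<forall>x y. inner (T x) y = inner x (T y)"
    and pos: "\<forall>x. inner (T x) x \<ge> 0"
    and eig: "eigenvalue_listing T lam"
    and lam_pos: "\<forall>n\<ge>1. lam n > 0"
    and asym: "(\<lambda>n. lam n - (c1 / real n powr \<alpha>1 + c2 / real n powr \<alpha>2))
                 \<in> o[sequentially](\<lambda>n. 1 / real n powr \<alpha>2)"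
    and c1_pos: "c1 > 0" and a1_pos: "\<alpha>1 > 0" and a2_pos: "\<alpha>2 > 0"
    and exps: "(\<alpha>1 < \<alpha>2 \<and> \<alpha>2 < \<alpha>1 + 1/2) \<or> (\<alpha>1 = \<alpha>2 \<and> c2 = 0)"
  shows "(\<lambda>eps. op_entropy eps T
            - (\<alpha>1 * c1 powr (1/\<alpha>1) / ln 2 * eps powr (-1/\<alpha>1)
               + c2 * c1 powr ((1 - \<alpha>2)/\<alpha>1) / (ln 2 * (\<alpha>1 - \<alpha>2 + 1))
                 * eps powr (-((\<alpha>1 - \<alpha>2 + 1)/\<alpha>1))))
         \<in> o[at_right 0](\<lambda>eps. eps powr (-((\<alpha>1 - \<alpha>2 + 1)/\<alpha>1)))
       \<and> (\<lambda>m. entropy_number m T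
            - (c1 * (\<alpha>1 / ln 2) powr \<alpha>1 * real m powr (-\<alpha>1)
               + c2 / (\<alpha>1 - \<alpha>2 + 1) * (\<alpha>1 / ln 2) powr \<alpha>2 * real m powr (-\<alpha>2)))
         \<in> o[sequentially](\<lambda>m. real m powr (-\<alpha>2))"
proof -
  have ab: "\<alpha>1 \<le> \<alpha>2" "\<alpha>2 < \<alpha>1 + 1 / 2" and c2: "\<alpha>1 = \<alpha>2 \<Longrightarrow> c2 = 0" using exps by auto
  have "\<alpha>1 < \<alpha>2 \<or> \<alpha>1 = \<alpha>2 \<and> c2 = 0" using exps by auto
  note ratio = ln_ratio_asymptotics[OF asym c1_pos this]
  have lam0: "lam \<longlonglongrightarrow> 0" by (rule tendsto_0_of_power_law[OF c1_pos a1_pos ratio(1)])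
  \<comment> \<open>Positive values recur only finitely often because \<open>lam\<close> tends to 0;
    other values do not occur in the list.\<close>
  have fin: "finite {n. 1 \<le> n \<and> lam n = \<mu>}" for \<mu>
  proof (cases "\<mu> > 0")
    case True
    then obtain k where "\<And>n. n \<ge> k \<Longrightarrow> lam n < \<mu>"
      using order_tendstoD(2)[OF lam0] unfolding eventually_sequentially by blast
    then have "{n. 1 \<le> n \<and> lam n = \<mu>} \<subseteq> {..<k}" by (force simp: not_less[symmetric])
    then show ?thesis by (rule finite_subset) simp
  next
    case False
    then have "{n. 1 \<le> n \<and> lam n = \<mu>} = {}" using lam_pos by auto
    then show ?thesis by (metis finite.emptyI)
  qed
  obtain e where e: "\<And>n. n \<ge> 1 \<Longrightarrow> T (e n) = lam n *\<^sub>R e n"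
    "\<And>m n. m \<ge> 1 \<Longrightarrow> n \<ge> 1 \<Longrightarrow> inner (e m) (e n) = (if m = n then 1 else 0)"
    "\<And>\<mu>. is_eigenvalue T \<mu> \<Longrightarrow> eigenspace T \<mu> = span (e ` {n. 1 \<le> n \<and> lam n = \<mu>})"
    using eigenbasis_of_listing[OF selfadj eig fin] by blast
  have dec: "\<forall>n\<ge>1. lam (Suc n) \<le> lam n"
    using eig unfolding eigenvalue_listing_def by (rule conjunct1)
  have mono: "lam (Suc n) \<le> lam (Suc m)" if "m \<le> n" for m n
    by (rule lift_Suc_antimono_le[of "\<lambda>n. lam (Suc n)", OF _ that]) (simp add: dec)
  have tail: "norm (T x) \<le> lam (Suc D) * norm x" if "\<And>n. n < D \<Longrightarrow> inner x (e (Suc n)) = 0" for D x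
  proof (rule norm_le_eigenvalue_on_complement[OF cpt selfadj pos eig lam_pos e(1) e(3)])
    fix n assume "n \<in> {1..D}"
    then show "inner x (e n) = 0" using that[of "n - 1"] by auto
  qed
  \<comment> \<open>The spectrum is reindexed from 0; \<beta> is
    \<open>\<alpha>2 - \<alpha>1\<close>, and the coefficient of the logarithmic correction is
    \<open>c2 / c1\<close>.\<close>
  interpret power_law_operator T "\<lambda>n. e (Suc n)" "\<lambda>n. lam (Suc n)" lam c1 \<alpha>1 "\<alpha>2 - \<alpha>1" "c2 / c1"
  proof unfold_locales
    show "compact_operator T" by (rule cpt)
    show "inner (T x) y = inner x (T y)" for x y by (rule selfadj[rule_format])
    show "inner (e (Suc m)) (e (Suc n)) = (if m = n then 1 else 0)" for m n using e(2)[of "Suc m" "Suc n"] by simp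
    show "T (e (Suc n)) = lam (Suc n) *\<^sub>R e (Suc n)" for n by (rule e(1)) simp
    show "lam (Suc n) > 0" for n using lam_pos by simp
    show "lam (Suc n) \<le> lam (Suc m)" if "m \<le> n" for m n by (rule mono[OF that])
    show "norm (T x) \<le> lam (Suc D) * norm x" if "\<And>n. n < D \<Longrightarrow> inner x (e (Suc n)) = 0" for D x
      by (rule tail[OF that])
    show "c1 > 0" "\<alpha>1 > 0" by (rule c1_pos a1_pos)+
    show "0 \<le> \<alpha>2 - \<alpha>1" "\<alpha>2 - \<alpha>1 < 1 / 2" using ab by simp_all
    show "(\<lambda>n. lam n * real n powr \<alpha>1 / c1) \<longlonglongrightarrow> 1" by (rule ratio(1))
    show "(\<lambda>n. ln (lam n * real n powr \<alpha>1 / c1) * real n powr (\<alpha>2 - \<alpha>1)) \<longlonglongrightarrow> c2 / c1"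
      by (rule ratio(2))
  qed simp
  define N where "N eps = ln (real (covering_number eps K))" for eps
  have opN: "op_entropy eps T = N eps / ln 2" for eps
    by (simp add: op_entropy_def metric_entropy_def log_def N_def)
  have anti: "N e' \<le> N e" if "0 < e" "e \<le> e'" for e e'
    unfolding N_def using covering_number_antimono[OF compact_K that]
      covering_number_pos[OF compact_K K_nonempty] that by (subst ln_le_cancel_iff) auto
  have lim: "((\<lambda>x. (N (c1 * x powr - \<alpha>1) - \<alpha>1 * x) / x powr (1 - (\<alpha>2 - \<alpha>1))) \<longlongrightarrow>
      c2 / c1 / (1 - (\<alpha>2 - \<alpha>1))) at_top"
    unfolding N_def by (rule ln_covering_number_asymptotics)
  have ab': "\<alpha>2 < \<alpha>1 + 1" using ab by simp
  show ?thesis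
    unfolding entropy_number_def opN
    by (rule conjI[OF op_entropy_expansion[OF lim c1_pos a1_pos ab']
          entropy_number_expansion[OF anti lim c1_pos a1_pos ab(1) ab' c2]])
qed

end
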